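(* Let $R$ be a local Gorenstein ring and let $M$ be an $R$-module having minimal free resolution $\mathbb F:0\to F_3\xrightarrow{d_3}F_2\xrightarrow{d_2}F_1\xrightarrow{d_1}F_0$ of format $(2,4,4,2)$. The following conditions are equivalent: 1. $M$ is perfect. 2. The structure maps $w^{(3)}_1$, $w^{(1)}_1$, $w^{(2)}_{2,1}$ of $\mathbb F$ are invertible, where $w^{(3)}_1$ is regarded as a map $\bigwedge^3F_1\to F_2$, $w^{(1)}_1$ as a map $F_0^*\otimes\bigwedge^4F_1\to F_3$, and $w^{(2)}_{2,1}$ as a map $\bigwedge^4F_1\otimes F_1\otimes(\bigwedge^2F_3)^*\to F_2^*$.
   Context: Standing assumptions: $R$ is Noetherian, with infinite residue field and $\frac12\in R$. A module is perfect if its projective dimension equals the depth (grade) of its annihilator. Format $(2,4,4,2)$ means $\operatorname{rank}F_0,\operatorname{rank}F_1,\operatorname{rank}F_2,\operatorname{rank}F_3=2,4,4,2$. Let $u_1,u_2$ be a basis of $F_0$, $e_1,\dots,e_4$ of $F_1$, $f_1,\dots,f_4$ of $F_2$. Let $m_{ij}$ be the $2\times2$ minor of $d_1$ on columns $i,j$ (with $m_{ji}=-m_{ij}$). Identify $\bigwedge^2F_0=R$ by $u_1\wedge u_2=1$; for $v\in F_0$ and $c=\sum_j u_j\otimes g_j\in F_0\otimes F_3$ write $v\wedge c=\sum_j(v\wedge u_j)g_j\in F_3$. The structure maps are defined by choosing lifts (which exist) as follows; any fixed choice is allowed. Formulas hold with $e_1,\dots,e_4$ replaced by any permutation of them. Write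 $e_ie_je_k:=w^{(3)}_1(e_i\wedge e_j\wedge e_k)$ and $\varepsilon=e_1\wedge e_2\wedge e_3\wedge e_4$. - $w^{(3)}_1:\bigwedge^3F_1\to F_2$ satisfies $d_2(e_ie_je_k)=m_{ij}e_k-m_{ik}e_j+m_{jk}e_i$. - $w^{(2)}_1:\bigwedge^2F_1\otimes F_2\to F_3$ is the unique map with $d_3\big(w^{(2)}_1(e_i\wedge e_j\otimes f_h)\big)=m_{ij}f_h-w^{(3)}_1(d_2(f_h)\wedge e_i\wedge e_j)$. - $w^{(1)}_1:\bigwedge^4F_1\to F_0\otimes F_3$ is the unique map with $(1\otimes d_3)w^{(1)}_1(\varepsilon)=d_1(e_1)\otimes e_2e_3e_4-d_1(e_2)\otimes e_1e_3e_4+d_1(e_3)\otimes e_1e_2e_4-d_1(e_4)\otimes e_1e_2e_3$. - $w^{(2)}_{2,1}:\bigwedge^4F_1\otimes F_1\otimes F_2\to\bigwedge^2F_3$: $w^{(2)}_{2,1}(\varepsilon\otimes e_1\otimes f_h)$ is the lift, along the injection $\bigwedge^2F_3\to F_2\otimes F_3$, $a\wedge b\mapsto d_3(a)\otimes b-d_3(b)\otimes a$, of $e_1e_2e_3\otimes w^{(2)}_1(e_1\wedge e_4\otimes f_h)-e_1e_2e_4\otimes w^{(2)}_1(e_1\wedge e_3\otimes f_h)+e_1e_3e_4\otimes w^{(2)}_1(e_1\wedge e_2\otimes f_h)+f_h\otimes\big(d_1(e_1)\wedge w^{(1)}_1(\varepsilon)\big)$. *)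

theory Defs
  imports "HOL-Analysis.Analysis" "HOL-Library.Poly_Mapping" "HOL-Library.Extended_Nat"
begin

section \<open>Noetherian local rings, perfect modules, Gorenstein rings\<close>

text \<open>
  The ring is a type of class \<^class>\<open>comm_ring_1\<close>, regarded as a module over itself via
  multiplication; its ideals are the submodules. A module is a type with a scalar multiplication
  satisfying the library locale \<^locale>\<open>module\<close>.
\<close>

abbreviation ring_ideal :: "'a::comm_ring_1 set \<Rightarrow> bool" where
  "ring_ideal \<equiv> module.subspace ((*) :: 'a \<Rightarrow> 'a \<Rightarrow> 'a)"

abbreviation ideal_gen :: "'a::comm_ring_1 set \<Rightarrow> 'a set" where
  "ideal_gen \<equiv> module.span ((*) :: 'a \<Rightarrow> 'a \<Rightarrow> 'a)"

definition noetherian :: "'a::comm_ring_1 itself \<Rightarrow> bool" where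
  "noetherian _ \<longleftrightarrow> (\<forall>I::'a set. ring_ideal I \<longrightarrow> (\<exists>B. finite B \<and> I = ideal_gen B))"

definition maximal_ideal :: "'a::comm_ring_1 set \<Rightarrow> bool" where
  "maximal_ideal I \<longleftrightarrow> ring_ideal I \<and> I \<noteq> UNIV \<and>
     (\<forall>J. ring_ideal J \<and> I \<subseteq> J \<longrightarrow> J = I \<or> J = UNIV)"

definition local_ring :: "'a::comm_ring_1 set \<Rightarrow> bool" where
  "local_ring \<mm> \<longleftrightarrow> maximal_ideal \<mm> \<and> (\<forall>\<nn>. maximal_ideal \<nn> \<longrightarrow> \<nn> = \<mm>)"

definition residue_ring :: "'a::comm_ring_1 set \<Rightarrow> 'a set set" where
  "residue_ring \<mm> = UNIV // {(x, y). x - y \<in> \<mm>}"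

definition regular_sequence :: "'a::comm_ring_1 list \<Rightarrow> bool" where
  "regular_sequence xs \<longleftrightarrow> ideal_gen (set xs) \<noteq> UNIV \<and>
     (\<forall>i<length xs. \<forall>r. xs ! i * r \<in> ideal_gen (set (take i xs))
        \<longrightarrow> r \<in> ideal_gen (set (take i xs)))"

definition grade :: "'a::comm_ring_1 set \<Rightarrow> enat" where
  "grade I = Sup {enat (length xs) | xs. regular_sequence xs \<and> set xs \<subseteq> I}"

definition annihilator :: "('a::comm_ring_1 \<Rightarrow> 'm::ab_group_add \<Rightarrow> 'm) \<Rightarrow> 'a set" where
  "annihilator s = {a. \<forall>x. s a x = 0}"

definition linear_on :: "('a \<Rightarrow> 'b \<Rightarrow> 'b) \<Rightarrow> ('a \<Rightarrow> 'c \<Rightarrow> 'c) \<Rightarrow> 'b set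
    \<Rightarrow> ('b::ab_group_add \<Rightarrow> 'c::ab_group_add) \<Rightarrow> bool" where
  "linear_on s t A f \<longleftrightarrow>
     (\<forall>x\<in>A. \<forall>y\<in>A. f (x + y) = f x + f y) \<and> (\<forall>c. \<forall>x\<in>A. f (s c x) = t c (f x))"

text \<open>The type of finitely supported functions \<open>'i \<Rightarrow>\<^sub>0 'a\<close> is the free module on \<open>'i\<close>.\<close>

definition free_scale :: "'a::comm_ring_1 \<Rightarrow> ('i \<Rightarrow>\<^sub>0 'a) \<Rightarrow> ('i \<Rightarrow>\<^sub>0 'a)" where
  "free_scale c p = Poly_Mapping.map ((*) c) p"

text \<open>Projective modules are the direct summands of free modules.\<close>

definition projective :: "('i \<Rightarrow>\<^sub>0 'a::comm_ring_1) set \<Rightarrow> bool" where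
  "projective P \<longleftrightarrow> module.subspace free_scale P \<and>
     (\<exists>Q. module.subspace free_scale Q \<and> P \<inter> Q = {0} \<and> (\<forall>z. \<exists>x\<in>P. \<exists>y\<in>Q. z = x + y))"

text \<open>
  Projective resolutions \<open>0 \<rightarrow> P n \<rightarrow> \<dots> \<rightarrow> P 0 \<rightarrow> M \<rightarrow> 0\<close>. A module over \<open>'a\<close> carried by the type \<open>'m\<close>,
  and each of its successive syzygies, is generated by at most
  \<open>max |'a| |'m| \<aleph>\<^sub>0\<close> elements, which is the cardinality of
  \<open>('a + 'm) list\<close>; hence all the projective modules needed
  occur inside the free module on that type, for every module \<open>M\<close>.
\<close>

definition projective_dimension_le ::
    "('a::comm_ring_1 \<Rightarrow> 'm::ab_group_add \<Rightarrow> 'm) \<Rightarrow> nat \<Rightarrow> bool" where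
  "projective_dimension_le s n \<longleftrightarrow>
     (\<exists>(P :: nat \<Rightarrow> (('a + 'm) list \<Rightarrow>\<^sub>0 'a) set) \<delta> \<epsilon>.
        (\<forall>i. projective (P i)) \<and> (\<forall>i>n. P i = {0}) \<and>
        linear_on free_scale s (P 0) \<epsilon> \<and> \<epsilon> ` P 0 = UNIV \<and>
        (\<forall>i. linear_on free_scale free_scale (P (Suc i)) (\<delta> i)) \<and>
        \<delta> 0 ` P 1 = {x \<in> P 0. \<epsilon> x = 0} \<and>
        (\<forall>i. \<delta> (Suc i) ` P (Suc (Suc i)) = {x \<in> P (Suc i). \<delta> i x = 0}))"

definition projective_dimension ::
    "('a::comm_ring_1 \<Rightarrow> 'm::ab_group_add \<Rightarrow> 'm) \<Rightarrow> enat" where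
  "projective_dimension s = Inf {enat n | n. projective_dimension_le s n}"

definition perfect_module :: "('a::comm_ring_1 \<Rightarrow> 'm::ab_group_add \<Rightarrow> 'm) \<Rightarrow> bool" where
  "perfect_module s \<longleftrightarrow> projective_dimension s = grade (annihilator s)"

text \<open>
  Injectivity of a submodule \<open>J\<close>. Since one cannot quantify over the modules on all types,
  the extension property is required for maps defined on ideals
  (Baer's criterion: this is the extension property for all inclusions of modules).
\<close>

definition injective_module :: "('a::comm_ring_1 \<Rightarrow> 'e::ab_group_add \<Rightarrow> 'e) \<Rightarrow> 'e set \<Rightarrow> bool" where
  "injective_module t J \<longleftrightarrow> module.subspace t J \<and>
     (\<forall>I g. ring_ideal I \<and> linear_on (*) t I g \<and> g ` I \<subseteq> J \<longrightarrow>
        (\<exists>h. module_hom (*) t h \<and> h ` UNIV \<subseteq> J \<and> (\<forall>a\<in>I. h a = g a)))"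

text \<open>
  A Gorenstein local ring is a Noetherian local ring with a finite injective resolution
  \<open>0 \<rightarrow> R \<rightarrow> J 0 \<rightarrow> \<dots> \<rightarrow> J n \<rightarrow> 0\<close>. The modules \<open>J i\<close> are submodules of a module
  on a type \<open>'e\<close>, for instance of their direct sum. In a theorem that assumes this predicate with
  \<open>'e\<close> and \<open>t\<close> otherwise unconstrained, these are universally quantified over the theorem, so that
  the assumption amounts to the existence of such a resolution on some type.
\<close>

definition gorenstein_local_ring ::
    "('a::comm_ring_1 \<Rightarrow> 'e::ab_group_add \<Rightarrow> 'e) \<Rightarrow> 'a set \<Rightarrow> bool" where
  "gorenstein_local_ring t \<mm> \<longleftrightarrow> noetherian TYPE('a) \<and> local_ring \<mm> \<and> module t \<and>
     (\<exists>n (J :: nat \<Rightarrow> 'e set) \<delta> \<iota>.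
        (\<forall>i. injective_module t (J i)) \<and> (\<forall>i>n. J i = {0}) \<and>
        module_hom (*) t \<iota> \<and> inj \<iota> \<and> \<iota> ` UNIV = {x \<in> J 0. \<delta> 0 x = 0} \<and>
        (\<forall>i. linear_on t t (J i) (\<delta> i)) \<and>
        (\<forall>i. \<delta> i ` J i = {x \<in> J (Suc i). \<delta> (Suc i) x = 0}))"


section \<open>Minimal free resolutions of format (2,4,4,2)\<close>

text \<open>
  The free modules come with their chosen bases: \<open>F\<^sub>0 = F\<^sub>3 = 'a^2\<close> and \<open>F\<^sub>1 = F\<^sub>2 = 'a^4\<close>,
  so the differentials are matrices acting on column vectors, and \<open>\<pi> : F\<^sub>0 \<rightarrow> M\<close> is the
  augmentation.
\<close>

definition minimal_free_resolution_2442 ::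
    "'a::comm_ring_1 set \<Rightarrow> ('a \<Rightarrow> 'm::ab_group_add \<Rightarrow> 'm) \<Rightarrow> ('a^2 \<Rightarrow> 'm)
      \<Rightarrow> 'a^4^2 \<Rightarrow> 'a^4^4 \<Rightarrow> 'a^2^4 \<Rightarrow> bool" where
  "minimal_free_resolution_2442 \<mm> s \<pi> d1 d2 d3 \<longleftrightarrow>
     module_hom (*s) s \<pi> \<and> surj \<pi> \<and>
     {x. \<pi> x = 0} = (*v) d1 ` UNIV \<and>
     {x. d1 *v x = 0} = (*v) d2 ` UNIV \<and>
     {x. d2 *v x = 0} = (*v) d3 ` UNIV \<and>
     inj ((*v) d3) \<and>
     (\<forall>i j. d1 $ i $ j \<in> \<mm>) \<and> (\<forall>i j. d2 $ i $ j \<in> \<mm>) \<and> (\<forall>i j. d3 $ i $ j \<in> \<mm>)"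


section \<open>Exterior powers and tensor products of coordinate modules\<close>

abbreviation basis_vec :: "'n \<Rightarrow> 'a::comm_ring_1 ^ 'n" where
  "basis_vec i \<equiv> axis i 1"

text \<open>The submodule of \<open>'a^'i\<close> spanned by the basis vectors with index in \<open>X\<close>.\<close>

definition coord_sub :: "'i set \<Rightarrow> ('a::comm_ring_1 ^ 'i) set" where
  "coord_sub X = {z. \<forall>i. i \<notin> X \<longrightarrow> z $ i = 0}"

text \<open>
  The exterior algebra of \<open>'a^'n\<close> is \<open>'a^('n set)\<close>: the basis vector at \<open>S\<close> is
  the product of the \<open>basis_vec i\<close> for \<open>i\<close> in \<open>S\<close>, taken in increasing order. The order
  affects only the signs of these basis vectors; note that the numeral \<open>4\<close>
  denotes \<open>0\<close>, the least element of the type \<open>4\<close>.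
\<close>

definition ext_sign :: "'n::linorder set \<Rightarrow> 'n set \<Rightarrow> 'a::comm_ring_1" where
  "ext_sign A B = (- 1) ^ card {(a, b). a \<in> A \<and> b \<in> B \<and> b < a}"

definition ext_mult :: "'a::comm_ring_1 ^ ('n::{finite,linorder} set) \<Rightarrow> 'a ^ ('n set) \<Rightarrow> 'a ^ ('n set)" where
  "ext_mult \<omega> \<eta> = (\<chi> S. \<Sum>A\<in>Pow S. ext_sign A (S - A) * (\<omega> $ A) * (\<eta> $ (S - A)))"

definition ext_vec :: "'a::comm_ring_1 ^ 'n::{finite,linorder} \<Rightarrow> 'a ^ ('n set)" where
  "ext_vec x = (\<Sum>i\<in>UNIV. (x $ i) *s basis_vec {i})"

text \<open>\<open>wedge [x\<^sub>1, \<dots>, x\<^sub>k]\<close> is the product of \<open>x\<^sub>1, \<dots>, x\<^sub>k\<close> in the exterior algebra.\<close>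

definition wedge :: "('a::comm_ring_1 ^ 'n::{finite,linorder}) list \<Rightarrow> 'a ^ ('n set)" where
  "wedge xs = foldr (\<lambda>x. ext_mult (ext_vec x)) xs (basis_vec {})"

text \<open>
  Basis indices of the \<open>k\<close>-th exterior power; thus \<open>coord_sub (deg k)\<close> is the
  \<open>k\<close>-th exterior power of \<open>'a^'n\<close>.
\<close>

definition deg :: "nat \<Rightarrow> 'n set set" where
  "deg k = {S. card S = k}"

text \<open>
  The tensor product of \<open>'a^'m\<close> and \<open>'a^'n\<close> is \<open>'a^('m \<times> 'n)\<close>, and that of
  \<open>coord_sub X\<close> and \<open>coord_sub Y\<close> is \<open>coord_sub (X \<times> Y)\<close>.
\<close>

definition tensor :: "'a::comm_ring_1 ^ 'm \<Rightarrow> 'a ^ 'n \<Rightarrow> 'a ^ ('m \<times> 'n)" where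
  "tensor v w = (\<chi> p. v $ fst p * w $ snd p)"

text \<open>\<open>tensor_part c j\<close> is \<open>g\<^sub>j\<close> if \<open>c = \<Sum>j. basis_vec j \<otimes> g\<^sub>j\<close>.\<close>

definition tensor_part :: "'a::comm_ring_1 ^ ('m::finite \<times> 'n::finite) \<Rightarrow> 'm \<Rightarrow> 'a ^ 'n" where
  "tensor_part c j = (\<chi> i. c $ (j, i))"

definition id_tensor :: "'a::comm_ring_1 ^ 'n ^ 'p \<Rightarrow> 'a ^ ('m::finite \<times> 'n::finite) \<Rightarrow> 'a ^ ('m \<times> 'p::finite)" where
  "id_tensor d c = (\<Sum>j\<in>UNIV. tensor (basis_vec j) (d *v tensor_part c j))"

text \<open>A linear map between the submodules \<open>A\<close> and \<open>B\<close> that has a linear inverse.\<close>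

definition invertible_map :: "('a::comm_ring_1 ^ 'm) set \<Rightarrow> ('a ^ 'n) set
    \<Rightarrow> ('a ^ 'm \<Rightarrow> 'a ^ 'n) \<Rightarrow> bool" where
  "invertible_map A B f \<longleftrightarrow> linear_on (*s) (*s) A f \<and> f ` A \<subseteq> B \<and>
     (\<exists>g. linear_on (*s) (*s) B g \<and> g ` B \<subseteq> A \<and> (\<forall>x\<in>A. g (f x) = x) \<and> (\<forall>y\<in>B. f (g y) = y))"


section \<open>Structure maps\<close>

definition minor2 :: "'a::comm_ring_1 ^ 4 ^ 2 \<Rightarrow> 4 \<Rightarrow> 4 \<Rightarrow> 'a" where
  "minor2 d1 i j = det ((\<chi> r c. d1 $ r $ (if c = 1 then i else j)) :: 'a ^ 2 ^ 2)"

text \<open>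
  The product of two elements of \<open>F\<^sub>0\<close>, the second exterior power of \<open>F\<^sub>0\<close> being identified
  with \<open>'a\<close> by \<open>u\<^sub>1 \<and> u\<^sub>2 = 1\<close>.
\<close>

definition wedge_F0 :: "'a::comm_ring_1 ^ 2 \<Rightarrow> 'a ^ 2 \<Rightarrow> 'a" where
  "wedge_F0 v w = v $ 1 * w $ 2 - v $ 2 * w $ 1"

definition wedge_tensor :: "'a::comm_ring_1 ^ 2 \<Rightarrow> 'a ^ (2 \<times> 2) \<Rightarrow> 'a ^ 2" where
  "wedge_tensor v c = (\<Sum>j\<in>UNIV. wedge_F0 v (basis_vec j) *s tensor_part c j)"

definition structure_map_3_1 ::
    "'a::comm_ring_1 ^ 4 ^ 2 \<Rightarrow> 'a ^ 4 ^ 4 \<Rightarrow> ('a ^ (4 set) \<Rightarrow> 'a ^ 4) \<Rightarrow> bool" where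
  "structure_map_3_1 d1 d2 w31 \<longleftrightarrow> linear_on (*s) (*s) (coord_sub (deg 3)) w31 \<and>
     (\<forall>i j k. d2 *v w31 (wedge [basis_vec i, basis_vec j, basis_vec k]) =
        minor2 d1 i j *s basis_vec k - minor2 d1 i k *s basis_vec j + minor2 d1 j k *s basis_vec i)"

definition structure_map_2_1 ::
    "'a::comm_ring_1 ^ 4 ^ 2 \<Rightarrow> 'a ^ 4 ^ 4 \<Rightarrow> 'a ^ 2 ^ 4 \<Rightarrow> ('a ^ (4 set) \<Rightarrow> 'a ^ 4)
      \<Rightarrow> ('a ^ (4 set \<times> 4) \<Rightarrow> 'a ^ 2) \<Rightarrow> bool" where
  "structure_map_2_1 d1 d2 d3 w31 w21 \<longleftrightarrow>
     linear_on (*s) (*s) (coord_sub (deg 2 \<times> UNIV)) w21 \<and>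
     (\<forall>i j h. d3 *v w21 (tensor (wedge [basis_vec i, basis_vec j]) (basis_vec h)) =
        minor2 d1 i j *s basis_vec h
        - w31 (wedge [d2 *v basis_vec h, basis_vec i, basis_vec j]))"

definition structure_map_1_1 ::
    "'a::comm_ring_1 ^ 4 ^ 2 \<Rightarrow> 'a ^ 2 ^ 4 \<Rightarrow> ('a ^ (4 set) \<Rightarrow> 'a ^ 4)
      \<Rightarrow> ('a ^ (4 set) \<Rightarrow> 'a ^ (2 \<times> 2)) \<Rightarrow> bool" where
  "structure_map_1_1 d1 d3 w31 w11 \<longleftrightarrow> linear_on (*s) (*s) (coord_sub (deg 4)) w11 \<and>
     (\<forall>i j k l. distinct [i, j, k, l] \<longrightarrow>
        id_tensor d3 (w11 (wedge [basis_vec i, basis_vec j, basis_vec k, basis_vec l])) =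
          tensor (d1 *v basis_vec i) (w31 (wedge [basis_vec j, basis_vec k, basis_vec l]))
        - tensor (d1 *v basis_vec j) (w31 (wedge [basis_vec i, basis_vec k, basis_vec l]))
        + tensor (d1 *v basis_vec k) (w31 (wedge [basis_vec i, basis_vec j, basis_vec l]))
        - tensor (d1 *v basis_vec l) (w31 (wedge [basis_vec i, basis_vec j, basis_vec k])))"

text \<open>
  In the last structure map, \<open>\<iota>\<close> is the injection of the second exterior power of \<open>F\<^sub>3\<close> into
  \<open>F\<^sub>2 \<otimes> F\<^sub>3\<close>; the first two conditions determine it on that module.
\<close>

definition structure_map_2_21 ::
    "'a::comm_ring_1 ^ 4 ^ 2 \<Rightarrow> 'a ^ 2 ^ 4 \<Rightarrow> ('a ^ (4 set) \<Rightarrow> 'a ^ 4)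
      \<Rightarrow> ('a ^ (4 set \<times> 4) \<Rightarrow> 'a ^ 2) \<Rightarrow> ('a ^ (4 set) \<Rightarrow> 'a ^ (2 \<times> 2))
      \<Rightarrow> ('a ^ (4 set \<times> 4 \<times> 4) \<Rightarrow> 'a ^ (2 set)) \<Rightarrow> bool" where
  "structure_map_2_21 d1 d3 w31 w21 w11 w221 \<longleftrightarrow>
     linear_on (*s) (*s) (coord_sub (deg 4 \<times> UNIV \<times> UNIV)) w221 \<and>
     w221 ` coord_sub (deg 4 \<times> UNIV \<times> UNIV) \<subseteq> coord_sub (deg 2) \<and>
     (\<exists>\<iota> :: 'a ^ (2 set) \<Rightarrow> 'a ^ (4 \<times> 2).
        linear_on (*s) (*s) (coord_sub (deg 2)) \<iota> \<and>
        (\<forall>a b. \<iota> (wedge [a, b]) = tensor (d3 *v a) b - tensor (d3 *v b) a) \<and>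
        (\<forall>i j k l h. distinct [i, j, k, l] \<longrightarrow>
           \<iota> (w221 (tensor (wedge [basis_vec i, basis_vec j, basis_vec k, basis_vec l])
                     (tensor (basis_vec i) (basis_vec h)))) =
             tensor (w31 (wedge [basis_vec i, basis_vec j, basis_vec k]))
                    (w21 (tensor (wedge [basis_vec i, basis_vec l]) (basis_vec h)))
           - tensor (w31 (wedge [basis_vec i, basis_vec j, basis_vec l]))
                    (w21 (tensor (wedge [basis_vec i, basis_vec k]) (basis_vec h)))
           + tensor (w31 (wedge [basis_vec i, basis_vec k, basis_vec l]))
                    (w21 (tensor (wedge [basis_vec i, basis_vec j]) (basis_vec h)))
           + tensor (basis_vec h)
                    (wedge_tensor (d1 *v basis_vec i)
                       (w11 (wedge [basis_vec i, basis_vec j, basis_vec k, basis_vec l])))))"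


section \<open>Structure maps with dualised factors\<close>

text \<open>
  The dual of \<open>coord_sub X\<close> is again \<open>coord_sub X\<close>, in the coordinates of the dual basis.
  The map \<open>F\<^sub>0\<^sup>* \<otimes> \<And>\<^sup>4F\<^sub>1 \<rightarrow> F\<^sub>3\<close> sends \<open>\<phi> \<otimes> \<omega>\<close> to \<open>(\<phi> \<otimes> 1) (w11 \<omega>)\<close>.
\<close>

definition adjoint_1_1 :: "('a::comm_ring_1 ^ (4 set) \<Rightarrow> 'a ^ (2 \<times> 2))
    \<Rightarrow> 'a ^ (2 \<times> 4 set) \<Rightarrow> 'a ^ 2" where
  "adjoint_1_1 w11 z = (\<Sum>j\<in>UNIV. tensor_part (w11 (tensor_part z j)) j)"

text \<open>
  The map \<open>\<And>\<^sup>4F\<^sub>1 \<otimes> F\<^sub>1 \<otimes> (\<And>\<^sup>2F\<^sub>3)\<^sup>* \<rightarrow> F\<^sub>2\<^sup>*\<close> sends \<open>\<omega> \<otimes> x \<otimes> \<psi>\<close> to the functional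
  \<open>f \<mapsto> \<psi> (w221 (\<omega> \<otimes> x \<otimes> f))\<close>. Its value below is given by the coordinates in the
  basis dual to the basis \<open>f\<^sub>h\<close>.
\<close>

definition adjoint_2_21 :: "('a::comm_ring_1 ^ (4 set \<times> 4 \<times> 4) \<Rightarrow> 'a ^ (2 set))
    \<Rightarrow> 'a ^ (4 set \<times> 4 \<times> 2 set) \<Rightarrow> 'a ^ 4" where
  "adjoint_2_21 w221 z = (\<chi> h. \<Sum>S\<in>deg 4. \<Sum>k\<in>UNIV. \<Sum>T\<in>deg 2.
     z $ (S, k, T) * w221 (tensor (basis_vec S) (tensor (basis_vec k) (basis_vec h))) $ T)"

end

(*
  Perfect modules of format (2,4,4,2) are resolved by Buchsbaum-Rim complexes. The complex
  G : 0 -> F0^* -> (third exterior power of F1) -> F1 -> F0 attached to d1 maps to the given resolution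
  F by the identity on F0 and F1 and by w31 and w11. Multiplication by a maximal minor of d1 is homotopic
  to zero on G, and multiplication by an element of the annihilator of M is homotopic to zero on F; so a
  regular sequence of length 3 in either ideal kills the cohomology of the dual complex in degrees 0, 1, 2.
  Conversely, if 0 -> F3 -> F2 -> F1 -> F0 is exact then the ideal of maximal minors of F3 -> F2
  contains a regular sequence of length 3. If M is perfect, this shows that the dual of F is
  exact, that the maximal minors of d1 have grade 3, and that G is exact; hence F and G are isomorphic by
  minimality. If w11 is invertible, then the grade of the maximal minors of d1 is 3 because it is so for d3.
  Finally, transported to G, the pairing w221 becomes det(w11) times the identity matrix.
*)

theory Submission
  imports Defs
begin

section \<open>Regular elements in Noetherian rings\<close>

text \<open>Depth is treated without Ext or localisation. All complexes are fixed matrices over R,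
  and \<open>exact_mod J\<close> states exactness with coefficients in R/J, so an induction along a
  regular sequence changes only \<open>J\<close>. It runs both ways:
  \<open>exact_mod_homotopy\<close> gains a degree by spending an element,
  \<open>exact_mod_adjoin\<close> gives up a place of exactness to adjoin one. The matrices
  \<open>hodge4 c\<close> are skew-symmetric, so G is its own dual up to sign, and the same lemmas
  on cochain complexes serve the dual of F and G itself. The link between the two is
  \<open>transpose d1\<close>, the first map of both: once it is injective, McCoy's theorem makes
  the minors of \<open>d1\<close> a source of nonzerodivisors. Minimality enters through matrices 1
  + XY, where X has two columns and entries in \<open>\<mm>\<close>; their invertibility reduces to
  a 2 by 2 determinant. The map \<open>w221\<close> is known only through an injection built from
  \<open>d3\<close>, so its matrix is computed up to factors from \<open>d3\<close>, which are then
  cancelled. The scalar det(w11) appears because an alternating form in rank 2 is multiplied by the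
  determinant under a change of coordinates.\<close>

interpretation ring_module: module "(*) :: 'a::comm_ring_1 \<Rightarrow> 'a \<Rightarrow> 'a"
  by unfold_locales (simp_all add: algebra_simps)

(* scale_scale would be associativity of multiplication, oriented against mult.assoc. *)
declare ring_module.scale_scale [simp del]

lemma ring_ideal_mult_right: "ring_ideal J \<Longrightarrow> x \<in> J \<Longrightarrow> x * r \<in> J"
  using ring_module.subspace_scale[of J x r] by (simp add: mult.commute)

lemma ring_ideal_one: "ring_ideal J \<Longrightarrow> 1 \<in> J \<longleftrightarrow> J = UNIV"
  using ring_ideal_mult_right[of J 1] by auto

definition nonzerodivisor_mod :: "'a::comm_ring_1 set \<Rightarrow> 'a \<Rightarrow> bool" where
  "nonzerodivisor_mod J x \<longleftrightarrow> (\<forall>r. x * r \<in> J \<longrightarrow> r \<in> J)"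

definition colon :: "'a::comm_ring_1 set \<Rightarrow> 'a \<Rightarrow> 'a set" where
  "colon J a = {r. r * a \<in> J}"

text \<open>For ideals this is the equality (J : I) = J, that is, the vanishing of Hom(R/I,
  R/J).\<close>

definition faithful_mod :: "'a::comm_ring_1 set \<Rightarrow> 'a set \<Rightarrow> bool" where
  "faithful_mod J I \<longleftrightarrow> (\<forall>a. (\<forall>y\<in>I. a * y \<in> J) \<longrightarrow> a \<in> J)"

lemma ring_ideal_colon: "ring_ideal J \<Longrightarrow> ring_ideal (colon J a)"
  by (auto simp: ring_module.subspace_def colon_def distrib_right mult.assoc)

text \<open>The union of a nonempty chain is an ideal whose finitely many generators already lie in
  one member, so the union belongs to the chain and Zorn's lemma applies.\<close>

lemma noetherian_maximal:
  fixes F :: "'a::comm_ring_1 set set"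
  assumes "noetherian TYPE('a)" "F \<noteq> {}" "\<And>I. I \<in> F \<Longrightarrow> ring_ideal I"
  shows "\<exists>M\<in>F. \<forall>X\<in>F. M \<subseteq> X \<longrightarrow> X = M"
proof (rule subset_Zorn_nonempty)
  fix C assume C: "C \<noteq> {}" "subset.chain F C"
  have CF: "C \<subseteq> F" using C(2) by (simp add: subset.chain_def)
  have sub: "ring_ideal (\<Union>C)"
  proof (rule ring_module.subspaceI)
    show "0 \<in> \<Union>C" using C(1) CF assms(3) ring_module.subspace_0 by blast
  next
    fix x y assume "x \<in> \<Union>C" "y \<in> \<Union>C"
    then obtain X Y where "x \<in> X" "X \<in> C" "y \<in> Y" "Y \<in> C" by blast
    moreover have "X \<subseteq> Y \<or> Y \<subseteq> X"
      using C(2) calculation by (auto simp: subset.chain_def)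
    ultimately show "x + y \<in> \<Union>C"
      using CF assms(3) ring_module.subspace_add by (metis UnionI subsetD)
  next
    fix c x assume "x \<in> \<Union>C"
    then show "c * x \<in> \<Union>C" using CF assms(3) ring_module.subspace_scale by blast
  qed
  then obtain B where B: "finite B" "\<Union>C = ideal_gen B"
    using assms(1) unfolding noetherian_def by blast
  then have "B \<subseteq> \<Union>C" using ring_module.span_superset by blast
  then obtain X where X: "X \<in> C" "B \<subseteq> X"
    using finite_subset_Union_chain[OF B(1) _ C(1,2)] by metis
  have "ideal_gen B \<subseteq> X"
    using X CF assms(3) by (intro ring_module.span_minimal) auto
  then have "\<Union>C = X" using B X by blast
  then show "\<Union>C \<in> F" using X CF by blast
qed (use assms in simp)

text \<open>Among the proper ideals containing a nonunit \<open>x\<close> there is a maximal one; it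
  is a maximal ideal, hence equal to \<open>\<mm>\<close>.\<close>

lemma local_ring_unit:
  fixes \<mm> :: "'a::comm_ring_1 set"
  assumes "noetherian TYPE('a)" "local_ring \<mm>" "x \<notin> \<mm>"
  shows "\<exists>y. x * y = 1"
proof (rule ccontr)
  assume nu: "\<nexists>y. x * y = 1"
  let ?F = "{I. ring_ideal I \<and> I \<noteq> UNIV \<and> x \<in> I}"
  have "range (\<lambda>r. r * x) \<in> ?F"
  proof -
    have "ring_ideal (range (\<lambda>r. r * x))"
      by (rule ring_module.subspaceI)
         (auto simp: image_iff distrib_right[symmetric] mult.assoc[symmetric]
            intro: exI[of _ 0])
    moreover have "x \<in> range (\<lambda>r. r * x)" by (auto intro: range_eqI[of _ _ 1])
    moreover have "1 \<notin> range (\<lambda>r. r * x)" using nu by (metis imageE mult.commute)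
    ultimately show ?thesis by blast
  qed
  then have "\<exists>M\<in>?F. \<forall>X\<in>?F. M \<subseteq> X \<longrightarrow> X = M"
    by (intro noetherian_maximal[OF assms(1)]) auto
  then obtain M where M: "M \<in> ?F" "\<forall>X\<in>?F. M \<subseteq> X \<longrightarrow> X = M" by blast
  have "maximal_ideal M" unfolding maximal_ideal_def using M by blast
  then have "M = \<mm>" using assms(2) unfolding local_ring_def by blast
  then show False using M assms(3) by blast
qed

text \<open>If an element \<open>x\<close> avoiding \<open>Qs\<close> lies in the new prime
  \<open>P\<close>, it is corrected by a product that lies in \<open>I\<close> and in every member
  of \<open>Qs\<close> but not in \<open>P\<close>. Incomparability of the primes supplies the
  factors \<open>z Q\<close>, in \<open>Q\<close> but outside \<open>P\<close>.\<close>

lemma prime_avoidance: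
  fixes Qs :: "'a::comm_ring_1 set set"
  assumes "finite Qs" "ring_ideal I"
    and "\<And>Q. Q \<in> Qs \<Longrightarrow> ring_ideal Q \<and> Q \<noteq> UNIV \<and> (\<forall>x y. x * y \<in> Q \<longrightarrow> x \<in> Q \<or> y \<in> Q) \<and> \<not> I \<subseteq> Q"
    and "\<And>P Q. P \<in> Qs \<Longrightarrow> Q \<in> Qs \<Longrightarrow> P \<subseteq> Q \<Longrightarrow> P = Q"
  shows "\<exists>x\<in>I. \<forall>Q\<in>Qs. x \<notin> Q"
  using assms
proof (induction Qs)
  case empty
  then show ?case using ring_module.subspace_0[of I] by auto
next
  case (insert P Qs)
  have "\<exists>x\<in>I. \<forall>Q\<in>Qs. x \<notin> Q"
    using insert.prems by (intro insert.IH) auto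
  then obtain x where x: "x \<in> I" "\<forall>Q\<in>Qs. x \<notin> Q" by blast
  show ?case
  proof (cases "x \<in> P")
    case False
    then show ?thesis using x by auto
  next
    case True
    obtain y where y: "y \<in> I" "y \<notin> P" using insert.prems(2)[of P] by auto
    have P: "ring_ideal P" "1 \<notin> P" "\<And>x y. x * y \<in> P \<Longrightarrow> x \<in> P \<or> y \<in> P"
      using insert.prems(2)[of P] ring_ideal_one[of P] by auto
    have "\<forall>Q\<in>Qs. \<exists>z. z \<in> Q \<and> z \<notin> P" using insert.hyps(2) insert.prems(3)[of _ P] by blast
    then obtain z where z: "\<And>Q. Q \<in> Qs \<Longrightarrow> z Q \<in> Q \<and> z Q \<notin> P" by metis
    have "(\<Prod>Q\<in>Qs. z Q) \<notin> P" using insert.hyps(1) z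
      by (induction Qs) (use P in auto)
    then have np: "y * (\<Prod>Q\<in>Qs. z Q) \<notin> P" using P(3) y by blast
    have inQ: "y * (\<Prod>Q\<in>Qs. z Q) \<in> Q" if "Q \<in> Qs" for Q
    proof -
      have "(\<Prod>Q\<in>Qs. z Q) = z Q * (\<Prod>Q\<in>Qs - {Q}. z Q)"
        using that insert.hyps(1) by (simp add: prod.remove)
      moreover have "ring_ideal Q" using insert.prems(2)[of Q] that by auto
      ultimately show ?thesis
        using z[OF that] by (simp add: ring_ideal_mult_right ring_module.subspace_scale)
    qed
    have I: "x + y * (\<Prod>Q\<in>Qs. z Q) \<in> I"
      using x y insert.prems(1) by (simp add: ring_module.subspace_add ring_ideal_mult_right)
    have "x + y * (\<Prod>Q\<in>Qs. z Q) \<notin> P"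
      using np True P(1) ring_module.subspace_diff[of P "x + y * (\<Prod>Q\<in>Qs. z Q)" x] by auto
    moreover have "x + y * (\<Prod>Q\<in>Qs. z Q) \<notin> Q" if "Q \<in> Qs" for Q
      using inQ[OF that] x(2) that insert.prems(2)[of Q]
        ring_module.subspace_diff[of Q "x + y * (\<Prod>Q\<in>Qs. z Q)" "y * (\<Prod>Q\<in>Qs. z Q)"] by auto
    ultimately show ?thesis using I by blast
  qed
qed

text \<open>
  The zero divisors modulo \<open>J\<close> are the union of the maximal members of the family of the
  ideals \<open>colon J a\<close>, \<open>a \<notin> J\<close>; these are primes, and there are finitely many of them.
\<close>

lemma faithful_mod_nonzerodivisor:
  fixes J I :: "'a::comm_ring_1 set"
  assumes noeth: "noetherian TYPE('a)" and J: "ring_ideal J" and I: "ring_ideal I"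
    and faithful: "faithful_mod J I"
  shows "\<exists>x\<in>I. nonzerodivisor_mod J x"
proof -
  define A where "A = {a. a \<notin> J \<and> (\<forall>b. b \<notin> J \<longrightarrow> colon J a \<subseteq> colon J b \<longrightarrow> colon J b = colon J a)}"
  have AJ: "a \<notin> J" if "a \<in> A" for a using that by (simp add: A_def)
  have Amax: "colon J b = colon J a" if "a \<in> A" "b \<notin> J" "colon J a \<subseteq> colon J b" for a b
    using that by (simp add: A_def)
  have below: "\<exists>b\<in>A. colon J a \<subseteq> colon J b" if "a \<notin> J" for a
  proof -
    let ?F = "colon J ` {b. b \<notin> J \<and> colon J a \<subseteq> colon J b}"
    have "\<exists>M\<in>?F. \<forall>X\<in>?F. M \<subseteq> X \<longrightarrow> X = M"
      using that ring_ideal_colon[OF J] by (intro noetherian_maximal[OF noeth]) auto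
    then obtain b where b: "b \<notin> J" "colon J a \<subseteq> colon J b"
      "\<forall>X\<in>?F. colon J b \<subseteq> X \<longrightarrow> X = colon J b"
      by auto
    have "b \<in> A" unfolding A_def
    proof (intro CollectI conjI allI impI)
      fix c assume "c \<notin> J" "colon J b \<subseteq> colon J c"
      then show "colon J c = colon J b" using b(2,3) by auto
    qed (rule b(1))
    then show ?thesis using b(2) by blast
  qed
  \<comment> \<open>If \<open>y * a\<close> is not in \<open>J\<close>, then
    \<open>colon J (y * a)\<close> contains \<open>colon J a\<close>, so they agree by maximality;
    and \<open>x\<close> lies in the former.\<close>
  have prime: "x \<in> colon J a \<or> y \<in> colon J a" if "a \<in> A" "x * y \<in> colon J a" for a x y
  proof (cases "y \<in> colon J a")
    case False
    then have "y * a \<notin> J" by (simp add: colon_def)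
    moreover have "colon J a \<subseteq> colon J (y * a)"
    proof
      fix r assume "r \<in> colon J a"
      then have "y * (r * a) \<in> J" using ring_module.subspace_scale[OF J] by (simp add: colon_def)
      then show "r \<in> colon J (y * a)" by (simp add: colon_def ac_simps)
    qed
    ultimately have "colon J (y * a) = colon J a" using that(1) unfolding A_def by blast
    moreover have "x \<in> colon J (y * a)" using that(2) by (simp add: colon_def mult.assoc)
    ultimately show ?thesis by blast
  qed simp
  \<comment> \<open>A maximal ideal generated by finitely many elements of \<open>A\<close> contains
    all of \<open>A\<close>. Its generators \<open>B\<close> will account for all the primes, which
    gives finiteness.\<close>
  let ?G = "ideal_gen ` {B. finite B \<and> B \<subseteq> A}"
  have "\<exists>M\<in>?G. \<forall>X\<in>?G. M \<subseteq> X \<longrightarrow> X = M"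
    by (intro noetherian_maximal[OF noeth]) auto
  then obtain B where B: "finite B" "B \<subseteq> A"
    and Bmax: "\<forall>X\<in>?G. ideal_gen B \<subseteq> X \<longrightarrow> X = ideal_gen B"
    by auto
  have AB: "a \<in> ideal_gen B" if "a \<in> A" for a
  proof -
    have "ideal_gen (insert a B) \<in> ?G" using B that by auto
    moreover have "ideal_gen B \<subseteq> ideal_gen (insert a B)" by (rule ring_module.span_mono) auto
    ultimately have "ideal_gen (insert a B) = ideal_gen B" using Bmax by blast
    then show ?thesis using ring_module.span_base[of a "insert a B"] by simp
  qed
  \<comment> \<open>Otherwise a product \<open>p\<close> of elements of the \<open>colon J b\<close>
    outside the prime \<open>colon J a\<close> multiplies all of \<open>B\<close>, hence the ideal
    that it generates, hence \<open>a\<close>, into \<open>J\<close>; but \<open>p\<close> is not in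
    \<open>colon J a\<close>.\<close>
  have same: "\<exists>b\<in>B. colon J b = colon J a" if a: "a \<in> A" for a
  proof (rule ccontr)
    assume neq: "\<not> (\<exists>b\<in>B. colon J b = colon J a)"
    have "\<exists>r. r \<in> colon J b \<and> r \<notin> colon J a" if "b \<in> B" for b
    proof -
      have "b \<in> A" using that B(2) by blast
      then have "\<not> colon J b \<subseteq> colon J a" using Amax[of b a] AJ[OF a] neq that by metis
      then show ?thesis by blast
    qed
    then obtain r where r: "\<And>b. b \<in> B \<Longrightarrow> r b \<in> colon J b \<and> r b \<notin> colon J a" by metis
    define p where "p = (\<Prod>b\<in>B. r b)"
    have one: "1 \<notin> colon J a" using AJ[OF a] by (simp add: colon_def)
    have "p \<notin> colon J a" unfolding p_def using B(1) r
      by (induction B) (use prime[OF a] one in auto)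
    have pB: "p * b \<in> J" if "b \<in> B" for b
    proof -
      have "p = (\<Prod>b\<in>B - {b}. r b) * r b"
        unfolding p_def using that B(1) by (simp add: prod.remove mult.commute)
      then show ?thesis using r[OF that] ring_module.subspace_scale[OF J]
        by (auto simp: colon_def mult.assoc)
    qed
    have "ideal_gen B \<subseteq> {x. p * x \<in> J}"
    proof (rule ring_module.span_minimal)
      show "ring_ideal {x. p * x \<in> J}"
        using J by (auto simp: ring_module.subspace_def distrib_left mult.left_commute)
    qed (use pB in auto)
    then have "p * a \<in> J" using AB[OF a] by blast
    then show False using \<open>p \<notin> colon J a\<close> by (simp add: colon_def)
  qed
  have "\<exists>x\<in>I. \<forall>Q\<in>colon J ` B. x \<notin> Q"
  proof (rule prime_avoidance[OF _ I])
    show "finite (colon J ` B)" using B by simp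
  next
    fix Q assume "Q \<in> colon J ` B"
    then obtain b where b: "b \<in> B" "b \<in> A" "Q = colon J b" using B by blast
    then have "1 \<notin> Q" using AJ by (simp add: colon_def)
    moreover obtain y where y: "y \<in> I" "b * y \<notin> J"
      using AJ[OF b(2)] faithful unfolding faithful_mod_def by blast
    moreover have "y \<notin> Q" using y(2) b(3) by (simp add: colon_def mult.commute)
    moreover have "ring_ideal Q" using b(3) ring_ideal_colon[OF J] by simp
    moreover have "\<forall>x y. x * y \<in> Q \<longrightarrow> x \<in> Q \<or> y \<in> Q" using prime[OF b(2)] b(3) by simp
    ultimately show "ring_ideal Q \<and> Q \<noteq> UNIV \<and> (\<forall>x y. x * y \<in> Q \<longrightarrow> x \<in> Q \<or> y \<in> Q) \<and> \<not> I \<subseteq> Q"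
      by auto
  next
    fix P Q assume "P \<in> colon J ` B" "Q \<in> colon J ` B" "P \<subseteq> Q"
    moreover from this obtain a b where "P = colon J a" "a \<in> A" "Q = colon J b" "b \<in> A"
      using B(2) by auto
    ultimately show "P = Q" using Amax[of a b] AJ[of b] by simp
  qed
  then obtain x where x: "x \<in> I" "\<forall>b\<in>B. x \<notin> colon J b" by auto
  have "nonzerodivisor_mod J x"
    unfolding nonzerodivisor_mod_def
  proof (intro allI impI, rule ccontr)
    fix a assume "x * a \<in> J" "a \<notin> J"
    then obtain b where "b \<in> A" "colon J a \<subseteq> colon J b" "x \<in> colon J a"
      using below[of a] by (force simp: colon_def)
    moreover from this(1) obtain c where "c \<in> B" "colon J c = colon J b" using same by blast
    ultimately show False using x(2) by blast
  qed
  then show ?thesis using x(1) by blast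
qed

section \<open>Regular sequences relative to an ideal\<close>

definition adjoin :: "'a::comm_ring_1 set \<Rightarrow> 'a \<Rightarrow> 'a set" where
  "adjoin J x = {r. \<exists>k. r - k * x \<in> J}"

text \<open>The recursion moves the ideal instead of an index, which suits induction with the ideal
  arbitrary; properness of the final ideal is kept apart.\<close>

fun regular_mod :: "'a::comm_ring_1 set \<Rightarrow> 'a list \<Rightarrow> bool" where
  "regular_mod J [] \<longleftrightarrow> True"
| "regular_mod J (x # xs) \<longleftrightarrow> nonzerodivisor_mod J x \<and> regular_mod (adjoin J x) xs"

lemma adjoin_ideal_gen: "adjoin (ideal_gen S) x = ideal_gen (insert x S)"
  by (simp add: adjoin_def ring_module.span_insert)

lemma ring_ideal_adjoin:
  assumes "ring_ideal J" shows "ring_ideal (adjoin J x)"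
proof -
  have "ideal_gen J = J" using assms by simp
  then show ?thesis using adjoin_ideal_gen[of J x] ring_module.subspace_span by metis
qed

lemma regular_sequence_iff:
  "regular_sequence xs \<longleftrightarrow> ideal_gen (set xs) \<noteq> UNIV \<and> regular_mod {0} xs"
proof -
  \<comment> \<open>Generalised over the elements \<open>ys\<close> already adjoined, since the
    recursion moves the head of \<open>xs\<close> to the end of \<open>ys\<close>.\<close>
  have gen: "regular_mod (ideal_gen (set ys)) xs \<longleftrightarrow>
      (\<forall>i<length xs. nonzerodivisor_mod (ideal_gen (set (ys @ take i xs))) (xs ! i))" for ys
  proof (induction xs arbitrary: ys)
    case (Cons x xs)
    have "regular_mod (adjoin (ideal_gen (set ys)) x) xs \<longleftrightarrow>
        regular_mod (ideal_gen (set (ys @ [x]))) xs"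
      by (simp add: adjoin_ideal_gen)
    then show ?case using Cons[of "ys @ [x]"]
      by (simp add: All_less_Suc2)
  qed simp
  show ?thesis
    using gen[of "[]"] by (simp add: regular_sequence_def nonzerodivisor_mod_def)
qed

section \<open>Exactness modulo an ideal\<close>

definition vec_in :: "'a set \<Rightarrow> 'a ^ 'n \<Rightarrow> bool" where
  "vec_in J v \<longleftrightarrow> (\<forall>i. v $ i \<in> J)"

text \<open>Exactness at the middle term over R/J, written with vectors over R. Only the inclusion
  of the kernel in the image is demanded; that the composition vanishes is stated separately where
  it is used.\<close>

definition exact_mod :: "'a::comm_ring_1 set \<Rightarrow> 'a ^ 'p ^ 'q \<Rightarrow> 'a ^ 'q ^ 'r \<Rightarrow> bool" where
  "exact_mod J B D \<longleftrightarrow> (\<forall>v. vec_in J (D *v v) \<longrightarrow> (\<exists>u. vec_in J (v - B *v u)))"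

lemma matrix_vector_mult_smult: "A *v (c *s v) = c *s (A *v v)"
  for A :: "'a::comm_semiring_1 ^ 'n ^ 'm"
  by (simp add: vec_eq_iff matrix_vector_mult_def sum_distrib_left mult.left_commute)

lemma vec_in_zero [simp]: "vec_in {0} v \<longleftrightarrow> v = 0"
  by (simp add: vec_in_def vec_eq_iff)

lemma vec_in_0: "ring_ideal J \<Longrightarrow> vec_in J 0"
  by (simp add: vec_in_def ring_module.subspace_0)

lemma vec_in_add: "ring_ideal J \<Longrightarrow> vec_in J v \<Longrightarrow> vec_in J w \<Longrightarrow> vec_in J (v + w)"
  by (simp add: vec_in_def ring_module.subspace_add)

lemma vec_in_diff: "ring_ideal J \<Longrightarrow> vec_in J v \<Longrightarrow> vec_in J w \<Longrightarrow> vec_in J (v - w)"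
  by (simp add: vec_in_def ring_module.subspace_diff)

lemma vec_in_mult: "ring_ideal J \<Longrightarrow> vec_in J v \<Longrightarrow> vec_in J (A *v v)"
  by (simp add: vec_in_def matrix_vector_mult_def ring_module.subspace_sum ring_module.subspace_scale)

lemma vec_in_smult: "ring_ideal J \<Longrightarrow> vec_in J v \<Longrightarrow> vec_in J (c *s v)"
  by (simp add: vec_in_def ring_module.subspace_scale)

lemma vec_in_matrix:
  "ring_ideal J \<Longrightarrow> \<forall>i j. A $ i $ j \<in> J \<Longrightarrow> vec_in J (A *v v)"
  by (simp add: vec_in_def matrix_vector_mult_def ring_module.subspace_sum ring_ideal_mult_right)

lemma vec_in_adjoin:
  fixes v :: "'a::comm_ring_1 ^ 'n"
  shows "vec_in (adjoin J x) v \<longleftrightarrow> (\<exists>w. vec_in J (v - x *s w))"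
proof
  assume "vec_in (adjoin J x) v"
  then have "\<forall>i. \<exists>k. v $ i - k * x \<in> J" by (simp add: vec_in_def adjoin_def)
  then obtain k where "\<forall>i. v $ i - k i * x \<in> J" by metis
  then have "vec_in J (v - x *s (\<chi> i. k i))" by (simp add: vec_in_def mult.commute)
  then show "\<exists>w. vec_in J (v - x *s w)" ..
next
  assume "\<exists>w. vec_in J (v - x *s w)"
  then show "vec_in (adjoin J x) v" by (fastforce simp: vec_in_def adjoin_def mult.commute)
qed

lemma vec_in_nonzerodivisor: "nonzerodivisor_mod J x \<Longrightarrow> vec_in J (x *s v) \<Longrightarrow> vec_in J v"
  by (simp add: vec_in_def nonzerodivisor_mod_def)

lemma exact_mod_zero:
  "exact_mod {0} B D \<longleftrightarrow> (\<forall>v. D *v v = 0 \<longrightarrow> (\<exists>u. v = B *v u))"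
  by (simp add: exact_mod_def)

text \<open>A piece of the long exact sequence of 0 -> R/J -> R/J -> R/(J, x) -> 0. If
  \<open>D v\<close> is \<open>x w\<close> modulo \<open>J\<close>, then \<open>C w\<close> vanishes
  modulo \<open>J\<close> because \<open>x\<close> can be cancelled; so \<open>w\<close> is some
  \<open>D u\<close>, and \<open>v - x u\<close> is a cycle modulo \<open>J\<close>.\<close>

lemma exact_mod_adjoin:
  fixes D :: "'a::comm_ring_1 ^ 'q ^ 'r" and C :: "'a ^ 'r ^ 's"
  assumes J: "ring_ideal J" and x: "nonzerodivisor_mod J x"
    and BD: "exact_mod J B D" and DC: "exact_mod J D C" and CD: "C ** D = 0"
  shows "exact_mod (adjoin J x) B D"
  unfolding exact_mod_def
proof (intro allI impI)
  fix v assume "vec_in (adjoin J x) (D *v v)"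
  then obtain w where w: "vec_in J (D *v v - x *s w)" unfolding vec_in_adjoin by blast
  have CDv: "C *v (D *v v) = 0" using CD by (simp add: matrix_vector_mul_assoc)
  have "vec_in J (C *v (D *v v - x *s w))" by (rule vec_in_mult[OF J w])
  then have "vec_in J (0 - x *s (C *v w))"
    by (simp only: matrix_vector_mult_diff_distrib CDv matrix_vector_mult_smult)
  from vec_in_diff[OF J vec_in_0[OF J] this] have "vec_in J (x *s (C *v w))" by simp
  then have "vec_in J (C *v w)" by (rule vec_in_nonzerodivisor[OF x])
  then obtain u where u: "vec_in J (w - D *v u)" using DC unfolding exact_mod_def by blast
  have "vec_in J ((D *v v - x *s w) + x *s (w - D *v u))"
    by (intro vec_in_add[OF J w] vec_in_smult[OF J u])
  moreover have "(D *v v - x *s w) + x *s (w - D *v u) = D *v (v - x *s u)"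
    by (simp add: matrix_vector_mult_diff_distrib matrix_vector_mult_smult vector_ssub_ldistrib)
  ultimately obtain t where t: "vec_in J (v - x *s u - B *v t)"
    using BD unfolding exact_mod_def by metis
  have "vec_in J ((v - B *v t) - x *s u)" using t by (simp add: algebra_simps)
  then show "\<exists>t. vec_in (adjoin J x) (v - B *v t)" unfolding vec_in_adjoin by blast
qed

lemma mat_vector_mult: "mat x *v v = x *s (v :: 'a::comm_ring_1 ^ 'n)"
  by (simp add: vec_eq_iff matrix_vector_mult_def mat_def if_distrib[of "\<lambda>y. y * _"] cong: if_cong)

text \<open>
  Multiplication by \<open>x\<close> is injective on \<open>R/J\<close> but zero on the cohomology with coefficients in
  \<open>R/J\<close>; so the connecting map onto the latter from the cohomology with
  coefficients in \<open>R/(J, x)\<close>, one degree lower, is surjective.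
\<close>

lemma exact_mod_homotopy:
  fixes D :: "'a::comm_ring_1 ^ 'q ^ 'r" and D' :: "'a ^ 'r ^ 's"
  assumes J: "ring_ideal J" and x: "nonzerodivisor_mod J x"
    and E: "exact_mod (adjoin J x) E D" and DE: "D ** E = 0"
    and hom: "D ** h + k ** D' = mat x"
  shows "exact_mod J D D'"
  unfolding exact_mod_def
proof (intro allI impI)
  fix \<phi> assume \<phi>: "vec_in J (D' *v \<phi>)"
  \<comment> \<open>Modulo \<open>J\<close> the homotopy gives \<open>D \<psi> = x \<phi>\<close>,
    so \<open>\<psi>\<close> is a cycle modulo \<open>(J, x)\<close>, hence of the form
    \<open>E \<theta> + x \<eta>\<close>. Applying \<open>D\<close> and cancelling \<open>x\<close>
    exhibits \<open>\<phi>\<close> as \<open>D \<eta>\<close>.\<close>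
  define \<psi> where "\<psi> = h *v \<phi>"
  have "x *s \<phi> = (D ** h + k ** D') *v \<phi>" by (simp add: hom mat_vector_mult)
  also have "\<dots> = D *v \<psi> + k *v (D' *v \<phi>)"
    by (simp add: \<psi>_def matrix_vector_mult_add_rdistrib matrix_vector_mul_assoc)
  finally have eq: "x *s \<phi> = D *v \<psi> + k *v (D' *v \<phi>)" .
  have k: "vec_in J (k *v (D' *v \<phi>))" by (rule vec_in_mult[OF J \<phi>])
  have "vec_in (adjoin J x) (D *v \<psi>)"
    unfolding vec_in_adjoin
  proof (intro exI)
    show "vec_in J (D *v \<psi> - x *s \<phi>)"
      using vec_in_diff[OF J vec_in_0[OF J] k] by (simp add: eq)
  qed
  then obtain \<theta> where "vec_in (adjoin J x) (\<psi> - E *v \<theta>)"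
    using E unfolding exact_mod_def by blast
  then obtain \<eta> where \<eta>: "vec_in J (\<psi> - E *v \<theta> - x *s \<eta>)" unfolding vec_in_adjoin by blast
  have "D *v (E *v \<theta>) = 0" using DE by (simp add: matrix_vector_mul_assoc)
  then have "x *s (\<phi> - D *v \<eta>) = k *v (D' *v \<phi>) + D *v (\<psi> - E *v \<theta> - x *s \<eta>)"
    by (simp add: eq vector_ssub_ldistrib matrix_vector_mult_diff_distrib matrix_vector_mult_smult)
  moreover have "vec_in J (k *v (D' *v \<phi>) + D *v (\<psi> - E *v \<theta> - x *s \<eta>))"
    by (intro vec_in_add[OF J k] vec_in_mult[OF J \<eta>])
  ultimately have "vec_in J (x *s (\<phi> - D *v \<eta>))" by simp
  then show "\<exists>\<eta>. vec_in J (\<phi> - D *v \<eta>)" using vec_in_nonzerodivisor[OF x] by blast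
qed

text \<open>The lowest degree: a zero matrix as incoming map encodes injectivity modulo
  \<open>J\<close>, whatever its number of columns.\<close>

lemma exact_mod_homotopy_0:
  fixes D :: "'a::comm_ring_1 ^ 'q ^ 'r"
  assumes J: "ring_ideal J" and x: "nonzerodivisor_mod J x" and hom: "k ** D = mat x"
  shows "exact_mod J (0 :: 'a ^ 'p ^ 'q) D"
  unfolding exact_mod_def
proof (intro allI impI)
  fix v assume "vec_in J (D *v v)"
  then have "vec_in J (k *v (D *v v))" by (rule vec_in_mult[OF J])
  then have "vec_in J (x *s v)" by (simp add: matrix_vector_mul_assoc hom mat_vector_mult)
  then have "vec_in J v" by (rule vec_in_nonzerodivisor[OF x])
  then show "\<exists>u. vec_in J (v - (0 :: 'a ^ 'p ^ 'q) *v u)" by simp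
qed

text \<open>A contraction of multiplication by \<open>x\<close> in degrees 0, 1 and 2 of a cochain
  complex that starts with \<open>D0\<close>. The equation in degree 3 would be
  \<open>D2 ** l = mat x\<close>; it is required only in \<open>regular_mod_exact_3\<close>.\<close>

definition null_homotopic ::
  "'a::comm_ring_1 ^ 'n ^ 'p \<Rightarrow> 'a ^ 'p ^ 'q \<Rightarrow> 'a ^ 'q ^ 'r \<Rightarrow> 'a \<Rightarrow> bool" where
  "null_homotopic D0 D1 D2 x \<longleftrightarrow> (\<exists>h k l. h ** D0 = mat x \<and> D0 ** h + k ** D1 = mat x
     \<and> D1 ** k + l ** D2 = mat x)"

section \<open>Vanishing of cohomology from homotopies and regular sequences\<close>

context
  fixes D0 :: "'a::comm_ring_1 ^ 'n ^ 'p" and D1 :: "'a ^ 'p ^ 'q" and D2 :: "'a ^ 'q ^ 'r"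
    and I :: "'a set"
  assumes complex: "D1 ** D0 = 0" "D2 ** D1 = 0"
    and homotopy: "\<And>x. x \<in> I \<Longrightarrow> null_homotopic D0 D1 D2 x"
begin

lemma regular_mod_exact_0:
  assumes "ring_ideal J" "regular_mod J xs" "set xs \<subseteq> I" "length xs \<ge> 1"
  shows "exact_mod J (0 :: 'a ^ 'm ^ 'n) D0"
proof -
  obtain x ys where xs: "xs = x # ys" using assms(4) by (cases xs) auto
  obtain h where "h ** D0 = mat x" 
    using homotopy[of x] assms(3) xs unfolding null_homotopic_def by auto
  then show ?thesis using assms xs by (intro exact_mod_homotopy_0[of J x]) auto
qed

text \<open>Here and in the next degrees the first element \<open>x\<close> provides the homotopy,
  while the remaining elements give exactness one degree lower modulo \<open>(J, x)\<close>.\<close>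

lemma regular_mod_exact_1:
  assumes "ring_ideal J" "regular_mod J xs" "set xs \<subseteq> I" "length xs \<ge> 2"
  shows "exact_mod J D0 D1"
proof -
  obtain x ys where xs: "xs = x # ys" using assms(4) by (cases xs) auto
  obtain h k where hk: "D0 ** h + k ** D1 = mat x"
    using homotopy[of x] assms(3) xs unfolding null_homotopic_def by auto
  have "exact_mod (adjoin J x) (0 :: 'a ^ 'n ^ 'n) D0"
    using assms xs by (intro regular_mod_exact_0[of _ ys] ring_ideal_adjoin) auto
  then show ?thesis
    using assms xs hk by (intro exact_mod_homotopy[of J x 0]) (auto simp: matrix_matrix_mult_def zero_vec_def)
qed

lemma regular_mod_exact_2:
  assumes "ring_ideal J" "regular_mod J xs" "set xs \<subseteq> I" "length xs \<ge> 3"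
  shows "exact_mod J D1 D2"
proof -
  obtain x ys where xs: "xs = x # ys" using assms(4) by (cases xs) auto
  obtain k l where kl: "D1 ** k + l ** D2 = mat x"
    using homotopy[of x] assms(3) xs unfolding null_homotopic_def by auto
  have "exact_mod (adjoin J x) D0 D1"
    using assms xs by (intro regular_mod_exact_1[of _ ys] ring_ideal_adjoin) auto
  then show ?thesis
    using assms xs kl complex by (intro exact_mod_homotopy[of J x D0]) auto
qed

lemma regular_mod_exact_3:
  assumes "ring_ideal J" "regular_mod J xs" "set xs \<subseteq> I" "length xs \<ge> 4"
    and "\<And>x. x \<in> I \<Longrightarrow> \<exists>l. D2 ** l = mat x"
  shows "exact_mod J D2 (0 :: 'a ^ 'r ^ 'm)"
proof -
  obtain x ys where xs: "xs = x # ys" using assms(4) by (cases xs) auto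
  obtain l where l: "D2 ** l = mat x" using assms(3,5) xs by auto
  have "exact_mod (adjoin J x) D1 D2"
    using assms xs by (intro regular_mod_exact_2[of _ ys] ring_ideal_adjoin) auto
  then show ?thesis
    using assms xs l complex 
    by (intro exact_mod_homotopy[of J x D1 D2 l 0]) (auto simp: matrix_matrix_mult_def zero_vec_def)
qed

end

text \<open>McCoy's theorem for two columns. If \<open>a\<close> multiplies all minors into
  \<open>J\<close>, then \<open>X\<close> sends the vector with entries \<open>a * X $ s $ 2\<close>
  and \<open>- a * X $ s $ 1\<close> to zero modulo \<open>J\<close>, so \<open>a\<close> multiplies
  the first column into \<open>J\<close>; then \<open>X\<close> sends \<open>a\<close> times the
  first basis vector to zero as well.\<close>

lemma minors_faithful_mod:
  fixes X :: "'a::comm_ring_1 ^ 2 ^ 'n"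
  assumes J: "ring_ideal J" and X: "exact_mod J (0 :: 'a ^ 'm ^ 2) X"
    and I: "\<And>r s. X $ r $ 1 * X $ s $ 2 - X $ r $ 2 * X $ s $ 1 \<in> I"
  shows "faithful_mod J I"
  unfolding faithful_mod_def
proof (intro allI impI)
  fix a assume a: "\<forall>y\<in>I. a * y \<in> J"
  have inj: "vec_in J v" if "vec_in J (X *v v)" for v
    using X that by (simp add: exact_mod_def)
  have row: "a * X $ s $ 1 \<in> J" for s
  proof -
    let ?v = "(\<chi> c. if c = 1 then a * X $ s $ 2 else - (a * X $ s $ 1)) :: 'a ^ 2"
    have "X *v ?v = (\<chi> r. a * (X $ r $ 1 * X $ s $ 2 - X $ r $ 2 * X $ s $ 1))"
      by (simp add: vec_eq_iff matrix_vector_mult_def sum_2 algebra_simps)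
    then have "vec_in J (X *v ?v)" using a I by (simp add: vec_in_def)
    then have "vec_in J ?v" by (rule inj)
    then have "?v $ 2 \<in> J" unfolding vec_in_def by blast
    then show ?thesis using ring_module.subspace_neg[OF J] by fastforce
  qed
  let ?v = "(\<chi> c. if c = 1 then a else 0) :: 'a ^ 2"
  have "vec_in J (X *v ?v)"
    using row by (simp add: vec_in_def matrix_vector_mult_def sum_2 mult.commute)
  then have "vec_in J ?v" by (rule inj)
  then show "a \<in> J" by (auto simp: vec_in_def dest: spec[of _ 1])
qed

text \<open>Each adjoined nonzerodivisor costs one place of exactness on the right, but
  \<open>D3\<close> stays injective modulo 0, \<open>(x)\<close> and \<open>(x, y)\<close>, enough
  for three choices. The ideal enters only through \<open>faithful\<close>, so it may consist of
  minors of a matrix other than \<open>D3\<close>.\<close>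

lemma regular_sequence_of_exact:
  fixes D3 :: "'a::comm_ring_1 ^ 'p ^ 'q" and D2 :: "'a ^ 'q ^ 'r" and D1 :: "'a ^ 'r ^ 's"
  assumes noeth: "noetherian TYPE('a)" and I: "ring_ideal I" "I \<noteq> UNIV"
    and exact: "exact_mod {0} (0 :: 'a ^ 'p ^ 'p) D3" "exact_mod {0} D3 D2" "exact_mod {0} D2 D1"
    and complex: "D2 ** D3 = 0" "D1 ** D2 = 0"
    and faithful: "\<And>J. ring_ideal J \<Longrightarrow> exact_mod J (0 :: 'a ^ 'p ^ 'p) D3 \<Longrightarrow> faithful_mod J I"
  shows "\<exists>x y z. regular_sequence [x, y, z] \<and> {x, y, z} \<subseteq> I"
proof -
  have J0: "ring_ideal {0::'a}" by simp
  obtain x where x: "x \<in> I" "nonzerodivisor_mod {0} x"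
    using faithful_mod_nonzerodivisor[OF noeth J0 I(1) faithful[OF J0 exact(1)]] by blast
  have J1: "ring_ideal (adjoin {0} x)" by (rule ring_ideal_adjoin[OF J0])
  have e1: "exact_mod (adjoin {0} x) (0 :: 'a ^ 'p ^ 'p) D3"
    by (rule exact_mod_adjoin[OF J0 x(2) exact(1,2) complex(1)])
  have e2: "exact_mod (adjoin {0} x) D3 D2"
    by (rule exact_mod_adjoin[OF J0 x(2) exact(2,3) complex(2)])
  obtain y where y: "y \<in> I" "nonzerodivisor_mod (adjoin {0} x) y"
    using faithful_mod_nonzerodivisor[OF noeth J1 I(1) faithful[OF J1 e1]] by blast
  have J2: "ring_ideal (adjoin (adjoin {0} x) y)" by (rule ring_ideal_adjoin[OF J1])
  have e3: "exact_mod (adjoin (adjoin {0} x) y) (0 :: 'a ^ 'p ^ 'p) D3"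
    by (rule exact_mod_adjoin[OF J1 y(2) e1 e2 complex(1)])
  obtain z where z: "z \<in> I" "nonzerodivisor_mod (adjoin (adjoin {0} x) y) z"
    using faithful_mod_nonzerodivisor[OF noeth J2 I(1) faithful[OF J2 e3]] by blast
  have "ideal_gen {x, y, z} \<subseteq> I" using x y z I(1) by (intro ring_module.span_minimal) auto
  then have "regular_sequence [x, y, z]"
    using x y z I(2) by (auto simp: regular_sequence_iff)
  then show ?thesis using x y z by blast
qed

section \<open>Invertible matrices over a local ring\<close>

lemma local_ring_ideal:
  assumes "local_ring \<mm>" shows "ring_ideal \<mm>" "\<mm> \<noteq> UNIV" "1 \<notin> \<mm>"
  using assms ring_ideal_one[of \<mm>] by (auto simp: local_ring_def maximal_ideal_def)

lemma two_by_two_inverse: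
  fixes A :: "'a::comm_ring_1 ^ 2 ^ 2"
  assumes "det A * u = 1"
  shows "invertible A"
proof -
  let ?B = "(\<chi> i j. u * (if i = 1 then if j = 1 then A $ 2 $ 2 else - A $ 1 $ 2
     else if j = 1 then - A $ 2 $ 1 else A $ 1 $ 1)) :: 'a ^ 2 ^ 2"
  have d: "(A $ 1 $ 1 * A $ 2 $ 2 - A $ 1 $ 2 * A $ 2 $ 1) * u = 1"
    using assms by (simp add: det_2)
  have "A ** ?B = mat 1" "?B ** A = mat 1"
    using d by (simp_all add: vec_eq_iff forall_2 matrix_matrix_mult_def sum_2 mat_def algebra_simps)
  then show ?thesis unfolding invertible_def by blast
qed

lemma two_by_two_right_inverse:
  fixes A :: "'a::comm_ring_1 ^ 2 ^ 2"
  assumes "A ** B = mat 1" shows "invertible A"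
proof -
  have "det A * det B = det (A ** B)" by (simp add: det_mul)
  also have "\<dots> = 1" using assms by simp
  finally show ?thesis by (rule two_by_two_inverse)
qed

text \<open>
  Here \<open>1 + XY\<close> is inverted by means of the inverse of the smaller matrix \<open>1 + YX\<close>.
\<close>

lemma invertible_one_plus:
  fixes X :: "'a::comm_ring_1 ^ 2 ^ 'n" and Y :: "'a ^ 'n ^ 2"
  assumes noeth: "noetherian TYPE('a)" and loc: "local_ring \<mm>" and X: "\<forall>i j. X $ i $ j \<in> \<mm>"
  shows "invertible (mat 1 + X ** Y)"
proof -
  have \<mm>: "ring_ideal \<mm>" "1 \<notin> \<mm>" using local_ring_ideal[OF loc] by auto
  define Z where "Z = Y ** X"
  have Z: "Z $ i $ j \<in> \<mm>" for i j
    using X \<mm> by (simp add: Z_def matrix_matrix_mult_def ring_module.subspace_sum ring_module.subspace_scale)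
  have "det (mat 1 + Z) - 1 = Z $ 1 $ 1 + Z $ 2 $ 2 + Z $ 1 $ 1 * Z $ 2 $ 2 - Z $ 1 $ 2 * Z $ 2 $ 1"
    by (simp add: det_2 mat_def algebra_simps)
  also have "\<dots> \<in> \<mm>"
    using Z \<mm> by (intro ring_module.subspace_add ring_module.subspace_diff ring_module.subspace_scale)
  finally have "det (mat 1 + Z) \<notin> \<mm>"
    using \<mm> ring_module.subspace_diff[of \<mm> "det (mat 1 + Z)" "det (mat 1 + Z) - 1"] by auto
  then obtain u where "det (mat 1 + Z) * u = 1" using local_ring_unit[OF noeth loc] by blast
  then obtain W where W: "(mat 1 + Z) ** W = mat 1" "W ** (mat 1 + Z) = mat 1"
    using two_by_two_inverse unfolding invertible_def by blast
  have add_r: "(B + C) ** A = B ** A + C ** A" for A :: "'a ^ 'i ^ 'j" and B C :: "'a ^ 'j ^ 'k"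
    by (simp add: vec_eq_iff matrix_matrix_mult_def sum.distrib algebra_simps)
  from W have "Z ** W = mat 1 - W" "W ** Z = mat 1 - W"
    by (simp_all add: matrix_add_ldistrib add_r eq_diff_eq add.commute)
  then have ZW: "Y ** (X ** W) = mat 1 - W" "W ** (Y ** X) = mat 1 - W"
    by (simp_all add: Z_def matrix_mul_assoc)
  have diff_l: "A ** (B - C) = A ** B - A ** C" for A :: "'a ^ 'i ^ 'j" and B C :: "'a ^ 'k ^ 'i"
    by (simp add: vec_eq_iff matrix_matrix_mult_def sum_subtractf algebra_simps)
  have diff_r: "(B - C) ** A = B ** A - C ** A" for A :: "'a ^ 'i ^ 'j" and B C :: "'a ^ 'j ^ 'k"
    by (simp add: vec_eq_iff matrix_matrix_mult_def sum_subtractf algebra_simps)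
  \<comment> \<open>If \<open>W\<close> inverts \<open>1 + YX\<close>, then \<open>1 - XWY\<close>
    inverts \<open>1 + XY\<close>.\<close>
  let ?V = "mat 1 - X ** (W ** Y)"
  have "(mat 1 + X ** Y) ** ?V = mat 1 + X ** Y - X ** (W ** Y) - X ** ((Y ** (X ** W)) ** Y)"
    by (simp add: diff_l add_r matrix_mul_assoc)
  also have "\<dots> = mat 1" unfolding ZW by (simp add: diff_l diff_r)
  finally have 1: "(mat 1 + X ** Y) ** ?V = mat 1" .
  have "?V ** (mat 1 + X ** Y) = mat 1 + X ** Y - X ** (W ** Y) - X ** ((W ** (Y ** X)) ** Y)"
    by (simp add: diff_r matrix_add_ldistrib matrix_mul_assoc)
  also have "\<dots> = mat 1" unfolding ZW by (simp add: diff_l diff_r)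
  finally show ?thesis using 1 unfolding invertible_def by blast
qed

section \<open>Projective dimension\<close>

lemma linear_onD:
  assumes "linear_on s t A f"
  shows "x \<in> A \<Longrightarrow> y \<in> A \<Longrightarrow> f (x + y) = f x + f y" "x \<in> A \<Longrightarrow> f (s c x) = t c (f x)"
  using assms by (simp_all add: linear_on_def)

lemma linear_on_zero:
  assumes "module s" "module t" "linear_on s t A f" "0 \<in> A"
  shows "f 0 = 0"
  using linear_onD(2)[OF assms(3,4), of 0] module.scale_zero_left[OF assms(1)]
    module.scale_zero_left[OF assms(2)] by simp

lemma linear_on_sum:
  assumes "module s" "module t" "linear_on s t A f" "module.subspace s A" "\<And>i. i \<in> S \<Longrightarrow> p i \<in> A"
  shows "f (\<Sum>i\<in>S. s (c i) (p i)) = (\<Sum>i\<in>S. t (c i) (f (p i)))"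
  using assms(5)
proof (induction S rule: infinite_finite_induct)
  case (insert i S)
  have "(\<Sum>i\<in>S. s (c i) (p i)) \<in> A"
    using insert.prems
    by (intro module.subspace_sum[OF assms(1,4)] module.subspace_scale[OF assms(1,4)]) simp
  moreover have "s (c i) (p i) \<in> A"
    using insert.prems by (intro module.subspace_scale[OF assms(1,4)]) simp
  ultimately have "f (s (c i) (p i) + (\<Sum>i\<in>S. s (c i) (p i))) = f (s (c i) (p i)) + f (\<Sum>i\<in>S. s (c i) (p i))"
    by (intro linear_onD(1)[OF assms(3)])
  also have "f (s (c i) (p i)) = t (c i) (f (p i))"
    using insert.prems by (intro linear_onD(2)[OF assms(3)]) simp
  finally show ?case using insert by simp
qed (use linear_on_zero[OF assms(1-3)] module.subspace_0[OF assms(1,4)] in auto)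

lemma linear_on_compose:
  assumes "linear_on s t A f" "linear_on t u B g" "f ` A \<subseteq> B"
  shows "linear_on s u A (\<lambda>x. g (f x))"
  using assms by (simp add: linear_on_def image_subset_iff)

lemma linear_on_diff:
  assumes "module t" "linear_on s t A f" "linear_on s t A g"
  shows "linear_on s t A (\<lambda>x. f x - g x)"
  using assms by (auto simp: linear_on_def module.scale_right_diff_distrib)

lemma linear_on_module_hom: "module_hom s t f \<Longrightarrow> linear_on s t A f"
  by (simp add: linear_on_def module_hom.add module_hom.scale)

lemma module_vec: "module ((*s) :: 'a::comm_ring_1 \<Rightarrow> 'a ^ 'n \<Rightarrow> 'a ^ 'n)"
  by unfold_locales (simp_all add: vec_eq_iff algebra_simps)

lemma linear_on_matrix: "linear_on (*s) (*s) A (\<lambda>v. (D :: 'a::comm_ring_1 ^ 'n ^ 'm) *v v)"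
  by (simp add: linear_on_def matrix_vector_right_distrib matrix_vector_mult_smult)

lemma vec_sum_basis: "(\<Sum>i\<in>UNIV. v $ i *s basis_vec i) = (v :: 'a::comm_ring_1 ^ 'n)"
  by (simp add: vec_eq_iff axis_def if_distrib[of "\<lambda>y. _ * y"] cong: if_cong)

lemma subspace_UNIV: "module s \<Longrightarrow> module.subspace s UNIV"
  by (simp add: module.subspace_def)

lemma linear_on_vec_eq_sum:
  assumes "module t" "linear_on (*s) t UNIV (f :: 'a::comm_ring_1 ^ 'n \<Rightarrow> 'y::ab_group_add)"
  shows "f v = (\<Sum>i\<in>UNIV. t (v $ i) (f (basis_vec i)))"
  using linear_on_sum[OF module_vec assms subspace_UNIV[OF module_vec], of UNIV basis_vec "\<lambda>i. v $ i"]
  by (simp add: vec_sum_basis)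

lemma lift_vec:
  fixes f :: "'a::comm_ring_1 ^ 'n \<Rightarrow> 'y::ab_group_add" and g :: "'x::ab_group_add \<Rightarrow> 'y"
  assumes s: "module s" and t: "module t" and P: "module.subspace s P" and g: "linear_on s t P g"
    and f: "linear_on (*s) t UNIV f" and range: "\<And>v. f v \<in> g ` P"
  shows "\<exists>h. linear_on (*s) s UNIV h \<and> (\<forall>v. h v \<in> P \<and> g (h v) = f v)"
proof -
  have "\<forall>i. \<exists>p. p \<in> P \<and> g p = f (basis_vec i)" using range by (metis imageE)
  then obtain p where p: "\<And>i. p i \<in> P" "\<And>i. g (p i) = f (basis_vec i)" by metis
  define h where "h v = (\<Sum>i\<in>UNIV. s (v $ i) (p i))" for v :: "'a ^ 'n"
  have "linear_on (*s) s UNIV h"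
    by (simp add: linear_on_def h_def module.scale_left_distrib[OF s] sum.distrib
        module.scale_sum_right[OF s] module.scale_scale[OF s])
  moreover have "h v \<in> P" for v
    unfolding h_def using p(1) by (intro module.subspace_sum[OF s P] module.subspace_scale[OF s P])
  moreover have "g (h v) = f v" for v
    unfolding h_def linear_on_sum[OF s t g P p(1)] linear_on_vec_eq_sum[OF t f, of v] p(2) ..
  ultimately show ?thesis by (intro exI[of _ h]) simp
qed

section \<open>Projective submodules of free modules\<close>

lemma lookup_free_scale [simp]: "Poly_Mapping.lookup (free_scale c p) i = c * Poly_Mapping.lookup p i"
  by (simp add: free_scale_def Poly_Mapping.map.rep_eq when_def)

lemma module_free: "module (free_scale :: 'a::comm_ring_1 \<Rightarrow> ('i \<Rightarrow>\<^sub>0 'a) \<Rightarrow> _)"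
  by unfold_locales (auto intro!: poly_mapping_eqI simp: lookup_add algebra_simps)

lemma sum_singles: "(\<Sum>i\<in>Poly_Mapping.keys x. Poly_Mapping.single i (Poly_Mapping.lookup x i)) = x"
  by (rule poly_mapping_eqI) (simp add: lookup_sum lookup_single when_def in_keys_iff)

lemma free_scale_single: "free_scale c (Poly_Mapping.single i d) = Poly_Mapping.single i (c * d)"
  by (rule poly_mapping_eqI) (simp add: lookup_single when_def)

lemma projective_projection:
  fixes P :: "('i \<Rightarrow>\<^sub>0 'a::comm_ring_1) set"
  assumes "projective P"
  obtains \<rho> where "linear_on free_scale free_scale UNIV \<rho>" "range \<rho> \<subseteq> P" "\<And>x. x \<in> P \<Longrightarrow> \<rho> x = x"
proof -
  obtain Q where P: "module.subspace free_scale P" and Q: "module.subspace free_scale Q"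
    and PQ: "P \<inter> Q = {0}" and ex: "\<And>z. \<exists>x\<in>P. \<exists>y\<in>Q. z = x + y"
    using assms unfolding projective_def by blast
  have "\<forall>z. \<exists>x. x \<in> P \<and> z - x \<in> Q"
  proof
    fix z
    obtain x y where "x \<in> P" "y \<in> Q" "z = x + y" using ex[of z] by blast
    then show "\<exists>x. x \<in> P \<and> z - x \<in> Q" by (intro exI[of _ x]) simp
  qed
  then obtain \<rho> where \<rho>: "\<And>z. \<rho> z \<in> P" "\<And>z. z - \<rho> z \<in> Q" by metis
  have uniq: "\<rho> z = x" if "x \<in> P" "z - x \<in> Q" for x z
  proof -
    have "\<rho> z - x \<in> P" by (rule module.subspace_diff[OF module_free P \<rho>(1) that(1)])
    moreover have "(z - x) - (z - \<rho> z) \<in> Q"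
      by (rule module.subspace_diff[OF module_free Q that(2) \<rho>(2)])
    ultimately have "\<rho> z - x \<in> P \<inter> Q" by simp
    then show ?thesis using PQ by simp
  qed
  have "\<rho> (y + z) = \<rho> y + \<rho> z" for y z
  proof (rule uniq)
    show "\<rho> y + \<rho> z \<in> P" by (rule module.subspace_add[OF module_free P \<rho>(1) \<rho>(1)])
    have "(y - \<rho> y) + (z - \<rho> z) \<in> Q" by (rule module.subspace_add[OF module_free Q \<rho>(2) \<rho>(2)])
    then show "y + z - (\<rho> y + \<rho> z) \<in> Q" by (simp add: algebra_simps)
  qed
  moreover have "\<rho> (free_scale c z) = free_scale c (\<rho> z)" for c z
  proof (rule uniq)
    show "free_scale c (\<rho> z) \<in> P" by (rule module.subspace_scale[OF module_free P \<rho>(1)])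
    have "free_scale c (z - \<rho> z) \<in> Q" by (rule module.subspace_scale[OF module_free Q \<rho>(2)])
    then show "free_scale c z - free_scale c (\<rho> z) \<in> Q"
      by (simp add: module.scale_right_diff_distrib[OF module_free])
  qed
  ultimately have "linear_on free_scale free_scale UNIV \<rho>" by (simp add: linear_on_def)
  moreover have "\<rho> x = x" if "x \<in> P" for x
    using that module.subspace_0[OF module_free Q] by (intro uniq) auto
  ultimately show ?thesis using that \<rho>(1) by blast
qed

text \<open>Composed with the projection onto the summand \<open>P\<close>, the map \<open>f\<close>
  extends to the whole free module, where preimages of its values can be chosen on the
  basis.\<close>

lemma lift_projective:
  fixes P :: "('i \<Rightarrow>\<^sub>0 'a::comm_ring_1) set" and g :: "'x::ab_group_add \<Rightarrow> 'y::ab_group_add"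
  assumes P: "projective P" and s: "module s" and t: "module t" and g: "linear_on s t UNIV g"
    and f: "linear_on free_scale t P f" and range: "\<And>x. x \<in> P \<Longrightarrow> f x \<in> range g"
  shows "\<exists>b. linear_on free_scale s P b \<and> (\<forall>x\<in>P. g (b x) = f x)"
proof -
  obtain \<rho> where \<rho>: "linear_on free_scale free_scale UNIV \<rho>" "range \<rho> \<subseteq> P" "\<And>x. x \<in> P \<Longrightarrow> \<rho> x = x"
    using projective_projection[OF P] by metis
  have "\<forall>i. \<exists>y. g y = f (\<rho> (Poly_Mapping.single i 1))"
    using range \<rho>(2) by (metis rangeI rangeE subsetD)
  then obtain q where q: "\<And>i. g (q i) = f (\<rho> (Poly_Mapping.single i 1))" by metis
  define b where "b x = (\<Sum>i\<in>Poly_Mapping.keys x. s (Poly_Mapping.lookup x i) (q i))" for x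
  have b: "b x = (\<Sum>i\<in>S. s (Poly_Mapping.lookup x i) (q i))" if "finite S" "Poly_Mapping.keys x \<subseteq> S" for x S
    unfolding b_def using that
    by (intro sum.mono_neutral_left) (auto simp: in_keys_iff module.scale_zero_left[OF s])
  have "b (x + y) = b x + b y" for x y
  proof -
    have "Poly_Mapping.keys (x + y) \<subseteq> Poly_Mapping.keys x \<union> Poly_Mapping.keys y" by (rule Poly_Mapping.keys_add)
    then show ?thesis
      using b[of "Poly_Mapping.keys x \<union> Poly_Mapping.keys y" x] b[of "Poly_Mapping.keys x \<union> Poly_Mapping.keys y" y] b[of "Poly_Mapping.keys x \<union> Poly_Mapping.keys y" "x + y"]
      by (simp add: lookup_add module.scale_left_distrib[OF s] sum.distrib)
  qed
  moreover have "b (free_scale c x) = s c (b x)" for c x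
  proof -
    have "Poly_Mapping.keys (free_scale c x) \<subseteq> Poly_Mapping.keys x" by (auto simp: in_keys_iff)
    then show ?thesis using b[of "Poly_Mapping.keys x" x] b[of "Poly_Mapping.keys x" "free_scale c x"]
      by (simp add: module.scale_sum_right[OF s] module.scale_scale[OF s])
  qed
  ultimately have "linear_on free_scale s P b" by (simp add: linear_on_def)
  moreover have "g (b x) = f x" if "x \<in> P" for x
  proof -
    have f\<rho>: "linear_on free_scale t UNIV (\<lambda>x. f (\<rho> x))" by (rule linear_on_compose[OF \<rho>(1) f \<rho>(2)])
    have "g (b x) = (\<Sum>i\<in>Poly_Mapping.keys x. t (Poly_Mapping.lookup x i) (f (\<rho> (Poly_Mapping.single i 1))))"
      unfolding b_def q[symmetric] by (rule linear_on_sum[OF s t g subspace_UNIV[OF s]]) simp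
    also have "\<dots> = f (\<rho> (\<Sum>i\<in>Poly_Mapping.keys x. free_scale (Poly_Mapping.lookup x i) (Poly_Mapping.single i 1)))"
      by (rule linear_on_sum[OF module_free t f\<rho> subspace_UNIV[OF module_free], symmetric]) simp
    also have "\<dots> = f x" using \<rho>(3)[OF that] by (simp add: free_scale_single sum_singles)
    finally show ?thesis .
  qed
  ultimately show ?thesis by (intro exI[of _ b]) simp
qed

text \<open>
  For comparison maps to a shorter projective resolution and back, the homotopy of their composition
  with the identity would split the last differential.
\<close>

lemma not_projective_dimension_le_2:
  fixes s :: "'a::comm_ring_1 \<Rightarrow> 'm::ab_group_add \<Rightarrow> 'm"
  assumes s: "module s" and \<mm>: "ring_ideal \<mm>" "1 \<notin> \<mm>"
    and res: "minimal_free_resolution_2442 \<mm> s \<pi> d1 d2 d3"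
    and pd: "projective_dimension_le s n" and n: "n \<le> 2"
  shows False
proof -
  have \<pi>: "linear_on (*s) s UNIV \<pi>" and surj: "surj \<pi>"
    and ex0: "{x. \<pi> x = 0} = range (\<lambda>v. d1 *v v)"
    and ex1: "{x. d1 *v x = 0} = range (\<lambda>v. d2 *v v)"
    and ex2: "{x. d2 *v x = 0} = range (\<lambda>v. d3 *v v)"
    and inj: "inj ((*v) d3)" and min: "\<forall>i j. d3 $ i $ j \<in> \<mm>"
    using res linear_on_module_hom unfolding minimal_free_resolution_2442_def by auto
  note vec_UNIV = subspace_UNIV[OF module_vec]
  have \<pi>d1: "\<pi> (d1 *v v) = 0" and d1d2: "d1 *v (d2 *v w) = 0" and d2d3: "d2 *v (d3 *v u) = 0" for v w u
    using ex0 ex1 ex2 by blast+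
  obtain P \<delta> \<epsilon> where proj: "\<And>i. projective (P i :: (('a + 'm) list \<Rightarrow>\<^sub>0 'a) set)"
    and P0: "\<And>i. i > n \<Longrightarrow> P i = {0}"
    and \<epsilon>: "linear_on free_scale s (P 0) \<epsilon>" "\<epsilon> ` P 0 = UNIV"
    and \<delta>: "\<And>i. linear_on free_scale free_scale (P (Suc i)) (\<delta> i)"
    and exP0: "\<delta> 0 ` P 1 = {x \<in> P 0. \<epsilon> x = 0}"
    and exP: "\<And>i. \<delta> (Suc i) ` P (Suc (Suc i)) = {x \<in> P (Suc i). \<delta> i x = 0}"
    using pd unfolding projective_dimension_le_def
    by (elim exE conjE) (rule that, (assumption | erule spec | erule allE, erule mp, assumption)+)
  have sub: "module.subspace free_scale (P i)" for i using proj[of i] by (simp add: projective_def)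
  have exP1: "\<delta> 1 ` P 2 = {x \<in> P 1. \<delta> 0 x = 0}" and exP2: "\<delta> 2 ` P 3 = {x \<in> P 2. \<delta> 1 x = 0}"
    using exP[of 0] exP[of 1] by (simp_all add: numeral_2_eq_2 numeral_3_eq_3)
  have \<delta>0: "linear_on free_scale free_scale (P 1) (\<delta> 0)" and \<delta>1: "linear_on free_scale free_scale (P 2) (\<delta> 1)"
    and \<delta>2: "linear_on free_scale free_scale (P 3) (\<delta> 2)"
    using \<delta>[of 0] \<delta>[of 1] \<delta>[of 2] by (simp_all add: numeral_2_eq_2 numeral_3_eq_3)
  have P3: "P 3 = {0}" using P0 n by simp
  have \<delta>2z: "\<delta> 2 ` P 3 = {0}" using linear_on_zero[OF module_free module_free \<delta>2] P3 by simp

  obtain a0 where a0: "linear_on (*s) free_scale UNIV a0" "\<And>v. a0 v \<in> P 0" "\<And>v. \<epsilon> (a0 v) = \<pi> v"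
    using lift_vec[OF module_free s sub \<epsilon>(1) \<pi>] \<epsilon>(2) by blast
  have z: "a0 0 = 0" by (rule linear_on_zero[OF module_vec module_free a0(1)]) simp
  have "a0 (d1 *v v) \<in> \<delta> 0 ` P 1" for v unfolding exP0 using a0 \<pi>d1 by simp
  then obtain a1 where a1: "linear_on (*s) free_scale UNIV a1" "\<And>v. a1 v \<in> P 1"
    "\<And>v. \<delta> 0 (a1 v) = a0 (d1 *v v)"
    using lift_vec[OF module_free module_free sub \<delta>0
      linear_on_compose[OF linear_on_matrix[of UNIV d1] a0(1) subset_UNIV]] by blast
  have z1: "a1 0 = 0" by (rule linear_on_zero[OF module_vec module_free a1(1)]) simp
  have "a1 (d2 *v v) \<in> \<delta> 1 ` P 2" for v unfolding exP1 using a1 d1d2 z by simp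
  then obtain a2 where a2: "linear_on (*s) free_scale UNIV a2" "\<And>v. a2 v \<in> P 2"
    "\<And>v. \<delta> 1 (a2 v) = a1 (d2 *v v)"
    using lift_vec[OF module_free module_free sub \<delta>1
      linear_on_compose[OF linear_on_matrix[of UNIV d2] a1(1) subset_UNIV]] by blast
  \<comment> \<open>As \<open>P 3\<close> is zero, \<open>\<delta> 1\<close> is injective on
    \<open>P 2\<close>, and it kills this element.\<close>
  have a2d3: "a2 (d3 *v u) = 0" for u
    using exP2 \<delta>2z a2(2)[of "d3 *v u"] a2(3)[of "d3 *v u"] d2d3 z1 by auto

  obtain b0 where b0: "linear_on free_scale (*s) (P 0) b0" "\<And>x. x \<in> P 0 \<Longrightarrow> \<pi> (b0 x) = \<epsilon> x"
    using lift_projective[OF proj module_vec s \<pi> \<epsilon>(1)] surj by blast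
  have \<delta>P0: "\<delta> 0 x \<in> P 0" "\<epsilon> (\<delta> 0 x) = 0" if "x \<in> P 1" for x using exP0 that by blast+
  have \<delta>P1: "\<delta> 1 x \<in> P 1" "\<delta> 0 (\<delta> 1 x) = 0" if "x \<in> P 2" for x using exP1 that by blast+
  have zP: "0 \<in> P i" for i using module.subspace_0[OF module_free sub] .
  have zb: "b0 0 = 0" by (rule linear_on_zero[OF module_free module_vec b0(1) zP])
  have "b0 (\<delta> 0 x) \<in> range (\<lambda>v. d1 *v v)" if "x \<in> P 1" for x
    unfolding ex0[symmetric] using b0(2) \<delta>P0 that by simp
  moreover have "linear_on free_scale (*s) (P 1) (\<lambda>x. b0 (\<delta> 0 x))"
    using \<delta>P0 by (intro linear_on_compose[OF \<delta>0 b0(1)]) auto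
  ultimately obtain b1 where b1: "linear_on free_scale (*s) (P 1) b1"
    "\<And>x. x \<in> P 1 \<Longrightarrow> d1 *v b1 x = b0 (\<delta> 0 x)"
    using lift_projective[OF proj module_vec module_vec linear_on_matrix[of UNIV d1],
      of 1 "\<lambda>x. b0 (\<delta> 0 x)"] by blast
  have zb1: "b1 0 = 0" by (rule linear_on_zero[OF module_free module_vec b1(1) zP])
  have "b1 (\<delta> 1 x) \<in> range (\<lambda>v. d2 *v v)" if "x \<in> P 2" for x
    unfolding ex1[symmetric] using b1(2) \<delta>P1 that zb by simp
  moreover have "linear_on free_scale (*s) (P 2) (\<lambda>x. b1 (\<delta> 1 x))"
    using \<delta>P1 by (intro linear_on_compose[OF \<delta>1 b1(1)]) auto
  ultimately obtain b2 where b2: "linear_on free_scale (*s) (P 2) b2"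
    "\<And>x. x \<in> P 2 \<Longrightarrow> d2 *v b2 x = b1 (\<delta> 1 x)"
    using lift_projective[OF proj module_vec module_vec linear_on_matrix[of UNIV d2],
      of 2 "\<lambda>x. b1 (\<delta> 1 x)"] by blast
  have zb2: "b2 0 = 0" by (rule linear_on_zero[OF module_free module_vec b2(1) zP])

  have lid: "linear_on (*s) (*s) UNIV (\<lambda>v :: 'a ^ 'n. v)" by (simp add: linear_on_def)
  have \<pi>diff: "\<pi> (v - w) = \<pi> v - \<pi> w" for v w
    using linear_onD(1)[OF \<pi>, of "v - w" w] by simp
  have ba0: "linear_on (*s) (*s) UNIV (\<lambda>v. b0 (a0 v))"
    using a0(2) by (intro linear_on_compose[OF a0(1) b0(1)]) auto
  have ba1: "linear_on (*s) (*s) UNIV (\<lambda>v. b1 (a1 v))"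
    using a1(2) by (intro linear_on_compose[OF a1(1) b1(1)]) auto
  have ba2: "linear_on (*s) (*s) UNIV (\<lambda>v. b2 (a2 v))"
    using a2(2) by (intro linear_on_compose[OF a2(1) b2(1)]) auto
  have "b0 (a0 v) - v \<in> range (\<lambda>v. d1 *v v)" for v
    unfolding ex0[symmetric] using a0 b0(2) by (simp add: \<pi>diff)
  then obtain k0 where k0: "linear_on (*s) (*s) UNIV k0" "\<And>v. d1 *v k0 v = b0 (a0 v) - v"
    using lift_vec[OF module_vec module_vec vec_UNIV linear_on_matrix[of UNIV d1]
      linear_on_diff[OF module_vec ba0 lid]] by blast
  have zk0: "k0 0 = 0" by (rule linear_on_zero[OF module_vec module_vec k0(1)]) simp
  have "b1 (a1 v) - v - k0 (d1 *v v) \<in> range (\<lambda>v. d2 *v v)" for v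
    unfolding ex1[symmetric] using a1 b1(2) k0(2) by (simp add: matrix_vector_mult_diff_distrib)
  then obtain k1 where k1: "linear_on (*s) (*s) UNIV k1"
    "\<And>v. d2 *v k1 v = b1 (a1 v) - v - k0 (d1 *v v)"
    using lift_vec[OF module_vec module_vec vec_UNIV linear_on_matrix[of UNIV d2] linear_on_diff[OF module_vec
      linear_on_diff[OF module_vec ba1 lid]
      linear_on_compose[OF linear_on_matrix[of UNIV d1] k0(1) subset_UNIV]]] by blast
  have zk1: "k1 0 = 0" by (rule linear_on_zero[OF module_vec module_vec k1(1)]) simp
  have "b2 (a2 v) - v - k1 (d2 *v v) \<in> range (\<lambda>v. d3 *v v)" for v
    unfolding ex2[symmetric] using a2 b2(2) k1(2) d1d2 zk0 by (simp add: matrix_vector_mult_diff_distrib)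
  then obtain k2 where k2: "linear_on (*s) (*s) UNIV k2"
    "\<And>v. d3 *v k2 v = b2 (a2 v) - v - k1 (d2 *v v)"
    using lift_vec[OF module_vec module_vec vec_UNIV linear_on_matrix[of UNIV d3] linear_on_diff[OF module_vec
      linear_on_diff[OF module_vec ba2 lid]
      linear_on_compose[OF linear_on_matrix[of UNIV d2] k1(1) subset_UNIV]]] by blast
  \<comment> \<open>On the image of \<open>d3\<close> the homotopy identity loses the terms
    \<open>b2 (a2 _)\<close> and \<open>k1 (d2 _)\<close>, so \<open>- k2\<close> is a left inverse
    of \<open>d3\<close>. The entries of \<open>d3\<close> lie in \<open>\<mm>\<close>, which would
    put a unit there.\<close>
  have "d3 *v k2 (d3 *v u) = d3 *v (- u)" for u
    using k2(2)[of "d3 *v u"] a2d3 zb2 zk1 d2d3 matrix_vector_mult_diff_distrib[of d3 0 u] by simp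
  then have split: "k2 (d3 *v u) = - u" for u using inj by (auto dest: injD)
  let ?u = "basis_vec 1 :: 'a ^ 2"
  have "vec_in \<mm> (d3 *v ?u)" by (rule vec_in_matrix[OF \<mm>(1) min])
  then have "k2 (d3 *v ?u) $ 1 \<in> \<mm>"
    using linear_on_vec_eq_sum[OF module_vec k2(1), of "d3 *v ?u"]
    by (simp add: vec_in_def ring_module.subspace_sum[OF \<mm>(1)] ring_ideal_mult_right[OF \<mm>(1)])
  then have "- 1 \<in> \<mm>" by (simp add: split axis_def)
  then show False using ring_module.subspace_neg[OF \<mm>(1)] \<mm>(2) by fastforce
qed

text \<open>Carries \<open>'a ^ 'n\<close> into a free module on a given index type, as
  \<open>projective_dimension_le\<close> prescribes the type that holds the projective
  modules.\<close>

definition coord_embedding :: "('n \<Rightarrow> 'i) \<Rightarrow> 'a::comm_ring_1 ^ 'n \<Rightarrow> ('i \<Rightarrow>\<^sub>0 'a)" where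
  "coord_embedding g v = (\<Sum>j\<in>UNIV. Poly_Mapping.single (g j) (v $ j))"

definition coord_restriction :: "('n \<Rightarrow> 'i) \<Rightarrow> ('i \<Rightarrow>\<^sub>0 'a::comm_ring_1) \<Rightarrow> 'a ^ 'n" where
  "coord_restriction g p = (\<chi> j. Poly_Mapping.lookup p (g j))"

lemma coord_restriction_embedding:
  assumes "inj g" shows "coord_restriction g (coord_embedding g v) = v"
  using assms by (simp add: vec_eq_iff coord_restriction_def coord_embedding_def lookup_sum
      lookup_single inj_eq when_def)

lemma linear_on_coord_embedding: "linear_on (*s) free_scale A (coord_embedding g)"
  by (simp add: linear_on_def coord_embedding_def single_add sum.distrib
      module.scale_sum_right[OF module_free] free_scale_single)

lemma linear_on_coord_restriction: "linear_on free_scale (*s) A (coord_restriction g)"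
  by (simp add: linear_on_def coord_restriction_def vec_eq_iff lookup_add)

lemma projective_coord_embedding:
  fixes g :: "'n::finite \<Rightarrow> 'i"
  assumes "inj g"
  shows "projective (range (coord_embedding g :: 'a::comm_ring_1 ^ 'n \<Rightarrow> _))" (is "projective ?P")
  unfolding projective_def
proof (intro conjI exI)
  let ?e = "coord_embedding g :: 'a ^ 'n \<Rightarrow> _" and ?r = "coord_restriction g :: _ \<Rightarrow> 'a ^ 'n"
  note e = linear_onD[OF linear_on_coord_embedding[of "UNIV :: ('a ^ 'n) set" g]]
  note r = linear_onD[OF linear_on_coord_restriction[of "UNIV :: ('i \<Rightarrow>\<^sub>0 'a) set" g]]
  have z: "?e 0 = 0" "?r 0 = 0"
    by (simp_all add: coord_embedding_def coord_restriction_def vec_eq_iff)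
  show "module.subspace free_scale ?P"
    unfolding module.subspace_def[OF module_free]
  proof (intro conjI ballI allI)
    show "0 \<in> ?P" using rangeI[of ?e 0] by (simp add: z(1))
  next
    fix x y assume "x \<in> ?P" "y \<in> ?P"
    then obtain v w where "x = ?e v" "y = ?e w" by blast
    then have "x + y = ?e (v + w)" by (simp add: e(1))
    then show "x + y \<in> ?P" by simp
  next
    fix c x assume "x \<in> ?P"
    then obtain v where "x = ?e v" by blast
    then have "free_scale c x = ?e (c *s v)" by (simp add: e(2))
    then show "free_scale c x \<in> ?P" by simp
  qed
  show "module.subspace free_scale {p. ?r p = 0}"
    unfolding module.subspace_def[OF module_free] using r z by auto
  show "?P \<inter> {p. ?r p = 0} = {0}"
  proof (intro equalityI subsetI)
    fix p assume "p \<in> ?P \<inter> {p. ?r p = 0}"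
    then obtain v where "p = ?e v" "?r (?e v) = 0" by blast
    then show "p \<in> {0}" using z by (simp add: coord_restriction_embedding[OF assms])
  next
    fix p :: "'i \<Rightarrow>\<^sub>0 'a" assume "p \<in> {0}"
    then show "p \<in> ?P \<inter> {p. ?r p = 0}" using z rangeI[of ?e 0] by simp
  qed
  show "\<forall>p. \<exists>x\<in>?P. \<exists>y\<in>{p. ?r p = 0}. p = x + y"
  proof
    fix p :: "'i \<Rightarrow>\<^sub>0 'a"
    have "?r (p - ?e (?r p)) + ?r (?e (?r p)) = ?r p"
      by (subst r(1)[symmetric]) simp_all
    then have "?r (p - ?e (?r p)) = 0" by (simp add: coord_restriction_embedding[OF assms])
    then show "\<exists>x\<in>?P. \<exists>y\<in>{p. ?r p = 0}. p = x + y"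
      by (intro bexI[of _ "?e (?r p)"] bexI[of _ "p - ?e (?r p)"]) auto
  qed
qed

lemma projective_zero: "projective ({0} :: ('i \<Rightarrow>\<^sub>0 'a::comm_ring_1) set)"
  unfolding projective_def
  by (auto simp: module.subspace_def[OF module_free] module.scale_zero_right[OF module_free]
      intro!: exI[of _ UNIV])

lemma projective_dimension_le_3:
  fixes s :: "'a::comm_ring_1 \<Rightarrow> 'm::ab_group_add \<Rightarrow> 'm"
  assumes s: "module s" and res: "minimal_free_resolution_2442 \<mm> s \<pi> d1 d2 d3"
  shows "projective_dimension_le s 3"
proof -
  have \<pi>: "linear_on (*s) s UNIV \<pi>" and surj: "surj \<pi>"
    and ex0: "{x. \<pi> x = 0} = range (\<lambda>v. d1 *v v)"
    and ex1: "{x. d1 *v x = 0} = range (\<lambda>v. d2 *v v)"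
    and ex2: "{x. d2 *v x = 0} = range (\<lambda>v. d3 *v v)"
    and inj: "inj ((*v) d3)"
    using res linear_on_module_hom unfolding minimal_free_resolution_2442_def by auto
  have d3z: "d3 *v u = 0 \<longleftrightarrow> u = 0" for u using inj by (metis injD matrix_vector_mult_0_right)
  \<comment> \<open>Lists form an infinite type even if the ring and the module are finite, so there
    is room for all the basis vectors.\<close>
  have "\<exists>g :: nat \<Rightarrow> ('a + 'm) list. inj g"
    using infinite_UNIV_listI infinite_countable_subset by blast
  then obtain g :: "nat \<Rightarrow> ('a + 'm) list" where g: "inj g" by blast
  define g4 where "g4 = g \<circ> to_nat_on (UNIV :: 4 set)"
  define g2 where "g2 = g \<circ> to_nat_on (UNIV :: 2 set)"
  have inj4: "inj g4" and inj2: "inj g2"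
    unfolding g4_def g2_def by (intro inj_compose[OF g] inj_on_to_nat_on countable_finite finite)+
  define e4 :: "'a ^ 4 \<Rightarrow> _" where "e4 = coord_embedding g4"
  define e2 :: "'a ^ 2 \<Rightarrow> _" where "e2 = coord_embedding g2"
  define r4 :: "_ \<Rightarrow> 'a ^ 4" where "r4 = coord_restriction g4"
  define r2 :: "_ \<Rightarrow> 'a ^ 2" where "r2 = coord_restriction g2"
  have lin: "linear_on (*s) free_scale UNIV e4" "linear_on (*s) free_scale UNIV e2"
    "linear_on free_scale (*s) A r4" "linear_on free_scale (*s) A r2" for A
    unfolding e4_def e2_def r4_def r2_def
    by (rule linear_on_coord_embedding linear_on_coord_restriction)+
  have re: "r4 (e4 v) = v" "r2 (e2 w) = w" for v w
    unfolding e4_def e2_def r4_def r2_def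
    using inj4 inj2 by (auto simp: coord_restriction_embedding)
  have ez: "e4 v = 0 \<longleftrightarrow> v = 0" "e2 w = 0 \<longleftrightarrow> w = 0" for v w
  proof -
    have "e4 0 = 0" "e2 0 = 0" by (simp_all add: e4_def e2_def coord_embedding_def)
    then show "e4 v = 0 \<longleftrightarrow> v = 0" "e2 w = 0 \<longleftrightarrow> w = 0" using re by metis+
  qed
  have rz: "r4 0 = 0" "r2 0 = 0"
    by (simp_all add: r4_def r2_def coord_restriction_def vec_eq_iff)
  define P where "P i = (if i = 0 \<or> i = 3 then range e2 else if i = 1 \<or> i = 2 then range e4 else {0})"
    for i :: nat
  define \<delta> where "\<delta> i = (if i = 0 then \<lambda>x. e2 (d1 *v r4 x) else if i = 1 then \<lambda>x. e4 (d2 *v r4 x)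
     else if i = 2 then \<lambda>x. e4 (d3 *v r2 x) else (\<lambda>x. 0))" for i :: nat
  have "projective (P i)" for i
    unfolding P_def e4_def e2_def
    using projective_coord_embedding[OF inj4] projective_coord_embedding[OF inj2] projective_zero by auto
  moreover have "\<forall>i>3. P i = {0}" by (simp add: P_def)
  moreover have "linear_on free_scale s (P 0) (\<lambda>x. \<pi> (r2 x))"
    by (rule linear_on_compose[OF lin(4) \<pi>]) simp
  moreover have "(\<lambda>x. \<pi> (r2 x)) ` P 0 = UNIV"
    using surj by (simp add: P_def image_image re)
  moreover have "linear_on free_scale free_scale (P (Suc i)) (\<delta> i)" for i
  proof -
    have "linear_on free_scale free_scale A (\<lambda>x. e2 (d1 *v r4 x))"
      "linear_on free_scale free_scale A (\<lambda>x. e4 (d2 *v r4 x))"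
      "linear_on free_scale free_scale A (\<lambda>x. e4 (d3 *v r2 x))"
      "linear_on free_scale free_scale A (\<lambda>x. 0 :: ('a + 'm) list \<Rightarrow>\<^sub>0 'a)" for A
      by (rule linear_on_compose[OF linear_on_compose[OF lin(3) linear_on_matrix] lin(2)]
          linear_on_compose[OF linear_on_compose[OF lin(3) linear_on_matrix] lin(1)]
          linear_on_compose[OF linear_on_compose[OF lin(4) linear_on_matrix] lin(1)] subset_UNIV
        | simp add: linear_on_def module.scale_zero_right[OF module_free])+
    then show ?thesis by (simp add: \<delta>_def)
  qed
  moreover have "\<delta> 0 ` P 1 = {x \<in> P 0. \<pi> (r2 x) = 0}"
  proof -
    have "\<delta> 0 ` P 1 = e2 ` {v. \<pi> v = 0}"
      by (simp add: \<delta>_def P_def image_image re ex0)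
    then show ?thesis by (auto simp: P_def re)
  qed
  moreover have "\<delta> (Suc i) ` P (Suc (Suc i)) = {x \<in> P (Suc i). \<delta> i x = 0}" for i
  proof -
    consider "i = 0" | "i = 1" | "i = 2" | "i > 2" by linarith
    then show ?thesis
    proof cases
      case 1
      have "\<delta> 1 ` P 2 = e4 ` {v. d1 *v v = 0}"
        by (simp add: \<delta>_def P_def image_image re ex1)
      then show ?thesis using 1 by (auto simp: \<delta>_def P_def re ez numeral_2_eq_2)
    next
      case 2
      have "\<delta> 2 ` P 3 = e4 ` {v. d2 *v v = 0}"
        by (simp add: \<delta>_def P_def image_image re ex2)
      then show ?thesis using 2 by (auto simp: \<delta>_def P_def re ez numeral_2_eq_2 numeral_3_eq_3)
    next
      case 3
      then show ?thesis by (auto simp: \<delta>_def P_def re rz ez d3z numeral_3_eq_3)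
    next
      case 4
      then show ?thesis by (auto simp: \<delta>_def P_def)
    qed
  qed
  ultimately show ?thesis
    unfolding projective_dimension_le_def by blast
qed

lemma projective_dimension_eq_3:
  fixes s :: "'a::comm_ring_1 \<Rightarrow> 'm::ab_group_add \<Rightarrow> 'm"
  assumes "module s" "ring_ideal \<mm>" "1 \<notin> \<mm>" "minimal_free_resolution_2442 \<mm> s \<pi> d1 d2 d3"
  shows "projective_dimension s = 3"
  unfolding projective_dimension_def
proof (rule antisym)
  have "enat 3 \<in> {enat n |n. projective_dimension_le s n}" using projective_dimension_le_3[OF assms(1,4)] by blast
  then have "Inf {enat n |n. projective_dimension_le s n} \<le> enat 3" by (rule Inf_lower)
  then show "Inf {enat n |n. projective_dimension_le s n} \<le> 3" by (simp add: numeral_eq_enat)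
  show "3 \<le> Inf {enat n |n. projective_dimension_le s n}"
  proof (rule Inf_greatest)
    fix x assume "x \<in> {enat n |n. projective_dimension_le s n}"
    then obtain n where "x = enat n" "projective_dimension_le s n" by blast
    then show "3 \<le> x" using not_projective_dimension_le_2[OF assms, of n]
      by (cases "n \<le> 2") (auto simp: numeral_eq_enat)
  qed
qed

section \<open>The Buchsbaum-Rim complex\<close>

lemma minor2_eq: "minor2 d1 i j = d1 $ 1 $ i * d1 $ 2 $ j - d1 $ 1 $ j * d1 $ 2 $ i"
  by (simp add: minor2_def det_2)

text \<open>The bivector with coefficients \<open>c i j\<close>, as a skew-symmetric matrix; only
  the six values with \<open>i\<close> before \<open>j\<close> in 1, 2, 3, 4 are read.\<close>

definition skew4 :: "(4 \<Rightarrow> 4 \<Rightarrow> 'a::comm_ring_1) \<Rightarrow> 'a ^ 4 ^ 4" where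
  "skew4 c = vector [vector [0, c 1 2, c 1 3, c 1 4], vector [- c 1 2, 0, c 2 3, c 2 4],
     vector [- c 1 3, - c 2 3, 0, c 3 4], vector [- c 1 4, - c 2 4, - c 3 4, 0]]"

text \<open>
  If the \<open>c i j\<close> are the maximal minors of \<open>d1\<close>, then \<open>hodge4 c\<close> is the middle differential of
  the Buchsbaum-Rim complex, from the third exterior power of \<open>F\<^sub>1\<close>, with the basis
  \<open>trivector\<close> below, to \<open>F\<^sub>1\<close>; the other two differentials are then \<open>d1\<close> and its transpose.
\<close>

definition hodge4 :: "(4 \<Rightarrow> 4 \<Rightarrow> 'a::comm_ring_1) \<Rightarrow> 'a ^ 4 ^ 4" where
  "hodge4 c = vector [vector [0, - c 3 4, c 2 4, - c 2 3], vector [c 3 4, 0, - c 1 4, c 1 3],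
     vector [- c 2 4, c 1 4, 0, - c 1 2], vector [c 2 3, - c 1 3, c 1 2, 0]]"

definition minor_comb :: "'a::comm_ring_1 ^ 4 ^ 2 \<Rightarrow> (4 \<Rightarrow> 4 \<Rightarrow> 'a) \<Rightarrow> 'a" where
  "minor_comb d1 c = c 1 2 * minor2 d1 1 2 + c 1 3 * minor2 d1 1 3 + c 1 4 * minor2 d1 1 4
     + c 2 3 * minor2 d1 2 3 + c 2 4 * minor2 d1 2 4 + c 3 4 * minor2 d1 3 4"

definition minor_ideal :: "'a::comm_ring_1 ^ 4 ^ 2 \<Rightarrow> 'a set" where
  "minor_ideal d1 = range (minor_comb d1)"

text \<open>The product \<open>d1 ** skew4 c ** transpose d1\<close> is skew of size 2, with entry
  \<open>minor_comb d1 c\<close>; the last factor turns it into a scalar matrix. If \<open>c\<close>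
  selects one minor, this is the adjugate of a 2 by 2 block of \<open>d1\<close>, padded with zero
  rows.\<close>

definition cramer :: "'a::comm_ring_1 ^ 4 ^ 2 \<Rightarrow> (4 \<Rightarrow> 4 \<Rightarrow> 'a) \<Rightarrow> 'a ^ 2 ^ 4" where
  "cramer d1 c = skew4 c ** transpose d1 ** vector [vector [0, - 1], vector [1, 0]]"

lemma vector_4:
  "(vector [x, y, z, w] :: 'a::zero ^ 4) $ 1 = x" "(vector [x, y, z, w] :: 'a ^ 4) $ 2 = y"
  "(vector [x, y, z, w] :: 'a ^ 4) $ 3 = z" "(vector [x, y, z, w] :: 'a ^ 4) $ 4 = w"
  unfolding vector_def by simp_all

lemmas entries4 = vec_eq_iff forall_4 forall_2 matrix_matrix_mult_def sum_4 sum_2 mat_def transpose_def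
  vector_4 vector_2

text \<open>This and the next two identities say that \<open>transpose (cramer d1 c)\<close>,
  \<open>- hodge4 c\<close> and \<open>cramer d1 c\<close> contract multiplication by
  \<open>minor_comb d1 c\<close> on G. They are polynomial identities in the entries, checked by
  expansion.\<close>

lemma cramer_right: "d1 ** cramer d1 c = mat (minor_comb d1 c)"
  by (simp add: cramer_def skew4_def minor_comb_def minor2_eq entries4 algebra_simps)

lemma cramer_left:
  "cramer d1 c ** d1 - hodge4 (minor2 d1) ** hodge4 c = mat (minor_comb d1 c)"
  by (simp add: cramer_def skew4_def hodge4_def minor_comb_def minor2_eq entries4 algebra_simps)

lemma cramer_left_transpose:
  "transpose d1 ** transpose (cramer d1 c) - hodge4 c ** hodge4 (minor2 d1) = mat (minor_comb d1 c)"
  by (simp add: cramer_def skew4_def hodge4_def minor_comb_def minor2_eq entries4 algebra_simps)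

lemma hodge4_minor2_transpose: "hodge4 (minor2 d1) ** transpose d1 = 0"
  by (simp add: hodge4_def minor2_eq entries4 algebra_simps)

lemma cramer_null_homotopic:
  assumes "x \<in> minor_ideal d1"
  shows "null_homotopic (transpose d1) (hodge4 (minor2 d1)) d1 x"
proof -
  obtain c where x: "x = minor_comb d1 c" using assms by (auto simp: minor_ideal_def)
  have neg: "A ** (- B) = - (A ** B)" "(- B) ** A = - (B ** A)" for A B :: "'a ^ 4 ^ 4"
    by (simp_all add: vec_eq_iff matrix_matrix_mult_def sum_negf)
  have "transpose (d1 ** cramer d1 c) = mat x" by (simp add: x cramer_right)
  then have "transpose (cramer d1 c) ** transpose d1 = mat x" by (simp add: matrix_transpose_mul)
  moreover have "transpose d1 ** transpose (cramer d1 c) + (- hodge4 c) ** hodge4 (minor2 d1) = mat x"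
    using cramer_left_transpose[of d1 c] by (simp add: x neg)
  moreover have "hodge4 (minor2 d1) ** (- hodge4 c) + cramer d1 c ** d1 = mat x"
    using cramer_left[of d1 c] by (simp add: x neg)
  ultimately show ?thesis unfolding null_homotopic_def by blast
qed

lemma minor_comb_add: "minor_comb d1 c + minor_comb d1 c' = minor_comb d1 (\<lambda>i j. c i j + c' i j)"
  and minor_comb_mult: "r * minor_comb d1 c = minor_comb d1 (\<lambda>i j. r * c i j)"
  by (simp_all add: minor_comb_def algebra_simps)

lemma ring_ideal_minor_ideal: "ring_ideal (minor_ideal d1)"
proof (rule ring_module.subspaceI)
  have "minor_comb d1 (\<lambda>i j. 0) = 0" by (simp add: minor_comb_def)
  then show "0 \<in> minor_ideal d1" unfolding minor_ideal_def by (metis rangeI)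
qed (auto simp: minor_ideal_def minor_comb_add minor_comb_mult)

lemma minor2_in_minor_ideal: "minor2 d1 i j \<in> minor_ideal d1"
proof -
  have anti: "minor2 d1 i j = - minor2 d1 j i" and diag: "minor2 d1 i i = 0" for i j
    by (simp_all add: minor2_eq)
  have m: "minor2 d1 1 2 \<in> minor_ideal d1" "minor2 d1 1 3 \<in> minor_ideal d1"
    "minor2 d1 1 4 \<in> minor_ideal d1" "minor2 d1 2 3 \<in> minor_ideal d1"
    "minor2 d1 2 4 \<in> minor_ideal d1" "minor2 d1 3 4 \<in> minor_ideal d1"
    unfolding minor_ideal_def
    by (rule range_eqI[of _ _ "\<lambda>i j. of_bool (i = 1 \<and> j = 2)"] range_eqI[of _ _ "\<lambda>i j. of_bool (i = 1 \<and> j = 3)"]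
      range_eqI[of _ _ "\<lambda>i j. of_bool (i = 1 \<and> j = 4)"] range_eqI[of _ _ "\<lambda>i j. of_bool (i = 2 \<and> j = 3)"]
      range_eqI[of _ _ "\<lambda>i j. of_bool (i = 2 \<and> j = 4)"] range_eqI[of _ _ "\<lambda>i j. of_bool (i = 3 \<and> j = 4)"],
      simp add: minor_comb_def)+
  note I = ring_module.subspace_0[OF ring_ideal_minor_ideal[of d1]]
    ring_module.subspace_neg[OF ring_ideal_minor_ideal[of d1]]
  show ?thesis
    using exhaust_4[of i] exhaust_4[of j] m m[THEN I(2)] I(1)
    by (auto simp: diag anti[symmetric])
qed

lemma minor_ideal_subset:
  assumes \<mm>: "ring_ideal \<mm>" and d1: "\<forall>i j. d1 $ i $ j \<in> \<mm>"
  shows "minor_ideal d1 \<subseteq> \<mm>"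
proof -
  have "minor2 d1 i j \<in> \<mm>" for i j
    unfolding minor2_eq using d1 by (intro ring_module.subspace_diff[OF \<mm>] ring_module.subspace_scale[OF \<mm>]) auto
  then show ?thesis
    unfolding minor_ideal_def minor_comb_def
    by (auto intro!: ring_module.subspace_add[OF \<mm>] ring_module.subspace_scale[OF \<mm>])
qed

lemma matrix_factor:
  fixes N :: "'a::comm_ring_1 ^ 'n ^ 'm" and D :: "'a ^ 'p ^ 'm"
  assumes "\<And>v. \<exists>u. N *v v = D *v u"
  shows "\<exists>H. N = D ** H"
proof -
  have "\<forall>j. \<exists>u. N *v basis_vec j = D *v u" using assms by blast
  then obtain u where u: "\<And>j. N *v basis_vec j = D *v u j" by metis
  have "N = D ** (\<chi> i j. u j $ i)"
  proof (simp only: vec_eq_iff, intro allI)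
    fix i j
    have "N $ i $ j = (N *v basis_vec j) $ i"
      by (simp add: matrix_vector_mult_def axis_def if_distrib[of "\<lambda>y. _ * y"] cong: if_cong)
    then show "N $ i $ j = (D ** (\<chi> i j. u j $ i)) $ i $ j"
      unfolding u by (simp add: matrix_vector_mult_def matrix_matrix_mult_def)
  qed
  then show ?thesis ..
qed

lemma grade_eq_3_obtain:
  assumes "grade I = 3"
  obtains xs where "regular_sequence xs" "set xs \<subseteq> I" "length xs \<ge> 3"
proof (cases "\<exists>xs. regular_sequence xs \<and> set xs \<subseteq> I \<and> length xs \<ge> 3")
  case False
  have "grade I \<le> 2"
    unfolding grade_def
  proof (rule Sup_least)
    fix n assume "n \<in> {enat (length xs) |xs. regular_sequence xs \<and> set xs \<subseteq> I}"
    then obtain xs where xs: "n = enat (length xs)" "regular_sequence xs" "set xs \<subseteq> I" by blast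
    then have "\<not> length xs \<ge> 3" using False by blast
    then show "n \<le> 2" by (simp add: xs(1) numeral_eq_enat)
  qed
  then show ?thesis using assms by (simp add: numeral_eq_enat)
qed (use that in blast)

lemma grade_eq_3I:
  assumes "regular_sequence xs" "set xs \<subseteq> I" "length xs = 3"
    and "\<And>ys. regular_sequence ys \<Longrightarrow> set ys \<subseteq> I \<Longrightarrow> length ys \<le> 3"
  shows "grade I = 3"
  unfolding grade_def
proof (rule antisym)
  show "Sup {enat (length xs) |xs. regular_sequence xs \<and> set xs \<subseteq> I} \<le> 3"
    using assms(4) by (auto intro!: Sup_least simp: numeral_eq_enat)
  have "enat 3 \<le> Sup {enat (length xs) |xs. regular_sequence xs \<and> set xs \<subseteq> I}"
    using assms(1-3) by (intro Sup_upper) force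
  then show "3 \<le> Sup {enat (length xs) |xs. regular_sequence xs \<and> set xs \<subseteq> I}"
    by (simp add: numeral_eq_enat)
qed

section \<open>The given resolution: homotopies, grade, comparison with G\<close>

locale format_2442 =
  fixes \<mm> :: "'a::comm_ring_1 set" and s :: "'a \<Rightarrow> 'm::ab_group_add \<Rightarrow> 'm" and \<pi> :: "'a ^ 2 \<Rightarrow> 'm"
    and d1 :: "'a ^ 4 ^ 2" and d2 :: "'a ^ 4 ^ 4" and d3 :: "'a ^ 2 ^ 4"
  assumes noeth: "noetherian TYPE('a)" and loc: "local_ring \<mm>" and s: "module s"
    and resolution: "minimal_free_resolution_2442 \<mm> s \<pi> d1 d2 d3"
begin

lemma \<mm>: "ring_ideal \<mm>" "1 \<notin> \<mm>"
  using local_ring_ideal[OF loc] by auto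

lemma min: "\<forall>i j. d1 $ i $ j \<in> \<mm>" "\<forall>i j. d3 $ i $ j \<in> \<mm>"
  using resolution unfolding minimal_free_resolution_2442_def by auto

lemma exact_1: "d1 *v v = 0 \<longleftrightarrow> (\<exists>u. v = d2 *v u)"
  and exact_2: "d2 *v v = 0 \<longleftrightarrow> (\<exists>w. v = d3 *v w)"
  and exact_0: "\<pi> x = 0 \<longleftrightarrow> (\<exists>u. x = d1 *v u)"
  using resolution unfolding minimal_free_resolution_2442_def by blast+

lemma \<pi>_smult: "\<pi> (x *s v) = s x (\<pi> v)"
  using resolution module_hom.scale[of "(*s)" s \<pi>] by (simp add: minimal_free_resolution_2442_def)

lemma exact_3: "d3 *v w = 0 \<longleftrightarrow> w = 0" and d3_cancel: "d3 *v w = d3 *v w' \<longleftrightarrow> w = w'"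
  using resolution unfolding minimal_free_resolution_2442_def
  by (metis injD matrix_vector_mult_0_right)+

lemma d1d2: "d1 ** d2 = 0" and d2d3: "d2 ** d3 = 0"
  using exact_1 exact_2 by (auto simp: matrix_eq matrix_vector_mul_assoc[symmetric])

lemma annihilatorD: "x \<in> annihilator s \<Longrightarrow> \<exists>u. x *s v = d1 *v u"
proof -
  assume "x \<in> annihilator s"
  then have "s x (\<pi> v) = 0" by (simp add: annihilator_def)
  then have "\<pi> (x *s v) = 0" by (simp add: \<pi>_smult)
  then show ?thesis by (simp add: exact_0)
qed

lemma minor_ideal_annihilator: "minor_ideal d1 \<subseteq> annihilator s"
proof
  fix x assume "x \<in> minor_ideal d1"
  then obtain c where x: "x = minor_comb d1 c" by (auto simp: minor_ideal_def)
  have "s x m = 0" for m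
  proof -
    obtain v where m: "m = \<pi> v"
      using resolution unfolding minimal_free_resolution_2442_def by (meson surjD)
    have "x *s v = d1 *v (cramer d1 c *v v)"
      by (simp add: matrix_vector_mul_assoc cramer_right x mat_vector_mult)
    then have "\<pi> (x *s v) = 0" by (auto simp: exact_0)
    then show ?thesis by (simp add: m \<pi>_smult)
  qed
  then show "x \<in> annihilator s" by (simp add: annihilator_def)
qed

text \<open>Multiplication by \<open>x\<close> on the resolution lifts the zero map of the module,
  so it is null homotopic; each component is a lift through the next differential. The last equation
  uses injectivity of \<open>d3\<close>.\<close>

lemma annihilator_homotopy:
  assumes "x \<in> annihilator s"
  obtains H0 H1 H2 where "d1 ** H0 = mat x" "H0 ** d1 + d2 ** H1 = mat x" "H1 ** d2 + d3 ** H2 = mat x"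
    "H2 ** d3 = mat x"
proof -
  have x: "d1 *v (x *s v) = x *s (d1 *v v)" "d2 *v (x *s w) = x *s (d2 *v w)" for v w
    by (simp_all add: matrix_vector_mult_smult)
  have "\<exists>u. mat x *v v = d1 *v u" for v using annihilatorD[OF assms] by (simp add: mat_vector_mult)
  then obtain H0 where H0: "mat x = d1 ** H0" using matrix_factor by blast
  have a0: "d1 *v (H0 *v v) = x *s v" for v
    by (simp add: matrix_vector_mul_assoc H0[symmetric] mat_vector_mult)
  have "\<exists>u. (mat x - H0 ** d1) *v v = d2 *v u" for v
    by (simp add: exact_1[symmetric] matrix_vector_mult_diff_rdistrib matrix_vector_mult_diff_distrib
      matrix_vector_mul_assoc[symmetric] a0 x mat_vector_mult)
  then obtain H1 where H1: "mat x - H0 ** d1 = d2 ** H1" using matrix_factor by blast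
  have a1: "d2 *v (H1 *v v) = x *s v - H0 *v (d1 *v v)" for v
    by (simp add: matrix_vector_mul_assoc H1[symmetric] matrix_vector_mult_diff_rdistrib mat_vector_mult)
  have z: "d1 *v (d2 *v v) = 0" "d2 *v (d3 *v w) = 0" for v w
    by (simp_all add: matrix_vector_mul_assoc d1d2 d2d3)
  have "\<exists>u. (mat x - H1 ** d2) *v v = d3 *v u" for v
    by (simp add: exact_2[symmetric] matrix_vector_mult_diff_rdistrib matrix_vector_mult_diff_distrib
      matrix_vector_mul_assoc[symmetric] a1 x z mat_vector_mult)
  then obtain H2 where H2: "mat x - H1 ** d2 = d3 ** H2" using matrix_factor by blast
  have a2: "d3 *v (H2 *v v) = x *s v - H1 *v (d2 *v v)" for v
    by (simp add: matrix_vector_mul_assoc H2[symmetric] matrix_vector_mult_diff_rdistrib mat_vector_mult)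
  have "d3 *v (H2 *v (d3 *v w)) = d3 *v (x *s w)" for w
    by (simp add: a2 z matrix_vector_mult_smult)
  then have "H2 ** d3 = mat x"
    by (simp add: d3_cancel matrix_eq matrix_vector_mul_assoc[symmetric] mat_vector_mult)
  then show ?thesis using that H0 H1 H2 by (metis add_diff_cancel_left' diff_add_cancel add.commute)
qed

lemma dual_homotopy:
  assumes "x \<in> annihilator s"
  shows "null_homotopic (transpose d1) (transpose d2) (transpose d3) x" "\<exists>l. transpose d3 ** l = mat x"
proof -
  obtain H0 H1 H2 where H: "d1 ** H0 = mat x" "H0 ** d1 + d2 ** H1 = mat x" "H1 ** d2 + d3 ** H2 = mat x"
    "H2 ** d3 = mat x" using annihilator_homotopy[OF assms] by blast
  have add: "transpose (A + B) = transpose A + transpose B" for A B :: "'a ^ 4 ^ 4"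
    by (simp add: transpose_def vec_eq_iff)
  have "transpose H0 ** transpose d1 = mat x"
    "transpose d1 ** transpose H0 + transpose H1 ** transpose d2 = mat x"
    "transpose d2 ** transpose H1 + transpose H2 ** transpose d3 = mat x"
    "transpose d3 ** transpose H2 = mat x"
    using H[THEN arg_cong[of _ _ transpose]] by (simp_all add: add matrix_transpose_mul)
  then show "null_homotopic (transpose d1) (transpose d2) (transpose d3) x" "\<exists>l. transpose d3 ** l = mat x"
    unfolding null_homotopic_def by blast+
qed

lemma dual_complex: "transpose d2 ** transpose d1 = 0" "transpose d3 ** transpose d2 = 0"
proof -
  have "transpose (0 :: 'a ^ 'i ^ 'j) = 0" by (simp add: transpose_def vec_eq_iff)
  then show "transpose d2 ** transpose d1 = 0" "transpose d3 ** transpose d2 = 0"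
    using d1d2 d2d3 by (simp_all add: matrix_transpose_mul[symmetric])
qed

text \<open>Four regular elements would make \<open>transpose d3\<close> surjective, although its
  entries lie in \<open>\<mm>\<close>.\<close>

lemma regular_sequence_annihilator_length:
  assumes xs: "regular_sequence xs" "set xs \<subseteq> annihilator s"
  shows "length xs \<le> 3"
proof (rule ccontr)
  assume "\<not> length xs \<le> 3"
  then have "exact_mod {0} (transpose d3) (0 :: 'a ^ 2 ^ 2)"
    using regular_mod_exact_3[OF dual_complex dual_homotopy(1), of "annihilator s" "{0}" xs] xs dual_homotopy(2)
    by (auto simp: regular_sequence_iff)
  then obtain u where u: "basis_vec 1 = transpose d3 *v u"
    unfolding exact_mod_zero by (metis matrix_vector_mult_0)
  have "vec_in \<mm> (transpose d3 *v u)"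
    using min(2) by (intro vec_in_matrix[OF \<mm>(1)]) (simp add: transpose_def)
  then have "(1 :: 'a) \<in> \<mm>" unfolding u[symmetric] by (simp add: vec_in_def axis_def) metis
  then show False using \<mm>(2) by simp
qed

lemma perfect_iff_grade: "perfect_module s \<longleftrightarrow> grade (annihilator s) = 3"
  unfolding perfect_module_def projective_dimension_eq_3[OF s \<mm> resolution] by auto

lemma perfectI:
  assumes "regular_sequence [x, y, z]" "{x, y, z} \<subseteq> minor_ideal d1"
  shows "perfect_module s"
  unfolding perfect_iff_grade
  using assms minor_ideal_annihilator
  by (intro grade_eq_3I[of "[x, y, z]"] regular_sequence_annihilator_length) auto

lemma minor_ideal_proper: "minor_ideal d1 \<noteq> UNIV"
  using minor_ideal_subset[OF \<mm>(1) min(1)] \<mm>(2) by blast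

lemma minors_of_transpose:
  assumes "ring_ideal J" "exact_mod J (0 :: 'a ^ 2 ^ 2) (transpose d1)"
  shows "faithful_mod J (minor_ideal d1)"
proof (rule minors_faithful_mod[OF assms])
  show "transpose d1 $ r $ 1 * transpose d1 $ t $ 2 - transpose d1 $ r $ 2 * transpose d1 $ t $ 1
      \<in> minor_ideal d1" for r t
    using minor2_in_minor_ideal[of d1 r t] by (simp add: minor2_eq transpose_def mult.commute)
qed

text \<open>Modulo any ideal, if \<open>d3\<close> is injective then so is
  \<open>d3 ** B = A ** transpose d1\<close>, hence \<open>transpose d1\<close>. Thus exactness of
  the resolution produces a regular sequence among the minors of \<open>d1\<close>.\<close>

lemma perfect_of_invertible:
  assumes comm: "d3 ** B = A ** transpose d1" and B: "invertible B"
  shows "perfect_module s"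
proof -
  obtain B' where B': "B' ** B = mat 1" using B unfolding invertible_def by blast
  have ex: "exact_mod {0} (0 :: 'a ^ 2 ^ 2) d3" "exact_mod {0} d3 d2" "exact_mod {0} d2 d1"
    unfolding exact_mod_zero using exact_1 exact_2 exact_3 by (auto intro: exI[of _ 0])
  have "\<exists>x y z. regular_sequence [x, y, z] \<and> {x, y, z} \<subseteq> minor_ideal d1"
  proof (rule regular_sequence_of_exact[OF noeth ring_ideal_minor_ideal minor_ideal_proper ex d2d3 d1d2])
    fix J :: "'a set" assume J: "ring_ideal J" and e: "exact_mod J (0 :: 'a ^ 2 ^ 2) d3"
    have "exact_mod J (0 :: 'a ^ 2 ^ 2) (transpose d1)"
      unfolding exact_mod_def
    proof (intro allI impI)
      fix v assume "vec_in J (transpose d1 *v v)"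
      then have "vec_in J (A *v (transpose d1 *v v))" by (rule vec_in_mult[OF J])
      then have "vec_in J (d3 *v (B *v v))" by (simp only: matrix_vector_mul_assoc comm)
      then have "vec_in J (B *v v)" using e unfolding exact_mod_def by auto
      then have "vec_in J (B' *v (B *v v))" by (rule vec_in_mult[OF J])
      then have "vec_in J v" by (simp add: matrix_vector_mul_assoc B')
      then show "\<exists>u. vec_in J (v - (0 :: 'a ^ 2 ^ 2) *v u)" by simp
    qed
    then show "faithful_mod J (minor_ideal d1)" by (rule minors_of_transpose[OF J])
  qed
  then show ?thesis using perfectI by blast
qed

text \<open>\<open>A\<close> and \<open>B\<close> complete a map from G to the resolution that is
  the identity on F0 and F1. Once G is exact there is a map \<open>\<beta>\<close> back, and the two
  compositions with \<open>A\<close> differ from the identity by matrices factoring through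
  \<open>d3\<close> and \<open>transpose d1\<close>, which have entries in
  \<open>\<mm>\<close>.\<close>

lemma invertible_of_perfect:
  assumes perfect: "perfect_module s"
    and A: "d2 ** A = hodge4 (minor2 d1)" and comm: "d3 ** B = A ** transpose d1"
  shows "invertible A" "invertible B"
proof -
  define S where "S = hodge4 (minor2 d1)"
  obtain xs where xs: "regular_sequence xs" "set xs \<subseteq> annihilator s" "length xs \<ge> 3"
    using perfect unfolding perfect_iff_grade by (rule grade_eq_3_obtain)
  have reg: "regular_mod {0} xs" using xs(1) by (simp add: regular_sequence_iff)
  note dual = dual_complex dual_homotopy(1)
  have ex: "exact_mod {0} (0 :: 'a ^ 2 ^ 2) (transpose d1)" "exact_mod {0} (transpose d1) (transpose d2)"
    "exact_mod {0} (transpose d2) (transpose d3)"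
    using regular_mod_exact_0[OF dual _ reg xs(2)] regular_mod_exact_1[OF dual _ reg xs(2)]
      regular_mod_exact_2[OF dual _ reg xs(2)] xs(3) by auto
  \<comment> \<open>The exact dual complex starts with \<open>transpose d1\<close>, so the regular
    sequence can be moved from the annihilator into the ideal of minors; there the explicit
    homotopies of G apply.\<close>
  obtain x y z where r: "regular_sequence [x, y, z]" "{x, y, z} \<subseteq> minor_ideal d1"
    using regular_sequence_of_exact[OF noeth ring_ideal_minor_ideal minor_ideal_proper ex dual_complex
      minors_of_transpose] by blast
  have r': "regular_mod {0} [x, y, z]" "set [x, y, z] \<subseteq> minor_ideal d1"
    using r by (simp_all only: regular_sequence_iff list.set)
  have S_d1: "S ** transpose d1 = 0" by (simp add: S_def hodge4_minor2_transpose)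
  have d1_S: "d1 ** S = 0" by (simp add: S_def A[symmetric] matrix_mul_assoc d1d2)
  note br = S_d1 d1_S cramer_null_homotopic[of _ d1, folded S_def]
  have S1: "\<exists>u. v = transpose d1 *v u" if "S *v v = 0" for v
    using regular_mod_exact_1[OF br _ r'] that by (simp add: exact_mod_zero)
  have S2: "\<exists>u. v = S *v u" if "d1 *v v = 0" for v
    using regular_mod_exact_2[OF br _ r'] that by (simp add: exact_mod_zero)
  have "\<exists>u. d2 *v v = S *v u" for v
    by (rule S2) (simp add: matrix_vector_mul_assoc d1d2)
  then obtain \<beta> where \<beta>: "d2 = S ** \<beta>" using matrix_factor by blast
  have diff: "M ** (N - L) = M ** N - M ** L" for M :: "'a ^ 'i ^ 'j" and N L :: "'a ^ 'k ^ 'i"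
    by (simp add: vec_eq_iff matrix_matrix_mult_def sum_subtractf algebra_simps)
  have S: "S = d2 ** A" by (simp add: S_def A)
  have "d2 ** (A ** \<beta> - mat 1) = 0"
    unfolding diff matrix_mul_assoc S[symmetric] \<beta>[symmetric] by simp
  then have "\<exists>u. (A ** \<beta> - mat 1) *v v = d3 *v u" for v
    unfolding exact_2[symmetric] by (simp add: matrix_vector_mul_assoc)
  then obtain \<gamma> where "A ** \<beta> - mat 1 = d3 ** \<gamma>" using matrix_factor by blast
  then have "A ** \<beta> = mat 1 + d3 ** \<gamma>" by (metis diff_add_cancel add.commute)
  then have "invertible (A ** \<beta>)" using invertible_one_plus[OF noeth loc min(2)] by simp
  then obtain R where R: "A ** \<beta> ** R = mat 1" unfolding invertible_def by blast
  have "S ** (\<beta> ** A - mat 1) = 0"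
    unfolding diff matrix_mul_assoc \<beta>[symmetric] S[symmetric] by simp
  then have "\<exists>u. (\<beta> ** A - mat 1) *v v = transpose d1 *v u" for v
    by (intro S1) (simp add: matrix_vector_mul_assoc)
  then obtain \<gamma>' where "\<beta> ** A - mat 1 = transpose d1 ** \<gamma>'" using matrix_factor by blast
  then have "\<beta> ** A = mat 1 + transpose d1 ** \<gamma>'" by (metis diff_add_cancel add.commute)
  moreover have "\<forall>i j. transpose d1 $ i $ j \<in> \<mm>" using min(1) by (simp add: transpose_def)
  ultimately have "invertible (\<beta> ** A)" using invertible_one_plus[OF noeth loc] by simp
  then obtain L where L: "L ** (\<beta> ** A) = mat 1" unfolding invertible_def by blast
  have RR: "A ** (\<beta> ** R) = mat 1" and LL: "(L ** \<beta>) ** A = mat 1"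
    using R L by (simp_all add: matrix_mul_assoc)
  have "L ** \<beta> = (L ** \<beta>) ** (A ** (\<beta> ** R))" unfolding RR by simp
  also have "\<dots> = \<beta> ** R" unfolding matrix_mul_assoc[of _ A] LL by simp
  finally show invA: "invertible A" using RR LL unfolding invertible_def by metis
  then obtain A' where A': "A ** A' = mat 1" unfolding invertible_def by blast
  \<comment> \<open>Surjectivity of \<open>B\<close>: \<open>A' (d3 v)\<close> is a cycle of G, so
    it is \<open>transpose d1 z\<close> for some \<open>z\<close>, and then
    \<open>d3 (B z) = d3 v\<close>.\<close>
  have "\<exists>w. mat 1 *v v = B *v w" for v
  proof -
    have AA: "A *v (A' *v (d3 *v v)) = d3 *v v"
      by (simp add: matrix_vector_mul_assoc matrix_mul_assoc A')
    have "S *v (A' *v (d3 *v v)) = d2 *v (A *v (A' *v (d3 *v v)))"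
      by (simp add: S matrix_vector_mul_assoc matrix_mul_assoc)
    also have "\<dots> = 0" unfolding AA by (simp add: matrix_vector_mul_assoc d2d3)
    finally obtain z where "A' *v (d3 *v v) = transpose d1 *v z" using S1 by blast
    then have "A *v (transpose d1 *v z) = d3 *v v" using AA by simp
    then have "d3 *v (B *v z) = d3 *v v" by (simp only: matrix_vector_mul_assoc comm)
    then have "v = B *v z" by (simp add: d3_cancel)
    then show ?thesis by (intro exI[of _ z]) simp
  qed
  then obtain B' where "mat 1 = B ** B'" using matrix_factor by blast
  then show "invertible B" using two_by_two_right_inverse by metis
qed

end

section \<open>Exterior powers in coordinates\<close>

lemma subspace_coord_sub: "module.subspace (*s) (coord_sub X :: ('a::comm_ring_1 ^ 'n) set)"
  by (simp add: module.subspace_def[OF module_vec] coord_sub_def)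

lemma basis_vec_in_coord_sub: "S \<in> X \<Longrightarrow> basis_vec S \<in> coord_sub X"
  by (auto simp: coord_sub_def axis_def)

lemma ext_vec_basis: "ext_vec (basis_vec i) = (basis_vec {i} :: 'a::comm_ring_1 ^ ('n::{finite,linorder} set))"
proof -
  have "ext_vec (basis_vec i) = (\<Sum>j\<in>UNIV. if i = j then basis_vec {j} else 0 :: 'a ^ ('n set))"
    unfolding ext_vec_def by (intro sum.cong) (auto simp: axis_def vec_eq_iff)
  then show ?thesis by simp
qed

lemma ext_mult_basis:
  "ext_mult (basis_vec A) (basis_vec B) =
    (if A \<inter> B = {} then ext_sign A B *s (basis_vec (A \<union> B) :: 'a::comm_ring_1 ^ ('n::{finite,linorder} set)) else 0)"
proof -
  have "ext_mult (basis_vec A) (basis_vec B) $ S =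
      (if A \<inter> B = {} \<and> S = A \<union> B then ext_sign A B else 0 :: 'a)" for S
  proof -
    have "ext_mult (basis_vec A) (basis_vec B) $ S =
        (\<Sum>C\<in>Pow S. ext_sign C (S - C) * basis_vec A $ C * basis_vec B $ (S - C) :: 'a)"
      by (simp only: ext_mult_def vec_lambda_beta)
    also have "\<dots> = (\<Sum>C\<in>Pow S. if C = A then (if S - A = B then ext_sign A B else 0) else 0 :: 'a)"
      by (intro sum.cong) (auto simp: axis_def)
    also have "\<dots> = (if A \<subseteq> S \<and> S - A = B then ext_sign A B else 0)"
      by simp
    also have "A \<subseteq> S \<and> S - A = B \<longleftrightarrow> A \<inter> B = {} \<and> S = A \<union> B" by blast
    finally show ?thesis .
  qed
  then show ?thesis by (auto simp: vec_eq_iff axis_def)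
qed

lemma ext_sign_empty: "ext_sign {i} {} = 1"
  by (simp add: ext_sign_def)

lemma ext_sign_insert:
  fixes i :: "'n::{finite,linorder}"
  assumes "x \<notin> S"
  shows "ext_sign {i} (insert x S) = (if x < i then - ext_sign {i} S else ext_sign {i} S)"
proof -
  have "{(a, b). a \<in> {i} \<and> b \<in> insert x S \<and> b < a} =
      (if x < i then insert (i, x) else id) {(a, b). a \<in> {i} \<and> b \<in> S \<and> b < a}"
    by auto
  moreover have "finite {(a, b). a \<in> {i} \<and> b \<in> S \<and> b < a}" by (rule finite)
  ultimately show ?thesis using assms by (simp add: ext_sign_def)
qed

lemma ext_mult_smult_right: "ext_mult \<omega> (c *s \<eta>) = c *s ext_mult \<omega> \<eta>"
  by (simp add: ext_mult_def vec_eq_iff sum_distrib_left mult.left_commute)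

lemma ext_mult_uminus_right: "ext_mult \<omega> (- \<eta>) = - ext_mult \<omega> \<eta>"
  by (simp add: ext_mult_def vec_eq_iff sum_negf)

lemma ext_mult_zero_right: "ext_mult \<omega> 0 = 0"
  by (simp add: ext_mult_def vec_eq_iff)

lemma ext_mult_add_left: "ext_mult (\<omega> + \<omega>') \<eta> = ext_mult \<omega> \<eta> + ext_mult \<omega>' \<eta>"
  by (simp add: ext_mult_def vec_eq_iff sum.distrib algebra_simps)

lemma ext_mult_smult_left: "ext_mult (c *s \<omega>) \<eta> = c *s ext_mult \<omega> \<eta>"
  by (simp add: ext_mult_def vec_eq_iff sum_distrib_left algebra_simps)

lemma ext_mult_basis_singleton:
  "ext_mult (basis_vec {i}) (basis_vec B) =
    (if i \<in> B then 0 else ext_sign {i} B *s (basis_vec (insert i B) :: 'a::comm_ring_1 ^ ('n::{finite,linorder} set)))"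
  by (simp add: ext_mult_basis)

lemma wedge_Cons_expand:
  "wedge (x # xs) = (\<Sum>k\<in>UNIV. x $ k *s wedge (basis_vec k # xs))"
proof -
  have lin: "linear_on (*s) (*s) UNIV (\<lambda>\<omega>. ext_mult \<omega> (wedge xs))"
    by (simp add: linear_on_def ext_mult_add_left ext_mult_smult_left)
  have "wedge (x # xs) = ext_mult (\<Sum>k\<in>UNIV. x $ k *s basis_vec {k}) (wedge xs)"
    by (simp add: wedge_def ext_vec_def)
  also have "\<dots> = (\<Sum>k\<in>UNIV. x $ k *s ext_mult (basis_vec {k}) (wedge xs))"
    by (rule linear_on_sum[OF module_vec module_vec lin subspace_UNIV[OF module_vec]]) simp
  finally show ?thesis by (simp add: wedge_def ext_vec_basis)
qed

lemma less_4:
  "(4::4) < 1" "(4::4) < 2" "(4::4) < 3" "(1::4) < 2" "(1::4) < 3" "(2::4) < 3"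
  "\<not> (1::4) < 4" "\<not> (2::4) < 4" "\<not> (3::4) < 4" "\<not> (2::4) < 1" "\<not> (3::4) < 1" "\<not> (3::4) < 2"
  by (simp_all add: less_bit0_def bit0.Rep_numeral bit0.Rep_1)

lemma less_2: "(2::2) < 1" "\<not> (1::2) < 2"
  by (simp_all add: less_bit0_def bit0.Rep_numeral bit0.Rep_1)

lemma wedge_Nil: "wedge [] = basis_vec {}" and wedge_basis_Cons:
  "wedge (basis_vec i # xs) = ext_mult (basis_vec {i}) (wedge xs)"
  by (simp_all add: wedge_def ext_vec_basis)

lemmas wedge_simps = wedge_Nil wedge_basis_Cons ext_mult_basis_singleton ext_mult_smult_right
  ext_mult_uminus_right ext_mult_zero_right ext_sign_empty ext_sign_insert less_4 less_2

lemma compl_singleton_4: "- {1::4} = {2, 3, 4}" "- {2::4} = {1, 3, 4}" "- {3::4} = {1, 2, 4}" "- {4::4} = {1, 2, 3}"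
  using exhaust_4 by auto

text \<open>
  The signs are chosen such that the product of the \<open>a\<close>-th basis vector with \<open>trivector a\<close>
  is \<open>volume\<close>.
\<close>

definition trivector :: "4 \<Rightarrow> 'a::comm_ring_1 ^ (4 set)" where
  "trivector a = (if a = 1 \<or> a = 3 then 1 else - 1) *s basis_vec (- {a})"

lemma deg_4: "deg 4 = {UNIV :: 4 set}"
  using card_eq_UNIV_imp_eq_UNIV[of "_ :: 4 set"] by (auto simp: deg_def)

lemma deg_2: "deg 2 = {UNIV :: 2 set}"
  using card_eq_UNIV_imp_eq_UNIV[of "_ :: 2 set"] by (auto simp: deg_def)

definition volume :: "'a::comm_ring_1 ^ (4 set)" where
  "volume = wedge [basis_vec 1, basis_vec 2, basis_vec 3, basis_vec 4]"

text \<open>The sign arises since \<open>4 < 1\<close> in the type \<open>4\<close>; similarly \<open>2 < 1\<close> in the type \<open>2\<close>.\<close>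

lemma volume_eq: "volume = (- 1 :: 'a::comm_ring_1) *s basis_vec UNIV"
  unfolding volume_def UNIV_4 by (simp add: wedge_simps)

lemma volume_in_coord_sub: "volume \<in> coord_sub (deg 4)"
  unfolding volume_eq
  by (intro module.subspace_scale[OF module_vec subspace_coord_sub] basis_vec_in_coord_sub) (simp add: deg_4)

lemma wedge_2: "wedge [basis_vec 1, basis_vec (2 :: 2)] = (- 1 :: 'a::comm_ring_1) *s basis_vec UNIV"
  unfolding UNIV_2 by (simp add: wedge_simps)

lemma compl_in_deg_3: "- {a :: 4} \<in> deg 3"
  by (simp add: deg_def Compl_eq_Diff_UNIV card_Diff_singleton)

lemma trivector_in_coord_sub: "trivector a \<in> coord_sub (deg 3)"
  unfolding trivector_def
  by (intro module.subspace_scale[OF module_vec subspace_coord_sub] basis_vec_in_coord_sub compl_in_deg_3)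

text \<open>The coefficients of the product of the \<open>i\<close>-th and \<open>j\<close>-th basis
  vectors, antisymmetrised so that either order of the indices, and \<open>i = j\<close>, are
  covered.\<close>

definition unit_bivector :: "4 \<Rightarrow> 4 \<Rightarrow> 4 \<Rightarrow> 4 \<Rightarrow> 'a::comm_ring_1" where
  "unit_bivector i j p q = of_bool (p = i \<and> q = j) - of_bool (p = j \<and> q = i)"

lemma minor_comb_unit_bivector: "minor_comb d1 (unit_bivector i j) = minor2 d1 i j"
  using exhaust_4[of i] exhaust_4[of j]
  by (elim disjE) (simp_all add: minor_comb_def unit_bivector_def minor2_eq)

text \<open>So \<open>- hodge4 (unit_bivector i j)\<close> is the matrix, in the basis
  \<open>trivector\<close>, of multiplication by the \<open>i\<close>-th and \<open>j\<close>-th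
  basis vectors. All 64 index triples are checked.\<close>

lemma wedge_trivector:
  "wedge [basis_vec k, basis_vec i, basis_vec j] =
    (\<Sum>c\<in>UNIV. (- hodge4 (unit_bivector i j)) $ c $ k *s (trivector c :: 'a::comm_ring_1 ^ (4 set)))"
  using exhaust_4[of i] exhaust_4[of j] exhaust_4[of k]
  by (elim disjE) (simp_all add: wedge_simps trivector_def sum_4 hodge4_def unit_bivector_def vector_4
      compl_singleton_4 insert_commute)

lemma matrix_vector_basis: "(N *v basis_vec h) $ r = (N :: 'a::comm_ring_1 ^ 'n ^ 'm) $ r $ h"
  by (simp add: matrix_vector_mult_def axis_def if_distrib[of "\<lambda>y. _ * y"] cong: if_cong)

text \<open>Coordinates in a signed basis of \<open>coord_sub X\<close>: \<open>\<phi>\<close> and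
  \<open>\<psi>\<close> below are the inverse coordinate isomorphisms. The signs allow for bases
  such as \<open>trivector\<close> and \<open>volume\<close>.\<close>

lemma invertible_map_basis:
  fixes f :: "'a::comm_ring_1 ^ 'm \<Rightarrow> 'a ^ 'r" and b :: "'n::finite \<Rightarrow> 'm"
  assumes f: "linear_on (*s) (*s) (coord_sub X) f" and b: "inj b" "range b = X" and \<sigma>: "\<And>i. \<sigma> i * \<sigma> i = 1"
  shows "invertible_map (coord_sub X) UNIV f \<longleftrightarrow>
    invertible (\<chi> r i. f (\<sigma> i *s basis_vec (b i)) $ r)" (is "_ \<longleftrightarrow> invertible ?M")
proof -
  define \<phi> where "\<phi> v = (\<Sum>i\<in>UNIV. v $ i *s (\<sigma> i *s basis_vec (b i)))" for v :: "'a ^ 'n"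
  define \<psi> where "\<psi> z = (\<chi> i. \<sigma> i * z $ b i)" for z :: "'a ^ 'm"
  note sub = subspace_coord_sub[of X]
  have gen: "\<sigma> i *s basis_vec (b i) \<in> coord_sub X" for i
    using b(2) by (intro module.subspace_scale[OF module_vec sub] basis_vec_in_coord_sub) auto
  have \<phi>_in: "\<phi> v \<in> coord_sub X" for v
    unfolding \<phi>_def by (intro module.subspace_sum[OF module_vec sub] module.subspace_scale[OF module_vec sub] gen)
  have \<phi>_b: "\<phi> v $ b j = \<sigma> j * v $ j" for v j
  proof -
    have "\<phi> v $ b j = (\<Sum>i\<in>UNIV. v $ i * (\<sigma> i * basis_vec (b i) $ b j))"
      by (simp add: \<phi>_def mult.assoc)
    also have "\<dots> = (\<Sum>i\<in>UNIV. if i = j then \<sigma> j * v $ j else 0)"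
      by (intro sum.cong) (auto simp: axis_def inj_eq[OF b(1)])
    finally have "\<phi> v $ b j = (\<Sum>i\<in>UNIV. if i = j then \<sigma> j * v $ j else 0)" .
    then show ?thesis by simp
  qed
  have \<psi>\<phi>: "\<psi> (\<phi> v) = v" for v
    by (simp add: \<psi>_def \<phi>_b vec_eq_iff mult.assoc[symmetric] \<sigma>)
  have \<phi>\<psi>: "\<phi> (\<psi> z) = z" if "z \<in> coord_sub X" for z
  proof (simp only: vec_eq_iff, intro allI)
    fix x
    show "\<phi> (\<psi> z) $ x = z $ x"
    proof (cases "x \<in> X")
      case True
      then obtain j where "x = b j" using b(2) by blast
      then show ?thesis by (simp add: \<phi>_b \<psi>_def mult.assoc[symmetric] \<sigma>)
    next
      case False
      then show ?thesis using \<phi>_in[of "\<psi> z"] that by (simp add: coord_sub_def)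
    qed
  qed
  have f\<phi>: "f (\<phi> v) = ?M *v v" for v
    unfolding \<phi>_def linear_on_sum[OF module_vec module_vec f sub gen]
    by (simp add: vec_eq_iff matrix_vector_mult_def mult.commute)
  have \<phi>_lin: "linear_on (*s) (*s) UNIV \<phi>"
    by (simp add: linear_on_def \<phi>_def vec_eq_iff distrib_right sum.distrib sum_distrib_left mult.assoc)
  have \<psi>_lin: "linear_on (*s) (*s) UNIV \<psi>"
    by (simp add: linear_on_def \<psi>_def vec_eq_iff algebra_simps)
  show ?thesis
  proof
    assume "invertible_map (coord_sub X) UNIV f"
    then obtain g where g: "linear_on (*s) (*s) UNIV g" "g ` UNIV \<subseteq> coord_sub X"
      "\<And>x. x \<in> coord_sub X \<Longrightarrow> g (f x) = x" "\<And>y. f (g y) = y"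
      unfolding invertible_map_def by blast
    have lin: "linear_on (*s) (*s) UNIV (\<lambda>y. \<psi> (g y))"
      by (rule linear_on_compose[OF g(1) \<psi>_lin subset_UNIV])
    define M' where "M' = (\<chi> i r. \<psi> (g (basis_vec r)) $ i)"
    have M': "M' *v y = \<psi> (g y)" for y
      unfolding linear_on_vec_eq_sum[OF module_vec lin, of y]
      by (simp add: M'_def vec_eq_iff matrix_vector_mult_def mult.commute)
    have "?M *v (M' *v y) = y" for y
    proof -
      have "g y \<in> coord_sub X" using g(2) by blast
      then show ?thesis unfolding M' f\<phi>[symmetric] by (simp add: \<phi>\<psi> g(4))
    qed
    moreover have "M' *v (?M *v v) = v" for v
      unfolding M' f\<phi>[symmetric] by (simp add: g(3)[OF \<phi>_in] \<psi>\<phi>)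
    ultimately have "?M ** M' = mat 1" "M' ** ?M = mat 1"
      by (simp_all add: matrix_eq matrix_vector_mul_assoc[symmetric])
    then show "invertible ?M" unfolding invertible_def by blast
  next
    assume "invertible ?M"
    then obtain M' where M': "?M ** M' = mat 1" "M' ** ?M = mat 1" unfolding invertible_def by blast
    have "linear_on (*s) (*s) UNIV (\<lambda>y. \<phi> (M' *v y))"
      by (rule linear_on_compose[OF linear_on_matrix \<phi>_lin subset_UNIV])
    moreover have "f (\<phi> (M' *v y)) = y" for y
      by (simp add: f\<phi> matrix_vector_mul_assoc M')
    moreover have "\<phi> (M' *v f x) = x" if "x \<in> coord_sub X" for x
    proof -
      have "f x = ?M *v \<psi> x" using f\<phi>[of "\<psi> x"] \<phi>\<psi>[OF that] by simp
      then show ?thesis by (simp add: matrix_vector_mul_assoc M' \<phi>\<psi>[OF that])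
    qed
    ultimately show "invertible_map (coord_sub X) UNIV f"
      unfolding invertible_map_def using f \<phi>_in
      by (intro conjI exI[of _ "\<lambda>y. \<phi> (M' *v y)"]) auto
  qed
qed

section \<open>Matrices of the structure maps\<close>

definition matrix_31 :: "('a::comm_ring_1 ^ (4 set) \<Rightarrow> 'a ^ 4) \<Rightarrow> 'a ^ 4 ^ 4" where
  "matrix_31 w31 = (\<chi> r c. w31 (trivector c) $ r)"

definition matrix_11 :: "('a::comm_ring_1 ^ (4 set) \<Rightarrow> 'a ^ (2 \<times> 2)) \<Rightarrow> 'a ^ 2 ^ 2" where
  "matrix_11 w11 = (\<chi> r j. w11 volume $ (j, r))"

definition matrix_21 :: "('a::comm_ring_1 ^ (4 set \<times> 4) \<Rightarrow> 'a ^ 2) \<Rightarrow> 4 \<Rightarrow> 4 \<Rightarrow> 'a ^ 4 ^ 2" where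
  "matrix_21 w21 i j = (\<chi> r h. w21 (tensor (wedge [basis_vec i, basis_vec j]) (basis_vec h)) $ r)"

text \<open>The sign makes the entries coefficients of
  \<open>wedge [basis_vec 1, basis_vec 2]\<close>, which is minus the basis vector at
  \<open>UNIV\<close>.\<close>

definition matrix_221 :: "('a::comm_ring_1 ^ (4 set \<times> 4 \<times> 4) \<Rightarrow> 'a ^ (2 set)) \<Rightarrow> 'a ^ 4 ^ 4" where
  "matrix_221 w221 = (\<chi> k h. - w221 (tensor volume (tensor (basis_vec k) (basis_vec h))) $ UNIV)"

context
  fixes d1 :: "'a::comm_ring_1 ^ 4 ^ 2" and d2 :: "'a ^ 4 ^ 4" and w31 :: "'a ^ (4 set) \<Rightarrow> 'a ^ 4"
  assumes w31: "structure_map_3_1 d1 d2 w31"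
begin

lemma w31_linear: "linear_on (*s) (*s) (coord_sub (deg 3)) w31"
  using w31 by (simp add: structure_map_3_1_def)

lemma w31_wedge_basis:
  "w31 (wedge [basis_vec k, basis_vec i, basis_vec j]) =
    matrix_31 w31 *v ((- hodge4 (unit_bivector i j)) *v basis_vec k)"
  unfolding wedge_trivector
    linear_on_sum[OF module_vec module_vec w31_linear subspace_coord_sub trivector_in_coord_sub]
  by (simp only: vec_eq_iff matrix_vector_mult_def[of "matrix_31 w31"] vec_lambda_beta matrix_vector_basis)
     (simp add: matrix_31_def mult.commute)

lemma wedge_basis_3_in_coord_sub:
  "wedge [basis_vec k, basis_vec i, basis_vec j] \<in> coord_sub (deg 3 :: 4 set set)"
  unfolding wedge_trivector
  by (intro module.subspace_sum[OF module_vec subspace_coord_sub]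
      module.subspace_scale[OF module_vec subspace_coord_sub] trivector_in_coord_sub)

lemma w31_wedge:
  "w31 (wedge [x, basis_vec i, basis_vec j]) =
    matrix_31 w31 *v ((- hodge4 (unit_bivector i j)) *v x)"
proof -
  have lin: "linear_on (*s) (*s) UNIV (\<lambda>x. matrix_31 w31 *v ((- hodge4 (unit_bivector i j)) *v x))"
    by (rule linear_on_compose[OF linear_on_matrix linear_on_matrix subset_UNIV])
  have "w31 (wedge [x, basis_vec i, basis_vec j]) =
      (\<Sum>k\<in>UNIV. x $ k *s w31 (wedge [basis_vec k, basis_vec i, basis_vec j]))"
    unfolding wedge_Cons_expand[of x]
    by (rule linear_on_sum[OF module_vec module_vec w31_linear subspace_coord_sub wedge_basis_3_in_coord_sub])
  then show ?thesis unfolding w31_wedge_basis linear_on_vec_eq_sum[OF module_vec lin, of x] .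
qed

text \<open>This and \<open>d3_matrix_11\<close> are the commutative squares of the map from G to
  the resolution.\<close>

lemma d2_matrix_31: "d2 ** matrix_31 w31 = hodge4 (minor2 d1)"
proof -
  have m: "d2 *v w31 (wedge [basis_vec i, basis_vec j, basis_vec k]) =
      minor2 d1 i j *s basis_vec k - minor2 d1 i k *s basis_vec j + minor2 d1 j k *s basis_vec i" for i j k
    using w31 by (simp add: structure_map_3_1_def)
  have neg: "w31 (- 1 *s x) = - 1 *s w31 x" if "x \<in> coord_sub (deg 3)" for x
    using that w31_linear by (simp only: linear_on_def)
  have c: "basis_vec (- {a}) \<in> coord_sub (deg 3)" for a :: 4
    by (intro basis_vec_in_coord_sub compl_in_deg_3)
  have b: "basis_vec (- {1}) = wedge [basis_vec 2, basis_vec 3, basis_vec (4::4)]"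
    "basis_vec (- {2}) = wedge [basis_vec 1, basis_vec 3, basis_vec (4::4)]"
    "basis_vec (- {3}) = wedge [basis_vec 1, basis_vec 2, basis_vec (4::4)]"
    "basis_vec (- {4}) = wedge [basis_vec 1, basis_vec 2, basis_vec (3::4)]"
    unfolding compl_singleton_4 by (simp_all add: wedge_simps)
  have "w31 (trivector 1) = w31 (basis_vec (- {1}))" "w31 (trivector 2) = - 1 *s w31 (basis_vec (- {2}))"
    "w31 (trivector 3) = w31 (basis_vec (- {3}))" "w31 (trivector 4) = - 1 *s w31 (basis_vec (- {4}))"
    using neg[OF c] by (simp_all add: trivector_def)
  then have v: "d2 *v w31 (trivector 1) = minor2 d1 2 3 *s basis_vec 4 - minor2 d1 2 4 *s basis_vec 3 + minor2 d1 3 4 *s basis_vec 2"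
    "d2 *v w31 (trivector 2) = - 1 *s (minor2 d1 1 3 *s basis_vec 4 - minor2 d1 1 4 *s basis_vec 3 + minor2 d1 3 4 *s basis_vec 1)"
    "d2 *v w31 (trivector 3) = minor2 d1 1 2 *s basis_vec 4 - minor2 d1 1 4 *s basis_vec 2 + minor2 d1 2 4 *s basis_vec 1"
    "d2 *v w31 (trivector 4) = - 1 *s (minor2 d1 1 2 *s basis_vec 3 - minor2 d1 1 3 *s basis_vec 2 + minor2 d1 2 3 *s basis_vec 1)"
    by (simp_all only: matrix_vector_mult_smult b m)
  have e: "(d2 ** matrix_31 w31) $ r $ c = (d2 *v w31 (trivector c)) $ r" for r c
    by (simp add: matrix_matrix_mult_def matrix_vector_mult_def matrix_31_def)
  show ?thesis
    unfolding vec_eq_iff e forall_4 v by (simp add: hodge4_def vector_4 axis_def)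
qed

lemma d3_matrix_11:
  assumes w11: "structure_map_1_1 d1 d3 w31 w11"
  shows "d3 ** matrix_11 w11 = matrix_31 w31 ** transpose d1"
proof -
  have neg: "w31 (- 1 *s x) = - 1 *s w31 x" if "x \<in> coord_sub (deg 3)" for x
    using that w31_linear by (simp only: linear_on_def)
  have c: "basis_vec (- {a}) \<in> coord_sub (deg 3)" for a :: 4
    by (intro basis_vec_in_coord_sub compl_in_deg_3)
  have b: "basis_vec (- {1}) = wedge [basis_vec 2, basis_vec 3, basis_vec (4::4)]"
    "basis_vec (- {2}) = wedge [basis_vec 1, basis_vec 3, basis_vec (4::4)]"
    "basis_vec (- {3}) = wedge [basis_vec 1, basis_vec 2, basis_vec (4::4)]"
    "basis_vec (- {4}) = wedge [basis_vec 1, basis_vec 2, basis_vec (3::4)]"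
    unfolding compl_singleton_4 by (simp_all add: wedge_simps)
  have t: "w31 (trivector 1) = w31 (basis_vec (- {1}))" "w31 (trivector 2) = - 1 *s w31 (basis_vec (- {2}))"
    "w31 (trivector 3) = w31 (basis_vec (- {3}))" "w31 (trivector 4) = - 1 *s w31 (basis_vec (- {4}))"
    using neg[OF c] by (simp_all add: trivector_def)
  have "id_tensor d3 (w11 volume) =
      tensor (d1 *v basis_vec 1) (w31 (basis_vec (- {1})))
      - tensor (d1 *v basis_vec 2) (w31 (basis_vec (- {2})))
      + tensor (d1 *v basis_vec 3) (w31 (basis_vec (- {3})))
      - tensor (d1 *v basis_vec 4) (w31 (basis_vec (- {4})))"
    using w11 unfolding structure_map_1_1_def volume_def b by simp
  moreover have "(d3 ** matrix_11 w11) $ r $ j = id_tensor d3 (w11 volume) $ (j, r)" for r j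
    by (simp add: id_tensor_def tensor_def axis_def matrix_matrix_mult_def matrix_vector_mult_def
        matrix_11_def tensor_part_def if_distrib[of "\<lambda>y. y * _"] cong: if_cong)
  ultimately show ?thesis
    by (simp add: vec_eq_iff tensor_def matrix_vector_basis matrix_matrix_mult_def sum_4 transpose_def
        matrix_31_def t algebra_simps)
qed

text \<open>Thus \<open>w21\<close> completes the map sending \<open>x\<close> to
  \<open>w31 (wedge [x, basis_vec i, basis_vec j])\<close> to a null homotopy, at F2, of
  multiplication by \<open>minor2 d1 i j\<close>.\<close>

lemma d3_matrix_21:
  assumes w21: "structure_map_2_1 d1 d2 d3 w31 w21"
  shows "d3 ** matrix_21 w21 i j =
    mat (minor2 d1 i j) + matrix_31 w31 ** (hodge4 (unit_bivector i j) ** d2)"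
proof (simp only: vec_eq_iff, intro allI)
  fix r h
  let ?H = "hodge4 (unit_bivector i j)"
  have neg: "matrix_31 w31 *v ((- ?H) *v (d2 *v v)) = - ((matrix_31 w31 ** (?H ** d2)) *v v)" for v
    unfolding matrix_vector_mul_assoc[symmetric] by (simp add: vec_eq_iff matrix_vector_mult_def sum_negf)
  have "d3 *v w21 (tensor (wedge [basis_vec i, basis_vec j]) (basis_vec h)) =
      minor2 d1 i j *s basis_vec h - w31 (wedge [d2 *v basis_vec h, basis_vec i, basis_vec j])"
    using w21 by (simp add: structure_map_2_1_def)
  then have "d3 *v w21 (tensor (wedge [basis_vec i, basis_vec j]) (basis_vec h)) =
      minor2 d1 i j *s basis_vec h + (matrix_31 w31 ** (?H ** d2)) *v basis_vec h"
    by (simp only: w31_wedge neg diff_minus_eq_add)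
  moreover have "(d3 ** matrix_21 w21 i j) $ r $ h =
      (d3 *v w21 (tensor (wedge [basis_vec i, basis_vec j]) (basis_vec h))) $ r"
    by (simp add: matrix_matrix_mult_def matrix_vector_mult_def matrix_21_def)
  ultimately have "(d3 ** matrix_21 w21 i j) $ r $ h =
      minor2 d1 i j * basis_vec h $ r + (matrix_31 w31 ** (?H ** d2)) $ r $ h"
    by (simp only: vector_add_component vector_smult_component matrix_vector_basis)
  then show "(d3 ** matrix_21 w21 i j) $ r $ h = (mat (minor2 d1 i j) + matrix_31 w31 ** (?H ** d2)) $ r $ h"
    by (simp add: mat_def axis_def)
qed

end

section \<open>The structure maps\<close>

lemma matrix_scaled_identity_mult: "mat x ** N = (\<chi> i j. x * (N :: 'a::comm_ring_1 ^ 'n ^ 'm) $ i $ j)"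
  by (simp add: vec_eq_iff matrix_matrix_mult_def mat_def if_distrib[of "\<lambda>y. y * _"] cong: if_cong)

lemma matrix_mult_scaled_identity: "N ** mat x = (\<chi> i j. x * (N :: 'a::comm_ring_1 ^ 'n ^ 'm) $ i $ j)"
  by (simp add: vec_eq_iff matrix_matrix_mult_def mat_def if_distrib[of "\<lambda>y. _ * y"] mult.commute cong: if_cong)

definition rotation :: "'a::comm_ring_1 ^ 2 ^ 2" where
  "rotation = vector [vector [0, 1], vector [- 1, 0]]"

text \<open>\<open>rotation\<close> is the standard alternating form; this is where the determinant
  of \<open>w11\<close> comes from.\<close>

lemma rotation_congruence: "B ** (rotation ** transpose B) = mat (det B) ** rotation"
  by (simp add: rotation_def entries4 det_2 algebra_simps)

text \<open>
  The \<open>(p, q)\<close> coordinate of the right-hand side of the formula defining \<open>w221\<close>, for the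
  Buchsbaum-Rim complex in place of the given resolution: there \<open>w31\<close> and \<open>w11\<close> are the
  identity, and \<open>w21\<close> is given by the transpose of \<open>cramer\<close>.
\<close>

definition buchsbaum_rim_formula :: "'a::comm_ring_1 ^ 4 ^ 2 \<Rightarrow> 4 \<Rightarrow> 4 \<Rightarrow> 4 \<Rightarrow> 4 \<Rightarrow> 4 \<Rightarrow> 4 \<Rightarrow> 2 \<Rightarrow> 'a" where
  "buchsbaum_rim_formula d1 i j k l b p q =
    (- hodge4 (unit_bivector j k)) $ p $ i * cramer d1 (unit_bivector i l) $ b $ q
    - (- hodge4 (unit_bivector j l)) $ p $ i * cramer d1 (unit_bivector i k) $ b $ q
    + (- hodge4 (unit_bivector k l)) $ p $ i * cramer d1 (unit_bivector i j) $ b $ q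
    + of_bool (p = b) * (transpose d1 ** rotation) $ i $ q"

text \<open>The Klein four-group: one even permutation for each first entry, so that the product of
  the basis vectors is \<open>volume\<close> without a sign and every row of
  \<open>matrix_221\<close> is reached.\<close>

definition arrangements :: "(4 \<times> 4 \<times> 4 \<times> 4) set" where
  "arrangements = {(1, 2, 3, 4), (2, 1, 4, 3), (3, 4, 1, 2), (4, 3, 2, 1)}"

lemma arrangement_cases:
  assumes "(i, j, k, l) \<in> arrangements"
  obtains "i = 1 \<and> j = 2 \<and> k = 3 \<and> l = 4" | "i = 2 \<and> j = 1 \<and> k = 4 \<and> l = 3"
    | "i = 3 \<and> j = 4 \<and> k = 1 \<and> l = 2" | "i = 4 \<and> j = 3 \<and> k = 2 \<and> l = 1"
  using assms by (simp add: arrangements_def) metis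

lemma arrangement_distinct: "(i, j, k, l) \<in> arrangements \<Longrightarrow> distinct [i, j, k, l]"
  by (erule arrangement_cases) simp_all

lemma arrangement_volume:
  assumes "(i, j, k, l) \<in> arrangements"
  shows "wedge [basis_vec i, basis_vec j, basis_vec k, basis_vec l] = (volume :: 'a::comm_ring_1 ^ (4 set))"
  using assms by (rule arrangement_cases) (simp_all add: volume_def wedge_simps insert_commute)

text \<open>\<open>transpose d1 ** rotation\<close> describes the injection of the second exterior
  power for G, as \<open>d3 ** rotation\<close> does for the resolution. So on G the pairing is the
  identity matrix.\<close>

lemma buchsbaum_rim_formula_eq:
  assumes "(i, j, k, l) \<in> arrangements"
  shows "buchsbaum_rim_formula d1 i j k l b p q = of_bool (i = b) * (transpose d1 ** rotation) $ p $ q"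
proof -
  note defs = buchsbaum_rim_formula_def hodge4_def cramer_def skew4_def unit_bivector_def rotation_def
    forall_4 forall_2 matrix_matrix_mult_def sum_4 sum_2 transpose_def vector_4
  have "\<forall>b p q. buchsbaum_rim_formula d1 i j k l b p q = of_bool (i = b) * (transpose d1 ** rotation) $ p $ q"
    using assms by (rule arrangement_cases) (simp_all add: defs)
  then show ?thesis by blast
qed

context format_2442
begin

context
  fixes w31 w21 w11 w221
  assumes w31: "structure_map_3_1 d1 d2 w31" and w21: "structure_map_2_1 d1 d2 d3 w31 w21"
    and w11: "structure_map_1_1 d1 d3 w31 w11" and w221: "structure_map_2_21 d1 d3 w31 w21 w11 w221"
begin

text \<open>Transported to G, \<open>w21\<close> becomes the component
  \<open>transpose (cramer d1 _)\<close> of the contraction there: both sides agree after the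
  injective map \<open>d3\<close>.\<close>

lemma matrix_21_eq:
  "matrix_21 w21 i j ** matrix_31 w31 = matrix_11 w11 ** transpose (cramer d1 (unit_bivector i j))"
proof -
  let ?A = "matrix_31 w31" and ?H = "hodge4 (unit_bivector i j)" and ?x = "minor2 d1 i j"
  have cl: "transpose d1 ** transpose (cramer d1 (unit_bivector i j)) = mat ?x + ?H ** hodge4 (minor2 d1)"
    using cramer_left_transpose[of d1 "unit_bivector i j"] by (simp add: minor_comb_unit_bivector algebra_simps)
  have "d3 ** (matrix_21 w21 i j ** ?A) = (mat ?x + ?A ** (?H ** d2)) ** ?A"
    by (simp add: matrix_mul_assoc d3_matrix_21[OF w31 w21])
  also have "\<dots> = mat ?x ** ?A + ?A ** (?H ** (d2 ** ?A))"
    by (simp add: vec_eq_iff matrix_mul_assoc matrix_matrix_mult_def[of "_ + _"] distrib_right sum.distrib)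
       (simp add: matrix_matrix_mult_def)
  also have "\<dots> = ?A ** (mat ?x + ?H ** hodge4 (minor2 d1))"
    by (simp add: d2_matrix_31[OF w31] matrix_add_ldistrib matrix_scaled_identity_mult matrix_mult_scaled_identity)
  also have "\<dots> = d3 ** (matrix_11 w11 ** transpose (cramer d1 (unit_bivector i j)))"
    by (simp add: cl[symmetric] matrix_mul_assoc d3_matrix_11[OF w31 w11])
  finally show ?thesis
    by (simp add: matrix_eq matrix_vector_mul_assoc[symmetric] d3_cancel)
qed

lemma w221_eq:
  "w221 (tensor volume (tensor (basis_vec k) (basis_vec h))) = matrix_221 w221 $ k $ h *s wedge [basis_vec 1, basis_vec 2]"
proof -
  let ?z = "tensor volume (tensor (basis_vec k) (basis_vec h)) :: 'a ^ (4 set \<times> 4 \<times> 4)"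
  have "?z \<in> coord_sub (deg 4 \<times> UNIV \<times> UNIV)"
    using volume_in_coord_sub[where 'a = 'a] by (auto simp: coord_sub_def tensor_def)
  then have "w221 ?z \<in> coord_sub (deg 2)"
    using w221 unfolding structure_map_2_21_def by blast
  then have "w221 ?z $ S = 0" if "S \<noteq> UNIV" for S
    using that by (simp add: coord_sub_def deg_2)
  then have "w221 ?z = w221 ?z $ UNIV *s basis_vec UNIV"
    by (simp add: vec_eq_iff axis_def)
  also have "\<dots> = matrix_221 w221 $ k $ h *s wedge [basis_vec 1, basis_vec 2]"
    unfolding wedge_2 matrix_221_def by (simp add: vec_eq_iff)
  finally show ?thesis .
qed

text \<open>The defining formula of \<open>w221\<close> in the coordinate \<open>(r, t)\<close>; the
  injection sends the generator of the second exterior power to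
  \<open>d3 ** rotation\<close>.\<close>

lemma matrix_221_formula:
  assumes ijkl: "distinct [i, j, k, l]"
    and vol: "wedge [basis_vec i, basis_vec j, basis_vec k, basis_vec l] = (volume :: 'a ^ (4 set))"
  shows "matrix_221 w221 $ i $ h * (d3 ** rotation) $ r $ t =
    (matrix_31 w31 *v ((- hodge4 (unit_bivector j k)) *v basis_vec i)) $ r * matrix_21 w21 i l $ t $ h
    - (matrix_31 w31 *v ((- hodge4 (unit_bivector j l)) *v basis_vec i)) $ r * matrix_21 w21 i k $ t $ h
    + (matrix_31 w31 *v ((- hodge4 (unit_bivector k l)) *v basis_vec i)) $ r * matrix_21 w21 i j $ t $ h
    + of_bool (r = h) * (matrix_11 w11 *v ((transpose d1 ** rotation) $ i)) $ t"
proof -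
  obtain \<iota> where \<iota>: "linear_on (*s) (*s) (coord_sub (deg 2)) \<iota>"
    "\<And>a b. \<iota> (wedge [a, b]) = tensor (d3 *v a) b - tensor (d3 *v b) a"
    and eq: "\<iota> (w221 (tensor volume (tensor (basis_vec i) (basis_vec h)))) =
             tensor (w31 (wedge [basis_vec i, basis_vec j, basis_vec k]))
                    (w21 (tensor (wedge [basis_vec i, basis_vec l]) (basis_vec h)))
           - tensor (w31 (wedge [basis_vec i, basis_vec j, basis_vec l]))
                    (w21 (tensor (wedge [basis_vec i, basis_vec k]) (basis_vec h)))
           + tensor (w31 (wedge [basis_vec i, basis_vec k, basis_vec l]))
                    (w21 (tensor (wedge [basis_vec i, basis_vec j]) (basis_vec h)))
           + tensor (basis_vec h) (wedge_tensor (d1 *v basis_vec i) (w11 volume))"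
    using w221 ijkl vol unfolding structure_map_2_21_def by metis
  have "wedge [basis_vec 1, basis_vec 2 :: 'a ^ 2] \<in> coord_sub (deg 2)"
    unfolding wedge_2
    by (intro module.subspace_scale[OF module_vec subspace_coord_sub] basis_vec_in_coord_sub) (simp add: deg_2)
  then have "\<iota> (w221 (tensor volume (tensor (basis_vec i) (basis_vec h)))) =
      matrix_221 w221 $ i $ h *s (tensor (d3 *v basis_vec 1) (basis_vec 2) - tensor (d3 *v basis_vec 2) (basis_vec 1))"
    unfolding w221_eq by (simp only: linear_onD(2)[OF \<iota>(1)] \<iota>(2))
  moreover have "(tensor (d3 *v basis_vec 1) (basis_vec 2) - tensor (d3 *v basis_vec 2) (basis_vec 1)) $ (r, t) =
      (d3 ** rotation) $ r $ t"
    using exhaust_2[of t]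
    by (elim disjE) (simp_all add: tensor_def matrix_vector_basis,
        simp_all add: axis_def rotation_def matrix_matrix_mult_def sum_2)
  ultimately have lhs: "\<iota> (w221 (tensor volume (tensor (basis_vec i) (basis_vec h)))) $ (r, t) =
      matrix_221 w221 $ i $ h * (d3 ** rotation) $ r $ t"
    by (simp only: vector_smult_component)
  have w: "wedge_tensor (d1 *v basis_vec i) (w11 volume) = matrix_11 w11 *v ((transpose d1 ** rotation) $ i)"
    by (simp add: wedge_tensor_def wedge_F0_def vec_eq_iff sum_2 matrix_vector_basis tensor_part_def)
      (simp add: axis_def matrix_vector_mult_def matrix_11_def rotation_def matrix_matrix_mult_def
        transpose_def sum_2 mult.commute)
  have h: "basis_vec h $ r = (of_bool (r = h) :: 'a)"
    by (simp add: axis_def)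
  show ?thesis
    unfolding lhs[symmetric] eq w w31_wedge_basis[OF w31]
    by (simp add: tensor_def matrix_21_def h)
qed

text \<open>Multiplying the formula by \<open>matrix_31 w31\<close> on the right turns it into the
  one for G, placed between \<open>matrix_31 w31\<close> and the transpose of
  \<open>matrix_11 w11\<close>. The comparison square and \<open>rotation_congruence\<close> then
  leave det(w11) times \<open>d3 ** rotation\<close>.\<close>

lemma matrix_221_inverse: "matrix_221 w221 ** matrix_31 w31 = mat (det (matrix_11 w11))"
proof -
  let ?W = "matrix_221 w221" and ?A = "matrix_31 w31" and ?B = "matrix_11 w11"
  have "(?W ** ?A) $ i $ b = of_bool (i = b) * det ?B" for i b
  proof -
    have "\<exists>j k l. (i, j, k, l) \<in> arrangements"
      using exhaust_4[of i] unfolding arrangements_def by blast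
    then obtain j k l where T: "(i, j, k, l) \<in> arrangements" by blast
    have key: "(?W ** ?A) $ i $ b * (d3 ** rotation) $ r $ t =
        of_bool (i = b) * det ?B * (d3 ** rotation) $ r $ t" for r t
    proof -
      define \<kappa> where "\<kappa> x y = ?A *v ((- hodge4 (unit_bivector x y)) *v basis_vec i)" for x y
      define \<theta> where "\<theta> = ?B *v ((transpose d1 ** rotation) $ i)"
      have T21: "(\<Sum>h\<in>UNIV. matrix_21 w21 x y $ t $ h * ?A $ h $ b) =
          (?B *v (cramer d1 (unit_bivector x y) $ b)) $ t" for x y
      proof -
        have "(\<Sum>h\<in>UNIV. matrix_21 w21 x y $ t $ h * ?A $ h $ b) = (matrix_21 w21 x y ** ?A) $ t $ b"
          by (simp add: matrix_matrix_mult_def)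
        then show ?thesis unfolding matrix_21_eq
          by (simp add: matrix_matrix_mult_def matrix_vector_mult_def transpose_def)
      qed
      have "(?W ** ?A) $ i $ b * (d3 ** rotation) $ r $ t =
          (\<Sum>h\<in>UNIV. (?W $ i $ h * (d3 ** rotation) $ r $ t) * ?A $ h $ b)"
        by (simp add: matrix_matrix_mult_def[of ?W] sum_distrib_left sum_distrib_right mult_ac)
      also have "\<dots> = (\<Sum>h\<in>UNIV. \<kappa> j k $ r * (matrix_21 w21 i l $ t $ h * ?A $ h $ b)
          - \<kappa> j l $ r * (matrix_21 w21 i k $ t $ h * ?A $ h $ b)
          + \<kappa> k l $ r * (matrix_21 w21 i j $ t $ h * ?A $ h $ b) + of_bool (r = h) * ?A $ h $ b * \<theta> $ t)"
        unfolding matrix_221_formula[OF arrangement_distinct[OF T] arrangement_volume[OF T]] \<kappa>_def[symmetric] \<theta>_def[symmetric]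
        by (intro sum.cong) (simp_all only: algebra_simps)
      also have "\<dots> = \<kappa> j k $ r * (?B *v (cramer d1 (unit_bivector i l) $ b)) $ t
          - \<kappa> j l $ r * (?B *v (cramer d1 (unit_bivector i k) $ b)) $ t
          + \<kappa> k l $ r * (?B *v (cramer d1 (unit_bivector i j) $ b)) $ t + ?A $ r $ b * \<theta> $ t"
        unfolding sum.distrib sum_subtractf sum_distrib_left[symmetric] T21
        by (simp add: of_bool_def if_distrib[of "\<lambda>y. y * _"] cong: if_cong)
      also have "\<dots> = (\<Sum>p\<in>UNIV. \<Sum>q\<in>UNIV. ?A $ r $ p * buchsbaum_rim_formula d1 i j k l b p q * ?B $ t $ q)"
      proof -
        have \<kappa>: "\<kappa> x y $ r = (\<Sum>p\<in>UNIV. ?A $ r $ p * (- hodge4 (unit_bivector x y)) $ p $ i)" for x y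
          unfolding \<kappa>_def matrix_vector_mult_def[of ?A] by (simp only: vec_lambda_beta matrix_vector_basis)
        have A: "?A $ r $ b = (\<Sum>p\<in>UNIV. ?A $ r $ p * of_bool (p = b))"
          by (simp add: of_bool_def if_distrib[of "\<lambda>y. _ * y"] cong: if_cong)
        show ?thesis
          unfolding \<kappa> A \<theta>_def matrix_vector_mult_def[of ?B] vec_lambda_beta buchsbaum_rim_formula_def
          by (simp only: sum_4 sum_2 algebra_simps)
      qed
      also have "\<dots> = of_bool (i = b) * (\<Sum>p\<in>UNIV. \<Sum>q\<in>UNIV. ?A $ r $ p * (transpose d1 ** rotation) $ p $ q * ?B $ t $ q)"
        unfolding buchsbaum_rim_formula_eq[OF T]
        by (simp only: sum_distrib_left) (simp only: mult_ac)
      also have "(\<Sum>p\<in>UNIV. \<Sum>q\<in>UNIV. ?A $ r $ p * (transpose d1 ** rotation) $ p $ q * ?B $ t $ q) =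
          (?A ** ((transpose d1 ** rotation) ** transpose ?B)) $ r $ t"
        by (simp add: matrix_matrix_mult_def[of ?A] matrix_matrix_mult_def[of "_ ** rotation"] transpose_def
            sum_distrib_left mult.assoc)
      also have "?A ** ((transpose d1 ** rotation) ** transpose ?B) = (d3 ** ?B) ** (rotation ** transpose ?B)"
        by (simp add: d3_matrix_11[OF w31 w11] matrix_mul_assoc)
      also have "\<dots> = d3 ** (mat (det ?B) ** rotation)"
        by (simp add: rotation_congruence matrix_mul_assoc[symmetric])
      also have "(d3 ** (mat (det ?B) ** rotation)) $ r $ t = det ?B * (d3 ** rotation) $ r $ t"
        by (simp add: matrix_scaled_identity_mult) (simp add: matrix_matrix_mult_def sum_distrib_left mult_ac)
      finally show ?thesis by (simp add: mult.assoc)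
    qed
    \<comment> \<open>By injectivity of \<open>d3\<close>, a scalar that kills the first column of
      \<open>d3\<close> is zero.\<close>
    define x where "x = (?W ** ?A) $ i $ b - of_bool (i = b) * det ?B"
    have "x * d3 $ r $ 1 = 0" for r
    proof -
      have "(d3 ** rotation) $ r $ 2 = d3 $ r $ 1"
        by (simp add: matrix_matrix_mult_def sum_2 rotation_def)
      then show ?thesis using key[of r 2] by (simp add: x_def left_diff_distrib)
    qed
    then have "d3 *v (x *s basis_vec 1) = 0"
      by (simp add: matrix_vector_mult_smult vec_eq_iff matrix_vector_basis)
    then have "x *s (basis_vec 1 :: 'a ^ 2) = 0" by (simp only: exact_3)
    then have "(x *s (basis_vec 1 :: 'a ^ 2)) $ 1 = 0" by (simp only: zero_index)
    then show ?thesis by (simp add: axis_def x_def)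
  qed
  then show ?thesis by (simp add: vec_eq_iff mat_def)
qed

lemma invertible_matrix_221:
  assumes A: "invertible (matrix_31 w31)" and B: "invertible (matrix_11 w11)"
  shows "invertible (transpose (matrix_221 w221))"
proof -
  let ?W = "matrix_221 w221" and ?A = "matrix_31 w31" and ?B = "matrix_11 w11"
  obtain A' where A': "?A ** A' = mat 1" "A' ** ?A = mat 1" using A unfolding invertible_def by blast
  obtain B' where "?B ** B' = mat 1" using B unfolding invertible_def by blast
  then have u: "det ?B * det B' = 1" by (metis det_mul det_I)
  have mat: "mat x ** mat y = (mat (x * y) :: 'a ^ 4 ^ 4)" for x y
    by (simp add: matrix_scaled_identity_mult vec_eq_iff) (simp add: mat_def)
  have "invertible (mat (det ?B) :: 'a ^ 4 ^ 4)"
    unfolding invertible_def using u by (intro exI[of _ "mat (det B')"]) (simp add: mat mult.commute)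
  moreover have "invertible A'" using A' unfolding invertible_def by blast
  ultimately have "invertible (mat (det ?B) ** A')" by (rule invertible_mult)
  also have "mat (det ?B) ** A' = ?W"
    unfolding matrix_221_inverse[symmetric] matrix_mul_assoc[symmetric] A' by simp
  finally obtain W' where "?W ** W' = mat 1" "W' ** ?W = mat 1" unfolding invertible_def by blast
  then have "transpose W' ** transpose ?W = mat 1" "transpose ?W ** transpose W' = mat 1"
    unfolding matrix_transpose_mul[symmetric] by simp_all
  then show ?thesis unfolding invertible_def by blast
qed

lemma invertible_map_31: "invertible_map (coord_sub (deg 3)) UNIV w31 \<longleftrightarrow> invertible (matrix_31 w31)"
proof -
  have "range (\<lambda>a :: 4. - {a}) = deg 3"
  proof (intro equalityI subsetI)
    fix S :: "4 set" assume "S \<in> deg 3"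
    then have "card (- S) = 1" 
      using card_Diff_subset[of S UNIV] by (simp add: deg_def flip: Compl_eq_Diff_UNIV)
    then obtain a where "- S = {a}" by (rule card_1_singletonE)
    then have "S = - {a}" by blast
    then show "S \<in> range (\<lambda>a. - {a})" by blast
  qed (use compl_in_deg_3 in blast)
  moreover have "inj (\<lambda>a :: 4. - {a})" by (auto intro: injI)
  ultimately show ?thesis
    unfolding matrix_31_def trivector_def
    by (intro invertible_map_basis w31_linear[OF w31]) auto
qed

lemma w11_linear: "linear_on (*s) (*s) (coord_sub (deg 4)) w11"
  using w11 by (simp add: structure_map_1_1_def)

lemma tensor_basis: "tensor (basis_vec a) (basis_vec b) = basis_vec (a, b)"
  by (auto simp: tensor_def vec_eq_iff axis_def)

lemma invertible_map_11:
  "invertible_map (coord_sub (UNIV \<times> deg 4)) UNIV (adjoint_1_1 w11) \<longleftrightarrow> invertible (matrix_11 w11)"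
proof -
  let ?b = "\<lambda>j :: 2. (j, UNIV :: 4 set)"
  have part: "tensor_part z j \<in> coord_sub (deg 4)" if "z \<in> coord_sub (UNIV \<times> deg 4)" for z :: "'a ^ (2 \<times> 4 set)" and j
    using that by (simp add: coord_sub_def tensor_part_def)
  have add: "tensor_part (x + y) j = tensor_part x j + tensor_part y j"
    and smult: "tensor_part (c *s x) j = c *s tensor_part x j" for x y :: "'a ^ ('k::finite \<times> 'l::finite)" and c j
    by (simp_all add: tensor_part_def vec_eq_iff)
  have lin: "linear_on (*s) (*s) (coord_sub (UNIV \<times> deg 4)) (adjoint_1_1 w11)"
    using part by (simp add: linear_on_def adjoint_1_1_def add smult linear_onD[OF w11_linear] sum.distrib
        module.scale_sum_right[OF module_vec])
  have w0: "w11 0 = 0"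
    by (rule linear_on_zero[OF module_vec module_vec w11_linear]) (simp add: coord_sub_def)
  \<comment> \<open>The factor \<open>- 1\<close> turns the basis vector at \<open>UNIV\<close> into
    \<open>volume\<close>.\<close>
  have "adjoint_1_1 w11 (- 1 *s basis_vec (?b j)) = (\<chi> r. w11 volume $ (j, r))" for j
  proof -
    have "tensor_part (- 1 *s basis_vec (?b j)) i = (if i = j then volume else 0 :: 'a ^ (4 set))" for i
      by (auto simp: tensor_part_def volume_eq vec_eq_iff axis_def)
    then have "adjoint_1_1 w11 (- 1 *s basis_vec (?b j)) = (\<Sum>i\<in>UNIV. if i = j then tensor_part (w11 volume) i else 0)"
      unfolding adjoint_1_1_def by (intro sum.cong) (auto simp: w0 tensor_part_def vec_eq_iff)
    then show ?thesis by (simp add: tensor_part_def)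
  qed
  then have "matrix_11 w11 = (\<chi> r j. adjoint_1_1 w11 (- 1 *s basis_vec (?b j)) $ r)"
    by (simp add: matrix_11_def vec_eq_iff)
  moreover have "inj ?b" "range ?b = UNIV \<times> deg 4" by (auto intro: injI simp: deg_4)
  ultimately show ?thesis
    by (simp only:) (intro invertible_map_basis[OF lin]; simp)
qed

lemma invertible_map_221:
  "invertible_map (coord_sub (deg 4 \<times> UNIV \<times> deg 2)) UNIV (adjoint_2_21 w221) \<longleftrightarrow>
    invertible (transpose (matrix_221 w221))"
proof -
  let ?b = "\<lambda>k :: 4. (UNIV :: 4 set, k, UNIV :: 2 set)"
  have lin: "linear_on (*s) (*s) (coord_sub (deg 4 \<times> UNIV \<times> deg 2)) (adjoint_2_21 w221)"
    by (simp add: linear_on_def adjoint_2_21_def vec_eq_iff distrib_right sum.distrib sum_distrib_left mult.assoc)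
  have w: "linear_on (*s) (*s) (coord_sub (deg 4 \<times> UNIV \<times> UNIV)) w221"
    using w221 by (simp add: structure_map_2_21_def)
  \<comment> \<open>No sign here: the one in \<open>matrix_221\<close> cancels that of
    \<open>volume\<close>.\<close>
  have "adjoint_2_21 w221 (1 *s basis_vec (?b k)) $ h = matrix_221 w221 $ k $ h" for k h
  proof -
    let ?z = "tensor (basis_vec UNIV) (tensor (basis_vec k) (basis_vec h)) :: 'a ^ (4 set \<times> 4 \<times> 4)"
    have "?z \<in> coord_sub (deg 4 \<times> UNIV \<times> UNIV)"
      unfolding tensor_basis by (intro basis_vec_in_coord_sub) (simp add: deg_4)
    then have "w221 (- 1 *s ?z) = - 1 *s w221 ?z" by (rule linear_onD(2)[OF w])
    moreover have "tensor volume (tensor (basis_vec k) (basis_vec h)) = - 1 *s ?z"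
      by (simp add: volume_eq tensor_def vec_eq_iff)
    ultimately have "matrix_221 w221 $ k $ h = w221 ?z $ UNIV"
      by (simp add: matrix_221_def)
    moreover have "adjoint_2_21 w221 (1 *s basis_vec (?b k)) $ h = w221 ?z $ UNIV"
    proof -
      have "adjoint_2_21 w221 (1 *s basis_vec (?b k)) $ h =
          (\<Sum>i\<in>UNIV. (if i = k then 1 else 0) * w221 (tensor (basis_vec UNIV) (tensor (basis_vec i) (basis_vec h))) $ UNIV)"
        by (simp add: adjoint_2_21_def deg_4 deg_2 axis_def)
      also have "\<dots> = (\<Sum>i\<in>UNIV. if i = k then w221 ?z $ UNIV else 0)"
        by (intro sum.cong) auto
      finally show ?thesis by simp
    qed
    ultimately show ?thesis by simp
  qed
  then have "transpose (matrix_221 w221) = (\<chi> h k. adjoint_2_21 w221 (1 *s basis_vec (?b k)) $ h)"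
    by (simp add: transpose_def vec_eq_iff)
  moreover have "inj ?b" "range ?b = deg 4 \<times> UNIV \<times> deg 2" by (auto intro: injI simp: deg_4 deg_2)
  ultimately show ?thesis
    by (simp only:) (intro invertible_map_basis[OF lin]; simp)
qed

lemma perfect_iff_invertible:
  "perfect_module s \<longleftrightarrow> invertible (matrix_31 w31) \<and> invertible (matrix_11 w11)
     \<and> invertible (transpose (matrix_221 w221))"
proof
  assume perfect: "perfect_module s"
  note inv = invertible_of_perfect[OF perfect d2_matrix_31[OF w31] d3_matrix_11[OF w31 w11]]
  show "invertible (matrix_31 w31) \<and> invertible (matrix_11 w11) \<and> invertible (transpose (matrix_221 w221))"
    by (intro conjI inv invertible_matrix_221)
next
  assume "invertible (matrix_31 w31) \<and> invertible (matrix_11 w11) \<and> invertible (transpose (matrix_221 w221))"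
  then show "perfect_module s"
    by (intro perfect_of_invertible[OF d3_matrix_11[OF w31 w11]]) simp
qed

end

end

theorem theorem2p1:
  fixes \<mm> :: "'a::comm_ring_1 set"
    and t :: "'a \<Rightarrow> 'e::ab_group_add \<Rightarrow> 'e"
    and s :: "'a \<Rightarrow> 'm::ab_group_add \<Rightarrow> 'm"
    and \<pi> :: "'a ^ 2 \<Rightarrow> 'm"
    and d1 :: "'a ^ 4 ^ 2" and d2 :: "'a ^ 4 ^ 4" and d3 :: "'a ^ 2 ^ 4"
    and w31 :: "'a ^ (4 set) \<Rightarrow> 'a ^ 4"
    and w21 :: "'a ^ (4 set \<times> 4) \<Rightarrow> 'a ^ 2"
    and w11 :: "'a ^ (4 set) \<Rightarrow> 'a ^ (2 \<times> 2)"
    and w221 :: "'a ^ (4 set \<times> 4 \<times> 4) \<Rightarrow> 'a ^ (2 set)"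
  assumes "gorenstein_local_ring t \<mm>"
    and "infinite (residue_ring \<mm>)"
    and "\<exists>h::'a. 2 * h = 1"
    and "module s"
    and "minimal_free_resolution_2442 \<mm> s \<pi> d1 d2 d3"
    and "structure_map_3_1 d1 d2 w31"
    and "structure_map_2_1 d1 d2 d3 w31 w21"
    and "structure_map_1_1 d1 d3 w31 w11"
    and "structure_map_2_21 d1 d3 w31 w21 w11 w221"
  shows "perfect_module s \<longleftrightarrow>
    invertible_map (coord_sub (deg 3)) UNIV w31 \<and>
    invertible_map (coord_sub (UNIV \<times> deg 4)) UNIV (adjoint_1_1 w11) \<and>
    invertible_map (coord_sub (deg 4 \<times> UNIV \<times> deg 2)) UNIV (adjoint_2_21 w221)"
proof -
  note gorenstein = assms(1)[unfolded gorenstein_local_ring_def]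
  interpret format_2442 \<mm> s \<pi> d1 d2 d3
    by (rule format_2442.intro[OF conjunct1[OF gorenstein] conjunct1[OF conjunct2[OF gorenstein]] assms(4,5)])
  show ?thesis
    unfolding perfect_iff_invertible[OF assms(6-9)] invertible_map_31[OF assms(6-9)]
      invertible_map_11[OF assms(6-9)] invertible_map_221[OF assms(6-9)] ..
qed

end
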